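(* Let $f\in\mathcal{O}_{\mathbb{C}^2,0}$, $f(0)=0$, be a (nonzero) function germ with Newton diagram $\Gamma\subset\mathbb{R}^2$ whose edges are $\gamma_1,\dots,\gamma_r$. (No non-degeneracy of $f$ with respect to $\Gamma$ is assumed.) Let $v''_1,\dots,v''_r$ be the order functions associated with $(\Gamma,f)$, and let $P_{\{v''_i\}}(\underline{t})$, $\underline{t}=(t_1,\dots,t_r)$, be the Poincaré series of the multi-index filtration they define. For $i=1,\dots,r$ let $\Gamma_i$ be the segment which is the translate of $\gamma_i$ having its two endpoints on the coordinate axes of $\mathbb{R}^2$, and let $\underline{M}_i=\underline{u}(\Gamma_i)=(u_1(\Gamma_i),\dots,u_r(\Gamma_i))$. Then $$P_{\{v''_i\}}(\underline{t})=\frac{\prod_{i=1}^r\left(1-\underline{t}^{\underline{M}_i}\right)}{\left(1-\underline{t}^{\underline{u}(x)}\right)\left(1-\underline{t}^{\underline{u}(y)}\right)}.$$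
   Context: $\mathcal{O}_{\mathbb{C}^2,0}$ is the ring of germs at $0$ of holomorphic functions in two variables $x,y$. For $\bar{k}=(k_x,k_y)$ write $\bar{x}^{\bar{k}}=x^{k_x}y^{k_y}$. Newton diagrams: for a nonzero $g=\sum a_{\bar{k}}\bar{x}^{\bar{k}}\in\mathcal{O}_{\mathbb{C}^2,0}$, its Newton polygon is the convex hull of $\bigcup_{a_{\bar{k}}\neq0}(\bar{k}+\mathbb{R}_{\ge0}^2)$, and its Newton diagram $\Gamma_g$ is the union of the compact faces (vertices and compact edges) of the Newton polygon. A Newton diagram in $\mathbb{R}^2$ is a set of the form $\Gamma_g$. Fix $f$ with Newton diagram $\Gamma=\Gamma_f$, with edges $\gamma_1,\dots,\gamma_r$, $r\ge1$. Let $\ell_i(\bar{k})=c_i$ be the reduced equation of the line containing $\gamma_i$: $\ell_i(\bar{k})=\ell_{i1}k_x+\ell_{i2}k_y$ with $\ell_{i1},\ell_{i2}$ positive integers and $\gcd(\ell_{i1},\ell_{i2})=1$. For $g=\sum_{\bar{k}\in\mathbb{Z}^2}a_{\bar{k}}\bar{x}^{\bar{k}}\in\mathcal{O}_{\mathbb{C}^2,0}[x^{-1},y^{-1}]$ put $u_i(g)=\min_{\bar{k}:a_{\bar{k}}\neq0}\ell_i(\bar{k})$ ($u_i(0)=+\infty$), and for a Newton diagram $\Lambda$ put $u_i(\Lambda)=\min_{\bar{k}\in\Lambda}\ell_i(\bar{k})$. Write $\underline{u}=(u_1,\dots,u_r)$; thus $\underline{u}(x)=(\ell_{11},\dots,\ell_{r1})$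 and $\underline{u}(y)=(\ell_{12},\dots,\ell_{r2})$. The order functions $v''_i:\mathcal{O}_{\mathbb{C}^2,0}\to\mathbb{Z}_{\ge0}\cup\{+\infty\}$ are $$v''_i(g)=\sup_{h\in\mathcal{O}_{\mathbb{C}^2,0}[x^{-1},y^{-1}]}u_i(g+hf),\qquad \underline{v}''=(v''_1,\dots,v''_r).$$ They induce functions on $\mathcal{O}_{\mathbb{C}^2,0}/(f)$, and the Poincaré series below is the same for $\mathcal{O}_{\mathbb{C}^2,0}$ and $\mathcal{O}_{\mathbb{C}^2,0}/(f)$. For $\underline{\upsilon}\in\mathbb{Z}^r$ let $J(\underline{\upsilon})=\{g\in\mathcal{O}_{\mathbb{C}^2,0}:\ v''_i(g)\ge\upsilon_i\text{ for all }i\}$. With $\underline{1}=(1,\dots,1)$ and $\underline{t}^{\underline{\upsilon}}=t_1^{\upsilon_1}\cdots t_r^{\upsilon_r}$, the Poincaré series is $$P_{\{v''_i\}}(\underline{t})=\frac{\left(\sum_{\underline{\upsilon}\in\mathbb{Z}^r}\dim_{\mathbb{C}}\big(J(\underline{\upsilon})/J(\underline{\upsilon}+\underline{1})\big)\,\underline{t}^{\underline{\upsilon}}\right)\prod_{i=1}^r(t_i-1)}{t_1t_2\cdots t_r-1}.$$ The numerator is understood as the formal product of the (possibly bi-infinite) series with the polynomial $\prod(t_i-1)$; it is a power series in $\mathbb{Z}[[t_1,\dots,t_r]]$, and the identity is an identity in $\mathbb{Z}[[t_1,\dots,t_r]]$. *)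

theory Defs
  imports
    "HOL-Analysis.Analysis"
    "HOL-Computational_Algebra.Formal_Laurent_Series"
    "HOL-Library.Poly_Mapping"
begin

section \<open>Germs of holomorphic functions in two variables\<close>

text \<open>
  A germ is identified with its expansion in the variables \<open>x\<close>, \<open>y\<close>, stored as an
  iterated Laurent series: \<open>y\<close> is the outer and \<open>x\<close> the inner variable.  The ring operations
  are those of the type \<^typ>\<open>complex fls fls\<close>.
\<close>

definition coeff2 :: "complex fls fls \<Rightarrow> int \<times> int \<Rightarrow> complex" where
  "coeff2 g k = fls_nth (fls_nth g (snd k)) (fst k)"

definition var_x :: "complex fls fls" where
  "var_x = fls_const fls_X"

definition var_y :: "complex fls fls" where
  "var_y = fls_X"

definition scale2 :: "complex \<Rightarrow> complex fls fls \<Rightarrow> complex fls fls" where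
  "scale2 c g = fls_const (fls_const c) * g"

definition holomorphic2_on :: "(complex \<times> complex \<Rightarrow> complex) \<Rightarrow> (complex \<times> complex) set \<Rightarrow> bool" where
  "holomorphic2_on F U \<longleftrightarrow>
     (\<forall>p\<in>U. \<exists>A B. (F has_derivative (\<lambda>v. A * fst v + B * snd v)) (at p))"

text \<open>The ring $\mathcal{O}_{\mathbb{C}^2,0}$: expansions at the origin of functions holomorphic
  in a neighbourhood of it.\<close>

definition hol_germs :: "complex fls fls set" where
  "hol_germs = {g. (\<forall>k. coeff2 g k \<noteq> 0 \<longrightarrow> 0 \<le> fst k \<and> 0 \<le> snd k) \<and>
     (\<exists>F U. open U \<and> (0, 0) \<in> U \<and> holomorphic2_on F U \<and>
        (\<forall>x y. (x, y) \<in> U \<longrightarrow>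
           ((\<lambda>(i, j). coeff2 g (int i, int j) * x ^ i * y ^ j) has_sum F (x, y)) UNIV))}"

text \<open>The ring $\mathcal{O}_{\mathbb{C}^2,0}[x^{-1},y^{-1}]$.\<close>

definition laurent_germs :: "complex fls fls set" where
  "laurent_germs = {g. \<exists>N. var_x ^ N * var_y ^ N * g \<in> hol_germs}"

section \<open>Newton polygons and weights\<close>

definition support2 :: "complex fls fls \<Rightarrow> (real \<times> real) set" where
  "support2 g = {(real_of_int a, real_of_int b) | a b. coeff2 g (a, b) \<noteq> 0}"

definition newton_polygon :: "complex fls fls \<Rightarrow> (real \<times> real) set" where
  "newton_polygon g =
     convex hull (\<Union>k\<in>support2 g. {k + q | q. 0 \<le> fst q \<and> 0 \<le> snd q})"

text \<open>
  The edges of the Newton diagram, which is the union of the compact faces of the Newton polygon.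
\<close>

definition newton_edges :: "complex fls fls \<Rightarrow> (real \<times> real) set set" where
  "newton_edges g = {e. e edge_of newton_polygon g \<and> compact e}"

definition linear_form :: "nat \<times> nat \<Rightarrow> real \<times> real \<Rightarrow> real" where
  "linear_form l k = real (fst l) * fst k + real (snd l) * snd k"

definition reduced_equation :: "(real \<times> real) set \<Rightarrow> nat \<times> nat \<Rightarrow> bool" where
  "reduced_equation e l \<longleftrightarrow> 0 < fst l \<and> 0 < snd l \<and> coprime (fst l) (snd l) \<and>
     (\<exists>c. affine hull e = {k. linear_form l k = c})"

definition axis_translate :: "(real \<times> real) set \<Rightarrow> (real \<times> real) set \<Rightarrow> bool" where
  "axis_translate e S \<longleftrightarrow> (\<exists>v. S = (\<lambda>k. v + k) ` e) \<and>
     (\<exists>a b. 0 \<le> a \<and> 0 \<le> b \<and> S = closed_segment (a, 0) (0, b))"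

text \<open>
  Used both for the support of a series (\<open>u\<^sub>i(g)\<close>, with value \<open>\<infinity>\<close> on the empty support of
  \<open>g = 0\<close>) and for Newton diagrams (\<open>u\<^sub>i(\<Lambda>)\<close>).
\<close>

definition min_weight :: "nat \<times> nat \<Rightarrow> (real \<times> real) set \<Rightarrow> ereal" where
  "min_weight l S = (INF k\<in>S. ereal (linear_form l k))"

text \<open>
  The vector of all \<open>u\<^sub>i\<close>.  It is only applied where the minimum is attained at a lattice point;
  the floor then merely changes the type of an integer.
\<close>

definition weight_vector :: "('i::finite \<Rightarrow> nat \<times> nat) \<Rightarrow> (real \<times> real) set \<Rightarrow> int ^ 'i" where
  "weight_vector l S = (\<chi> i. \<lfloor>real_of_ereal (min_weight (l i) S)\<rfloor>)"

section \<open>The order functions and their filtration\<close>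

definition order_fun :: "complex fls fls \<Rightarrow> nat \<times> nat \<Rightarrow> complex fls fls \<Rightarrow> ereal" where
  "order_fun f l g = (SUP h\<in>laurent_germs. min_weight l (support2 (g + h * f)))"

definition filtration ::
    "complex fls fls \<Rightarrow> ('i::finite \<Rightarrow> nat \<times> nat) \<Rightarrow> int ^ 'i \<Rightarrow> complex fls fls set" where
  "filtration f l v = {g \<in> hol_germs. \<forall>i. ereal (real_of_int (v $ i)) \<le> order_fun f (l i) g}"

text \<open>The classes of the elements of \<open>B\<close> are pairwise distinct and form a basis of \<open>V/W\<close>.\<close>

definition quotient_basis ::
    "complex fls fls set \<Rightarrow> complex fls fls set \<Rightarrow> complex fls fls set \<Rightarrow> bool" where
  "quotient_basis V W B \<longleftrightarrow> finite B \<and> B \<subseteq> V \<and>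
     (\<forall>g\<in>V. \<exists>!c. c \<in> B \<rightarrow>\<^sub>E UNIV \<and> g - (\<Sum>b\<in>B. scale2 (c b) b) \<in> W)"

definition quotient_dim :: "complex fls fls set \<Rightarrow> complex fls fls set \<Rightarrow> nat" where
  "quotient_dim V W = (THE n. \<exists>B. quotient_basis V W B \<and> card B = n)"

section \<open>Formal series in \<open>t\<^sub>i\<close>\<close>

text \<open>
  Possibly bi-infinite formal series are functions on the exponents \<^typ>\<open>int ^ 'i\<close>.  They form a
  module over the ring of Laurent polynomials \<^typ>\<open>(int ^ 'i) \<Rightarrow>\<^sub>0 int\<close>.
\<close>

type_synonym 'i series = "int ^ 'i \<Rightarrow> int"
type_synonym 'i lpoly = "(int ^ 'i) \<Rightarrow>\<^sub>0 int"

definition tpow :: "int ^ 'i::finite \<Rightarrow> 'i lpoly" where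
  "tpow v = Poly_Mapping.single v 1"

definition series_mult :: "'i::finite lpoly \<Rightarrow> 'i series \<Rightarrow> 'i series" where
  "series_mult p A = (\<lambda>w. \<Sum>v\<in>Poly_Mapping.keys p. Poly_Mapping.lookup p v * A (w - v))"

definition power_series :: "'i::finite series \<Rightarrow> bool" where
  "power_series A \<longleftrightarrow> (\<forall>v. A v \<noteq> 0 \<longrightarrow> 0 \<le> v)"

text \<open>
  The quotient \<open>A / p\<close> in the ring of power series, for a polynomial \<open>p\<close> with constant term
  \<open>\<plusminus>1\<close>.
\<close>

definition series_div :: "'i::finite series \<Rightarrow> 'i lpoly \<Rightarrow> 'i series" where
  "series_div A p = (THE C. power_series C \<and> series_mult p C = A)"

definition poincare_series ::
    "complex fls fls \<Rightarrow> ('i::finite \<Rightarrow> nat \<times> nat) \<Rightarrow> 'i series" where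
  "poincare_series f l = series_div
     (series_mult (\<Prod>i\<in>UNIV. tpow (axis i 1) - 1)
        (\<lambda>v. int (quotient_dim (filtration f l v) (filtration f l (v + 1)))))
     (tpow 1 - 1)"

end

(* The v''_i-filtration is compared with the monomial one, edge by edge.  Let h(v) be the
   codimension of J(v) in the ring of germs.  Up to a sign and the shift by (1,...,1), the Poincare
   series is the product of the t_i - 1 applied to the series of h.  If v''_i is replaced by the
   weight u_i for all i, then J(v) is spanned by monomials and the Poincare series is
   1 / ((1 - t^u(x)) (1 - t^u(y))).  Restore v''_j in place of u_j, going through the edges in
   the order of their slopes.  Up to a unit and terms of high weight, f agrees for u_j with a
   polynomial phi whose Newton diagram is Gamma_j, and phi has a monomial as leading form, of weight
   M_ji, for every other u_i.  If J and J' are the old and the new ideal and X is the intersection of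
   the conditions for i different from j, then J'(v) = J(v) + phi X(v - M_j) and
   J(v) Int phi X(v - M_j) = phi J(v - M_j).  Since X does not depend on v_j, its contribution is
   killed by t_j - 1, and the step multiplies the Poincare series by 1 - t^M_j.

   The decomposition of J' comes down to a statement on leading forms for u_j.  Along a line
   u_j = const, the leading forms of elements subject only to the conditions from the edges on one
   side of the j-th edge form an ideal of a polynomial ring in one variable that contains a power
   of the variable, hence a monomial ideal; the conditions from the other side are monomial.
   So divisibility by the edge polynomial can be read off the extreme monomials. *)
theory Submission
  imports Defs
begin

section \<open>Coefficients and Laurent polynomials\<close>

text \<open>The obstacle is that \<open>f\<close> need not factor along its edges in a usable way:
  it is a power series, its edge polynomials may have multiple roots, and the multipliers are
  Laurent germs. But all weights are positive, so a condition of bounded weight sees only finitely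
  many monomials. Hence \<phi> is needed only modulo weight v_j and may depend on v, multipliers can
  be cut down to Laurent polynomials and germs to polynomials; convergence matters only when the
  filtration of germs is compared with one of polynomials.

  The order of the edges matters because moving right along a line u_j = const raises every weight
  on the left. Far to the right the conditions from the left therefore hold automatically, which is
  where the power of the variable comes from, while the conditions from the right are still
  monomial.

  The decomposition is turned into numbers by J'(v)/J(v) = \<phi> X(v - M_j) / \<phi> J(v - M_j), so
  that h'(v) = h(v) - h(v - M_j) + codim X(v - M_j). The shift by (1,...,1) comes from dim J(v)/J(v
  + 1) = h(v + 1) - h(v), from which the division by t_1 ... t_r - 1 recovers h.\<close>

lemma coeff2_0 [simp]: "coeff2 0 k = 0"
  by (simp add: coeff2_def)

lemma coeff2_add [simp]: "coeff2 (g + h) k = coeff2 g k + coeff2 h k"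
  by (simp add: coeff2_def)

lemma coeff2_diff [simp]: "coeff2 (g - h) k = coeff2 g k - coeff2 h k"
  by (simp add: coeff2_def)

lemma coeff2_uminus [simp]: "coeff2 (- g) k = - coeff2 g k"
  by (simp add: coeff2_def)

lemma coeff2_scale2 [simp]: "coeff2 (scale2 c g) k = c * coeff2 g k"
  by (simp add: coeff2_def scale2_def)

lemma coeff2_sum: "coeff2 (\<Sum>x\<in>A. g x) k = (\<Sum>x\<in>A. coeff2 (g x) k)"
  by (simp add: coeff2_def fls_nth_sum)

lemma coeff2_eqI: "(\<And>k. coeff2 g k = coeff2 h k) \<Longrightarrow> g = h"
  unfolding coeff2_def by (intro fls_eqI) (metis fst_conv snd_conv)

definition mono2 :: "int \<times> int \<Rightarrow> complex fls fls" where
  "mono2 k = fls_const (fls_X_intpow (fst k)) * fls_X_intpow (snd k)"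

lemma coeff2_mono2_mult [simp]: "coeff2 (mono2 k * g) n = coeff2 g (n - k)"
proof -
  have "mono2 k * g = fls_const (fls_X_intpow (fst k)) * (fls_X_intpow (snd k) * g)"
    by (simp add: mono2_def mult.assoc)
  then show ?thesis
    by (simp add: coeff2_def fls_X_intpow_times_conv_shift)
qed

lemma coeff2_1: "coeff2 1 k = (if k = 0 then 1 else 0)"
  by (cases k) (auto simp: coeff2_def zero_prod_def)

lemma coeff2_mono2: "coeff2 (mono2 k) n = (if n = k then 1 else 0)"
  using coeff2_mono2_mult[of k 1 n] by (simp add: coeff2_1)

lemma mono2_0 [simp]: "mono2 0 = 1"
  by (simp add: mono2_def)

lemma mono2_add: "mono2 (a + b) = mono2 a * mono2 b"
  by (rule coeff2_eqI) (auto simp: coeff2_mono2 algebra_simps)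

lemma scale2_mult_left: "scale2 c g * h = scale2 c (g * h)"
  by (simp add: scale2_def mult.assoc)

lemma scale2_mult_right: "g * scale2 c h = scale2 c (g * h)"
  by (simp add: scale2_def algebra_simps)

interpretation scale2: vector_space scale2
  by unfold_locales
    (auto intro!: coeff2_eqI simp: algebra_simps)

text \<open>A coefficient of a product is a finite double sum, since exponents of \<open>y\<close>,
  and those of \<open>x\<close> for each power of \<open>y\<close>, are bounded below; if it is
  nonzero, so is a summand.\<close>

lemma coeff2_mult_nonzero:
  assumes "coeff2 (g * h) k \<noteq> 0"
  obtains a b where "coeff2 g a \<noteq> 0" "coeff2 h b \<noteq> 0" "k = a + b"
proof -
  define K where "K = {fls_subdegree g..snd k - fls_subdegree h}"
  have "(\<Sum>i\<in>K. fls_nth (fls_nth g i * fls_nth h (snd k - i)) (fst k)) \<noteq> 0"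
    using assms unfolding coeff2_def K_def by (simp add: fls_times_nth(2) fls_nth_sum)
  then obtain i where "fls_nth (fls_nth g i * fls_nth h (snd k - i)) (fst k) \<noteq> 0"
    by (meson sum.not_neutral_contains_not_neutral)
  then obtain j where "fls_nth (fls_nth g i) j * fls_nth (fls_nth h (snd k - i)) (fst k - j) \<noteq> 0"
    unfolding fls_times_nth(2) by (meson sum.not_neutral_contains_not_neutral)
  then show ?thesis
    by (intro that[of "(j, i)" "k - (j, i)"]) (auto simp: coeff2_def)
qed

definition supp :: "complex fls fls \<Rightarrow> (int \<times> int) set" where
  "supp g = {k. coeff2 g k \<noteq> 0}"

lemma supp_0 [simp]: "supp 0 = {}"
  by (simp add: supp_def)

lemma supp_add: "supp (g + h) \<subseteq> supp g \<union> supp h"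
  by (auto simp: supp_def)

lemma supp_diff: "supp (g - h) \<subseteq> supp g \<union> supp h"
  by (auto simp: supp_def)

lemma supp_scale2: "supp (scale2 c g) \<subseteq> supp g"
  by (auto simp: supp_def)

lemma supp_mono2 [simp]: "supp (mono2 k) = {k}"
  by (auto simp: supp_def coeff2_mono2)

lemma supp_mono2_mult: "supp (mono2 k * g) = (+) k ` supp g"
proof -
  have "n \<in> (+) k ` supp g" if "n - k \<in> supp g" for n
    using image_eqI[of n "(+) k" "n - k" "supp g"] that by simp
  then show ?thesis
    by (auto simp: supp_def)
qed

lemma supp_mult: "supp (g * h) \<subseteq> {a + b | a b. a \<in> supp g \<and> b \<in> supp h}"
  by (force simp: supp_def elim: coeff2_mult_nonzero)

text \<open>Meaningful only if \<open>S\<close> meets the support in a finite set; otherwise the value is \<open>0\<close>.\<close>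

definition restr :: "(int \<times> int) set \<Rightarrow> complex fls fls \<Rightarrow> complex fls fls" where
  "restr S g = (\<Sum>k\<in>S \<inter> supp g. scale2 (coeff2 g k) (mono2 k))"

lemma coeff2_restr:
  assumes "finite (S \<inter> supp g)"
  shows "coeff2 (restr S g) n = (if n \<in> S then coeff2 g n else 0)"
proof -
  have "coeff2 (restr S g) n = (\<Sum>k\<in>S \<inter> supp g. if n = k then coeff2 g k else 0)"
    unfolding restr_def coeff2_sum by (intro sum.cong) (auto simp: coeff2_mono2)
  also have "\<dots> = (if n \<in> S then coeff2 g n else 0)"
    using assms by (simp add: sum.delta supp_def)
  finally show ?thesis .
qed

lemma supp_restr: "finite (S \<inter> supp g) \<Longrightarrow> supp (restr S g) = S \<inter> supp g"
  by (auto simp: supp_def coeff2_restr)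

lemma supp_diff_restr: "finite (S \<inter> supp g) \<Longrightarrow> supp (g - restr S g) = supp g - S"
  by (auto simp: supp_def coeff2_restr)

definition lpolys :: "complex fls fls set" where
  "lpolys = {g. finite (supp g)}"

lemma restr_in_lpolys: "finite (S \<inter> supp g) \<Longrightarrow> restr S g \<in> lpolys"
  by (simp add: lpolys_def supp_restr)

lemma lpoly_finite: "g \<in> lpolys \<Longrightarrow> finite (S \<inter> supp g)"
  by (simp add: lpolys_def)

lemma lpoly_expansion:
  assumes "g \<in> lpolys"
  shows "g = (\<Sum>k\<in>supp g. scale2 (coeff2 g k) (mono2 k))"
proof -
  have "g = restr UNIV g"
    by (rule coeff2_eqI) (simp add: coeff2_restr[OF lpoly_finite[OF assms]])
  then show ?thesis
    by (simp add: restr_def)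
qed

lemma coeff2_lpoly_mult:
  assumes "g \<in> lpolys"
  shows "coeff2 (g * h) n = (\<Sum>k\<in>supp g. coeff2 g k * coeff2 h (n - k))"
proof -
  have "g * h = (\<Sum>k\<in>supp g. scale2 (coeff2 g k) (mono2 k * h))"
    by (subst lpoly_expansion[OF assms]) (simp add: sum_distrib_right scale2_mult_left)
  then show ?thesis
    by (simp add: coeff2_sum)
qed

lemma lpolys_0 [simp]: "0 \<in> lpolys"
  by (simp add: lpolys_def)

lemma lpolys_add [intro]: "g \<in> lpolys \<Longrightarrow> h \<in> lpolys \<Longrightarrow> g + h \<in> lpolys"
  unfolding lpolys_def using finite_subset[OF supp_add] by auto

lemma lpolys_diff [intro]: "g \<in> lpolys \<Longrightarrow> h \<in> lpolys \<Longrightarrow> g - h \<in> lpolys"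
  unfolding lpolys_def using finite_subset[OF supp_diff] by auto

lemma lpolys_scale2 [intro]: "g \<in> lpolys \<Longrightarrow> scale2 c g \<in> lpolys"
  unfolding lpolys_def using finite_subset[OF supp_scale2] by auto

lemma lpolys_mono2 [simp]: "mono2 k \<in> lpolys"
  by (simp add: lpolys_def)

lemma lpolys_mult [intro]:
  assumes "g \<in> lpolys" "h \<in> lpolys"
  shows "g * h \<in> lpolys"
proof -
  have "finite {a + b | a b. a \<in> supp g \<and> b \<in> supp h}"
    using assms by (intro finite_image_set2) (simp_all add: lpolys_def)
  then show ?thesis
    unfolding lpolys_def using finite_subset[OF supp_mult] by auto
qed

section \<open>Weights and the filtration by weight\<close>

definition wt :: "nat \<times> nat \<Rightarrow> int \<times> int \<Rightarrow> int" where
  "wt l k = int (fst l) * fst k + int (snd l) * snd k"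

lemma wt_0 [simp]: "wt l 0 = 0"
  by (simp add: wt_def)

lemma wt_add: "wt l (a + b) = wt l a + wt l b"
  by (simp add: wt_def algebra_simps)

lemma wt_diff: "wt l (a - b) = wt l a - wt l b"
  by (simp add: wt_def algebra_simps)

lemma wt_uminus: "wt l (- a) = - wt l a"
  by (simp add: wt_def)

lemma wt_nonneg: "0 \<le> k \<Longrightarrow> 0 \<le> wt l k"
  by (simp add: wt_def less_eq_prod_def)

text \<open>For \<open>k = k0 + (d, e)\<close> with nonnegative \<open>d\<close>, \<open>e\<close>
  and positive integer weights, both \<open>d\<close> and \<open>e\<close> are at most
  \<open>m - wt l k0\<close>. This makes parts of bounded weight finite for series that are not
  Laurent polynomials.\<close>

lemma finite_wt_le:
  assumes "0 < fst l" "0 < snd l"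
  shows "finite {k. k0 \<le> k \<and> wt l k \<le> m}"
proof -
  have *: "fst k0 \<le> fst k \<and> fst k \<le> fst k0 + (m - wt l k0) \<and>
      snd k0 \<le> snd k \<and> snd k \<le> snd k0 + (m - wt l k0)"
    if "k0 \<le> k" "wt l k \<le> m" for k
  proof -
    define d e where "d = fst k - fst k0" and "e = snd k - snd k0"
    have de: "0 \<le> d" "0 \<le> e" "fst k = fst k0 + d" "snd k = snd k0 + e"
      using that by (auto simp: less_eq_prod_def d_def e_def)
    have "1 * d \<le> int (fst l) * d" "1 * e \<le> int (snd l) * e"
      using assms de by (intro mult_right_mono; simp)+
    moreover have "wt l k = wt l k0 + int (fst l) * d + int (snd l) * e"
      by (simp add: wt_def d_def e_def algebra_simps)
    ultimately have "d \<le> m - wt l k0" "e \<le> m - wt l k0"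
      using that(2) de by linarith+
    then show ?thesis
      using de by simp
  qed
  show ?thesis
    by (rule finite_subset[of _ "{fst k0..fst k0 + (m - wt l k0)} \<times> {snd k0..snd k0 + (m - wt l k0)}"])
      (use * in \<open>auto simp: mem_Times_iff\<close>)
qed

text \<open>The condition u(g) \<ge> w without extended reals; the zero series satisfies it for
  every \<open>w\<close>, as u(0) = \<infinity> requires.\<close>

definition wfil :: "nat \<times> nat \<Rightarrow> int \<Rightarrow> complex fls fls set" where
  "wfil l w = {g. \<forall>k\<in>supp g. w \<le> wt l k}"

lemma wfilD: "g \<in> wfil l w \<Longrightarrow> k \<in> supp g \<Longrightarrow> w \<le> wt l k"
  by (simp add: wfil_def)

lemma wfil_coeff2: "g \<in> wfil l w \<Longrightarrow> wt l k < w \<Longrightarrow> coeff2 g k = 0"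
  using wfilD[of g l w k] by (auto simp: supp_def)

lemma wfil_0 [simp]: "0 \<in> wfil l w"
  by (simp add: wfil_def)

lemma wfil_add [intro]: "g \<in> wfil l w \<Longrightarrow> h \<in> wfil l w \<Longrightarrow> g + h \<in> wfil l w"
  using supp_add[of g h] by (auto simp: wfil_def)

lemma wfil_diff [intro]: "g \<in> wfil l w \<Longrightarrow> h \<in> wfil l w \<Longrightarrow> g - h \<in> wfil l w"
  using supp_diff[of g h] by (auto simp: wfil_def)

lemma wfil_scale2 [intro]: "g \<in> wfil l w \<Longrightarrow> scale2 c g \<in> wfil l w"
  using supp_scale2[of c g] by (auto simp: wfil_def)

lemma wfil_uminus [intro]: "g \<in> wfil l w \<Longrightarrow> - g \<in> wfil l w"
  by (auto simp: wfil_def supp_def)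

lemma subspace_wfil: "scale2.subspace (wfil l w)"
  by (auto simp: scale2.subspace_def)

lemma wfil_mono: "w' \<le> w \<Longrightarrow> wfil l w \<subseteq> wfil l w'"
  by (force simp: wfil_def)

lemma wfil_mult: "g \<in> wfil l w \<Longrightarrow> h \<in> wfil l w' \<Longrightarrow> g * h \<in> wfil l (w + w')"
proof -
  assume gh: "g \<in> wfil l w" "h \<in> wfil l w'"
  have "w + w' \<le> wt l k" if k: "k \<in> supp (g * h)" for k
  proof -
    obtain a b where "a \<in> supp g" "b \<in> supp h" "k = a + b"
      using k supp_mult[of g h] by blast
    then show ?thesis
      using gh by (simp add: wt_add wfilD add_mono)
  qed
  then show ?thesis
    by (simp add: wfil_def)
qed

lemma wfil_mono2: "w \<le> wt l k \<Longrightarrow> mono2 k \<in> wfil l w"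
  by (simp add: wfil_def)

text \<open>Lexicographic comparison of leading monomials: first the weight, then the power of \<open>x\<close>.\<close>

lemma wfil_mult_cancel:
  assumes l: "0 < fst l" "0 < snd l"
    and g: "g \<in> lpolys" and h: "h \<in> wfil l c" "h \<notin> wfil l (c + 1)" "\<forall>k\<in>supp h. k0 \<le> k"
    and gh: "g * h \<in> wfil l m"
  shows "g \<in> wfil l (m - c)"
proof (rule ccontr)
  assume neg: "g \<notin> wfil l (m - c)"
  define s where "s = Min (wt l ` supp g)"
  have ne: "supp g \<noteq> {}" and fin: "finite (supp g)"
    using neg g by (auto simp: wfil_def lpolys_def)
  have s_le: "s \<le> wt l k" if "k \<in> supp g" for k
    using that fin by (simp add: s_def)
  have "s \<in> wt l ` supp g"
    unfolding s_def using ne fin by (intro Min_in) auto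
  then have ne1: "{k \<in> supp g. wt l k = s} \<noteq> {}"
    by auto
  have s: "s < m - c"
    using neg s_le by (force simp: wfil_def)
  obtain a where a: "a \<in> supp g" "wt l a = s"
    and a_min: "\<And>k. k \<in> supp g \<Longrightarrow> wt l k = s \<Longrightarrow> fst a \<le> fst k"
    using ex_min_if_finite[of "fst ` {k \<in> supp g. wt l k = s}"] ne1 fin
    by auto (metis linorder_not_le)
  \<comment> \<open>Here \<open>h\<close> may be an infinite series such as \<open>f\<close>; the
    lower bound \<open>k0\<close> on its support makes the leading form finite.\<close>
  have fin2: "finite {k \<in> supp h. wt l k = c}"
    by (rule finite_subset[OF _ finite_wt_le[OF l, of k0 c]]) (use h(3) in auto)
  have "{k \<in> supp h. wt l k = c} \<noteq> {}"
    using h(1,2) unfolding wfil_def by force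
  then obtain b where b: "b \<in> supp h" "wt l b = c"
    and b_min: "\<And>k. k \<in> supp h \<Longrightarrow> wt l k = c \<Longrightarrow> fst b \<le> fst k"
    using ex_min_if_finite[of "fst ` {k \<in> supp h. wt l k = c}"] fin2
    by auto (metis linorder_not_le)
  have "coeff2 g k * coeff2 h (a + b - k) = 0" if k: "k \<in> supp g" "k \<noteq> a" for k
  proof (rule ccontr)
    assume "coeff2 g k * coeff2 h (a + b - k) \<noteq> 0"
    then have kb: "a + b - k \<in> supp h"
      by (auto simp: supp_def)
    have w: "c \<le> wt l (a + b - k)"
      using h(1) kb by (simp add: wfilD)
    have "wt l k = s" "wt l (a + b - k) = c"
      using w s_le[OF k(1)] a(2) b(2) by (simp_all add: wt_add wt_diff)
    then have "fst k = fst a"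
      using a_min[OF k(1)] b_min[OF kb] by simp
    moreover from this have "snd k = snd a"
      using \<open>wt l k = s\<close> a(2) l(2) unfolding wt_def by (metis add_left_cancel mult_cancel_left
          of_nat_0_less_iff order_less_irrefl)
    ultimately show False
      using k(2) by (simp add: prod_eq_iff)
  qed
  then have "coeff2 (g * h) (a + b) = (\<Sum>k\<in>supp g. if k = a then coeff2 g a * coeff2 h b else 0)"
    unfolding coeff2_lpoly_mult[OF g] by (intro sum.cong) auto
  also have "\<dots> = coeff2 g a * coeff2 h b"
    using a(1) fin by simp
  finally have "a + b \<in> supp (g * h)"
    using a(1) b(1) by (simp add: supp_def)
  then show False
    using wfilD[OF gh, of "a + b"] a(2) b(2) s by (simp add: wt_add)
qed

section \<open>Edges and order functions\<close>

text \<open>Polynomials replace the germs: the filtrations contain every germ of high weight, so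
  polynomials represent all classes in the quotients.\<close>

definition qpolys :: "complex fls fls set" where
  "qpolys = {g \<in> lpolys. \<forall>k\<in>supp g. 0 \<le> k}"

lemma qpolys_lpolys: "g \<in> qpolys \<Longrightarrow> g \<in> lpolys"
  by (simp add: qpolys_def)

lemma qpolys_0 [simp]: "0 \<in> qpolys"
  by (simp add: qpolys_def)

lemma qpolys_add: "g \<in> qpolys \<Longrightarrow> h \<in> qpolys \<Longrightarrow> g + h \<in> qpolys"
  using supp_add[of g h] by (auto simp: qpolys_def)

lemma qpolys_diff: "g \<in> qpolys \<Longrightarrow> h \<in> qpolys \<Longrightarrow> g - h \<in> qpolys"
  using supp_diff[of g h] by (auto simp: qpolys_def)

lemma qpolys_scale2: "g \<in> qpolys \<Longrightarrow> scale2 c g \<in> qpolys"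
  using supp_scale2[of c g] by (auto simp: qpolys_def)

lemma subspace_qpolys: "scale2.subspace qpolys"
  by (auto simp: scale2.subspace_def intro: qpolys_add qpolys_scale2)

lemma qpolys_mult:
  assumes "g \<in> qpolys" "h \<in> qpolys"
  shows "g * h \<in> qpolys"
proof -
  have "0 \<le> k" if k: "k \<in> supp (g * h)" for k
  proof -
    obtain a b where "a \<in> supp g" "b \<in> supp h" "k = a + b"
      using k supp_mult[of g h] by blast
    then show ?thesis
      using assms by (auto simp: qpolys_def less_eq_prod_def)
  qed
  then show ?thesis
    using assms by (auto simp: qpolys_def)
qed

lemma qpolys_wfil: "g \<in> qpolys \<Longrightarrow> g \<in> wfil l 0"
  by (auto simp: qpolys_def wfil_def intro: wt_nonneg)

lemma lpolys_bdd_below: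
  assumes "g \<in> lpolys"
  obtains k0 where "\<forall>k\<in>supp g. k0 \<le> k"
proof (cases "supp g = {}")
  case True
  then show thesis using that by auto
next
  case False
  show thesis
  proof (rule that[of "(Min (fst ` supp g), Min (snd ` supp g))"])
    show "\<forall>k\<in>supp g. (Min (fst ` supp g), Min (snd ` supp g)) \<le> k"
      using assms by (auto simp: less_eq_prod_def lpolys_def)
  qed
qed

lemma supp_mult_bdd_below:
  assumes "\<forall>k\<in>supp g. a \<le> k" "\<forall>k\<in>supp h. b \<le> k" "k \<in> supp (g * h)"
  shows "a + b \<le> k"
proof -
  obtain m n where "m \<in> supp g" "n \<in> supp h" "k = m + n"
    using assms(3) supp_mult[of g h] by blast
  then show ?thesis
    using assms(1,2) by (auto simp: less_eq_prod_def add_mono)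
qed

lemma wfil_diff_iff: "g - h \<in> wfil l w \<Longrightarrow> h \<in> wfil l w \<Longrightarrow> g \<in> wfil l w"
  using wfil_add[of "g - h" l w h] by simp

text \<open>
  For each index \<open>i\<close>, the part of \<open>f\<close> of minimal weight \<open>c i\<close> runs from
  \<open>s i + (0, q i)\<close> to \<open>s i + (p i, 0)\<close>.
\<close>

locale edge_data =
  fixes l :: "'i::finite \<Rightarrow> nat \<times> nat" and f :: "complex fls fls"
    and c p q :: "'i \<Rightarrow> int" and s :: "'i \<Rightarrow> int \<times> int"
  assumes fst_pos: "0 < fst (l i)" and snd_pos: "0 < snd (l i)"
    and distinct: "i \<noteq> j \<Longrightarrow> fst (l i) * snd (l j) \<noteq> fst (l j) * snd (l i)"
    and supp_f: "k \<in> supp f \<Longrightarrow> 0 \<le> k"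
    and f_wfil: "f \<in> wfil (l i) (c i)"
    and p_pos: "0 < p i" and q_pos: "0 < q i"
    and wt_left_end: "wt (l i) (s i + (0, q i)) = c i"
    and wt_right_end: "wt (l i) (s i + (p i, 0)) = c i"
    and left_end: "s i + (0, q i) \<in> supp f"
    and right_end: "s i + (p i, 0) \<in> supp f"
    and edge_ge: "k \<in> supp f \<Longrightarrow> wt (l i) k = c i \<Longrightarrow> s i \<le> k"
begin

text \<open>\<open>M j i\<close> is u_i of the segment from \<open>(p j, 0)\<close> to
  \<open>(0, q j)\<close>, as a linear form on a segment is least at an end.\<close>

definition M :: "'i \<Rightarrow> 'i \<Rightarrow> int" where
  "M j i = min (int (fst (l i)) * p j) (int (snd (l i)) * q j)"

definition edge_poly :: "'i \<Rightarrow> complex fls fls" where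
  "edge_poly j = mono2 (- s j) * restr {k. wt (l j) k = c j} f"

text \<open>The ratios of second to first weight are compared without fractions: a smaller ratio
  belongs to a steeper edge, nearer to the \<open>y\<close> axis.\<close>

definition left_of :: "'i \<Rightarrow> 'i \<Rightarrow> bool" where
  "left_of i j \<longleftrightarrow> fst (l j) * snd (l i) < fst (l i) * snd (l j)"

lemma left_of_cases: "i = j \<or> left_of i j \<or> left_of j i"
  using distinct[of i j] by (auto simp: left_of_def)

lemma left_of_irrefl: "\<not> left_of i i"
  by (simp add: left_of_def)

lemma left_of_asym: "left_of i j \<Longrightarrow> \<not> left_of j i"
  by (simp add: left_of_def)

definition det :: "'i \<Rightarrow> 'i \<Rightarrow> int" where
  "det i j = int (fst (l i)) * int (snd (l j)) - int (fst (l j)) * int (snd (l i))"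

lemma det_pos: "left_of i j \<Longrightarrow> 0 < det i j"
  unfolding left_of_def det_def by (metis of_nat_less_iff of_nat_mult diff_gt_0_iff_gt)

text \<open>Cramer's rule: along a line of constant \<open>j\<close>-weight the
  \<open>i\<close>-weight is affine in one exponent, and the sign of \<open>det i j\<close> gives
  the direction of growth.\<close>

lemma wt_det_fst: "int (snd (l j)) * wt (l i) d = int (snd (l i)) * wt (l j) d + det i j * fst d"
  by (simp add: wt_def det_def algebra_simps)

lemma wt_det_snd: "int (fst (l j)) * wt (l i) d = int (fst (l i)) * wt (l j) d - det i j * snd d"
  by (simp add: wt_def det_def algebra_simps)

lemma wt_eq_iff: "int (fst (l j)) * p j = int (snd (l j)) * q j"
  using wt_left_end[of j] wt_right_end[of j] by (simp add: wt_add) (simp add: wt_def)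

lemma M_self: "M j j = int (fst (l j)) * p j" "M j j = int (snd (l j)) * q j"
  using wt_eq_iff[of j] by (simp_all add: M_def)

lemma c_eq: "c j = wt (l j) (s j) + M j j"
  using wt_right_end[of j] by (simp add: wt_add M_self) (simp add: wt_def)

lemma M_self_pos: "0 < M j j"
  by (simp add: M_self fst_pos p_pos)

text \<open>Up to the positive factor \<open>fst (l j)\<close>, the \<open>i\<close>-weights of the
  ends \<open>(p j, 0)\<close> and \<open>(0, q j)\<close> differ by \<open>det i j * q j\<close>,
  so the side on which \<open>i\<close> lies decides which end attains the minimum.\<close>

lemma M_left: "left_of i j \<Longrightarrow> M j i = int (snd (l i)) * q j"
proof -
  assume "left_of i j"
  then have "0 \<le> det i j * q j"
    using det_pos q_pos[of j] by (simp add: less_imp_le)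
  also have "det i j * q j = int (fst (l j)) * (int (fst (l i)) * p j - int (snd (l i)) * q j)"
    using wt_eq_iff[of j] by (simp add: det_def algebra_simps)
  finally show ?thesis
    using fst_pos[of j] by (simp add: M_def zero_le_mult_iff)
qed

lemma M_right: "left_of j i \<Longrightarrow> M j i = int (fst (l i)) * p j"
proof -
  assume "left_of j i"
  then have "0 \<le> det j i * p j"
    using det_pos p_pos[of j] by (simp add: less_imp_le)
  also have "det j i * p j = int (snd (l j)) * (int (snd (l i)) * q j - int (fst (l i)) * p j)"
    using wt_eq_iff[of j] by (simp add: det_def algebra_simps)
  finally show ?thesis
    using snd_pos[of j] by (simp add: M_def zero_le_mult_iff)
qed

text \<open>The points of the quadrant on or above the line of the segment form its Newton polygon,
  where u_i is least at an end; the sign of \<open>det i j\<close> selects the end to compare with.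
  This bounds the other weights of \<phi> from below.\<close>

lemma M_le_wt:
  assumes "0 \<le> k" "M j j \<le> wt (l j) k"
  shows "M j i \<le> wt (l i) k"
proof -
  have k: "0 \<le> fst k" "0 \<le> snd k"
    using assms(1) by (auto simp: less_eq_prod_def)
  show ?thesis
  proof (cases "0 \<le> det i j")
    case True
    have "int (snd (l j)) * M j i \<le> int (snd (l j)) * (int (snd (l i)) * q j)"
      by (intro mult_left_mono) (simp_all add: M_def)
    also have "\<dots> = int (snd (l i)) * M j j"
      by (simp add: M_self(2))
    also have "\<dots> \<le> int (snd (l i)) * wt (l j) k + det i j * fst k"
      using assms(2) k True by (intro add_increasing2 mult_left_mono) simp_all
    finally show ?thesis
      using snd_pos[of j] by (simp add: wt_det_fst[symmetric])
  next
    case False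
    have "int (fst (l j)) * M j i \<le> int (fst (l j)) * (int (fst (l i)) * p j)"
      by (intro mult_left_mono) (simp_all add: M_def)
    also have "\<dots> = int (fst (l i)) * M j j"
      by (simp add: M_self(1))
    also have "\<dots> \<le> int (fst (l i)) * wt (l j) k + (- det i j) * snd k"
      using assms(2) k False by (intro add_increasing2 mult_left_mono mult_nonneg_nonneg) simp_all
    finally show ?thesis
      using fst_pos[of j] by (simp add: wt_det_snd[symmetric])
  qed
qed

lemma finite_supp_f: "finite ({k. wt (l j) k = m} \<inter> supp f)"
  by (rule finite_subset[OF _ finite_wt_le[OF fst_pos snd_pos, of 0 j m]]) (use supp_f in auto)

lemma f_not_wfil: "f \<notin> wfil (l j) (c j + 1)"
  using left_end[of j] wt_left_end[of j] by (force simp: wfil_def)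

lemma wfil_cancel_f: "g \<in> lpolys \<Longrightarrow> g * f \<in> wfil (l j) m \<Longrightarrow> g \<in> wfil (l j) (m - c j)"
  by (rule wfil_mult_cancel[OF fst_pos snd_pos _ f_wfil f_not_wfil]) (use supp_f in auto)

lemma supp_edge_poly: "supp (edge_poly j) = {k. k + s j \<in> supp f \<and> wt (l j) k = M j j}"
proof -
  have "k \<in> supp (edge_poly j) \<longleftrightarrow> k + s j \<in> supp f \<and> wt (l j) (k + s j) = c j" for k
    by (simp add: edge_poly_def supp_def coeff2_restr[OF finite_supp_f])
  then show ?thesis
    by (auto simp: wt_add c_eq)
qed

lemma edge_poly_lpolys [simp]: "edge_poly j \<in> lpolys"
  unfolding edge_poly_def by (intro lpolys_mult lpolys_mono2 restr_in_lpolys finite_supp_f)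

lemma edge_poly_wfil: "edge_poly j \<in> wfil (l j) (M j j)"
  by (simp add: wfil_def supp_edge_poly)

lemma edge_poly_nonneg: "k \<in> supp (edge_poly j) \<Longrightarrow> 0 \<le> k"
  using edge_ge[of "k + s j" j] by (auto simp: supp_edge_poly wt_add c_eq less_eq_prod_def)

lemma edge_poly_qpolys: "edge_poly j \<in> qpolys"
  by (simp add: qpolys_def edge_poly_nonneg)

lemma edge_poly_left_end: "(0, q j) \<in> supp (edge_poly j)"
  using left_end[of j] wt_left_end[of j] by (simp add: supp_edge_poly wt_add c_eq add.commute)

lemma edge_poly_right_end: "(p j, 0) \<in> supp (edge_poly j)"
  using right_end[of j] wt_right_end[of j] by (simp add: supp_edge_poly wt_add c_eq add.commute)

lemma shifted_f_approx: "mono2 (- s j) * f - edge_poly j \<in> wfil (l j) (M j j + 1)"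
proof -
  have "M j j + 1 \<le> wt (l j) k" if k: "k \<in> supp (mono2 (- s j) * f - edge_poly j)" for k
  proof -
    have "mono2 (- s j) * f - edge_poly j = mono2 (- s j) * (f - restr {k. wt (l j) k = c j} f)"
      by (simp add: edge_poly_def right_diff_distrib)
    with k have "k + s j \<in> supp f" "wt (l j) (k + s j) \<noteq> c j"
      by (auto simp: supp_def coeff2_restr[OF finite_supp_f] split: if_splits)
    then show ?thesis
      using wfilD[OF f_wfil[of j], of "k + s j"] by (simp add: wt_add c_eq)
  qed
  then show ?thesis
    by (simp add: wfil_def)
qed

lemma edge_poly_fst_0: "e \<in> supp (edge_poly j) \<Longrightarrow> fst e = 0 \<Longrightarrow> e = (0, q j)"
  using snd_pos[of j] by (cases e) (auto simp: supp_edge_poly wt_def M_self(2))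

lemma edge_poly_snd_0: "e \<in> supp (edge_poly j) \<Longrightarrow> snd e = 0 \<Longrightarrow> e = (p j, 0)"
  using fst_pos[of j] by (cases e) (auto simp: supp_edge_poly wt_def M_self(1))

section \<open>Moving monomials into the quadrant modulo the edge polynomial\<close>

text \<open>After division by the monomial at \<open>s j\<close>, \<open>f\<close> may have negative
  exponents, while \<phi> has to be a polynomial. The set collects what becomes polynomial modulo
  the edge polynomial without loss of weight in either piece.\<close>

definition divisible_part :: "'i \<Rightarrow> int \<Rightarrow> complex fls fls set" where
  "divisible_part j m = {g. \<exists>a\<in>lpolys. \<exists>r\<in>qpolys. g = edge_poly j * a + r \<and>
     a \<in> wfil (l j) (m - M j j) \<and> r \<in> wfil (l j) m}"

lemma subspace_divisible_part: "scale2.subspace (divisible_part j m)"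
proof (rule scale2.subspaceI)
  show "0 \<in> divisible_part j m"
    unfolding divisible_part_def by (intro CollectI bexI[of _ 0]) auto
  fix x y assume "x \<in> divisible_part j m" "y \<in> divisible_part j m"
  then obtain a r b t where "a \<in> lpolys" "r \<in> qpolys" "x = edge_poly j * a + r"
      "a \<in> wfil (l j) (m - M j j)" "r \<in> wfil (l j) m"
      "b \<in> lpolys" "t \<in> qpolys" "y = edge_poly j * b + t"
      "b \<in> wfil (l j) (m - M j j)" "t \<in> wfil (l j) m"
    unfolding divisible_part_def by blast
  then show "x + y \<in> divisible_part j m"
    unfolding divisible_part_def
    by (intro CollectI bexI[of _ "a + b"] bexI[of _ "r + t"])
      (auto simp: algebra_simps intro: qpolys_add)
next
  fix x d assume "x \<in> divisible_part j m"
  then obtain a r where "a \<in> lpolys" "r \<in> qpolys" "x = edge_poly j * a + r"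
      "a \<in> wfil (l j) (m - M j j)" "r \<in> wfil (l j) m"
    unfolding divisible_part_def by blast
  then show "scale2 d x \<in> divisible_part j m"
    unfolding divisible_part_def
    by (intro CollectI bexI[of _ "scale2 d a"] bexI[of _ "scale2 d r"])
      (auto simp: scale2_mult_right scale2.scale_right_distrib intro: qpolys_scale2)
qed

lemma mono2_divisible_nonneg: "0 \<le> k \<Longrightarrow> mono2 k \<in> divisible_part j (wt (l j) k)"
  unfolding divisible_part_def
  by (intro CollectI bexI[of _ 0] bexI[of _ "mono2 k"]) (auto simp: qpolys_def wfil_def)

text \<open>Shifting the edge polynomial so that its term at \<open>e0\<close> lands on
  \<open>k\<close> and subtracting trades \<open>k\<close> for the exponents
  \<open>k - e0 + e\<close>, all of the same weight.\<close>

lemma mono2_divisible_reduce: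
  assumes e0: "e0 \<in> supp (edge_poly j)"
    and step: "\<And>e. e \<in> supp (edge_poly j) \<Longrightarrow> e \<noteq> e0 \<Longrightarrow> mono2 (k - e0 + e) \<in> divisible_part j (wt (l j) k)"
  shows "mono2 k \<in> divisible_part j (wt (l j) k)"
proof -
  let ?F = "edge_poly j" and ?D = "divisible_part j (wt (l j) k)"
  note sub = subspace_divisible_part[of j "wt (l j) k"]
  have c0: "coeff2 ?F e0 \<noteq> 0"
    using e0 by (simp add: supp_def)
  have "?F * mono2 (k - e0) = (\<Sum>e\<in>supp ?F. scale2 (coeff2 ?F e) (mono2 (k - e0 + e)))"
    by (subst lpoly_expansion[OF edge_poly_lpolys])
      (simp add: sum_distrib_right scale2_mult_left mono2_add[symmetric] add.commute)
  also have "\<dots> = scale2 (coeff2 ?F e0) (mono2 k) +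
      (\<Sum>e\<in>supp ?F - {e0}. scale2 (coeff2 ?F e) (mono2 (k - e0 + e)))"
    using e0 edge_poly_lpolys[of j] by (subst sum.remove[of _ e0]) (auto simp: lpolys_def)
  finally have "scale2 (coeff2 ?F e0) (mono2 k) = ?F * mono2 (k - e0) -
      (\<Sum>e\<in>supp ?F - {e0}. scale2 (coeff2 ?F e) (mono2 (k - e0 + e)))"
    by simp
  moreover have "?F * mono2 (k - e0) \<in> ?D"
    unfolding divisible_part_def using e0
    by (intro CollectI bexI[of _ "mono2 (k - e0)"] bexI[of _ 0])
      (auto simp: wfil_def wt_diff supp_edge_poly)
  moreover have "(\<Sum>e\<in>supp ?F - {e0}. scale2 (coeff2 ?F e) (mono2 (k - e0 + e))) \<in> ?D"
    using step by (intro scale2.subspace_sum[OF sub] scale2.subspace_scale[OF sub]) auto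
  ultimately have "scale2 (coeff2 ?F e0) (mono2 k) \<in> ?D"
    using scale2.subspace_diff[OF sub] by simp
  from scale2.subspace_scale[OF sub this, of "inverse (coeff2 ?F e0)"] c0 show ?thesis
    by simp
qed

text \<open>With the pivot \<open>(0, q j)\<close> all new exponents lie strictly further right, so
  the induction on \<open>- fst k\<close> ends. They stay above the \<open>x\<close> axis: a point
  of weight at least \<open>M j j\<close> with first coordinate below \<open>p j\<close> has
  positive second coordinate.\<close>

lemma mono2_divisible_left:
  assumes "0 \<le> snd k" "M j j \<le> wt (l j) k"
  shows "mono2 k \<in> divisible_part j (wt (l j) k)"
  using assms
proof (induction "nat (- fst k)" arbitrary: k rule: less_induct)
  case less
  show ?case
  proof (cases "0 \<le> fst k")
    case True
    then show ?thesis
      using less.prems by (intro mono2_divisible_nonneg) (simp add: less_eq_prod_def)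
  next
    case False
    show ?thesis
    proof (rule mono2_divisible_reduce[OF edge_poly_left_end])
      fix e assume e: "e \<in> supp (edge_poly j)" "e \<noteq> (0, q j)"
      define k' where "k' = k - (0, q j) + e"
      have e0: "0 \<le> fst e" "0 \<le> snd e"
        using edge_poly_nonneg[OF e(1)] by (auto simp: less_eq_prod_def)
      then have e1: "0 < fst e"
        using edge_poly_fst_0[OF e(1)] e(2) by linarith
      have wt: "wt (l j) k' = wt (l j) k"
        using e(1) edge_poly_left_end[of j] by (simp add: k'_def wt_add wt_diff supp_edge_poly)
      have "wt (l j) e = M j j" "0 \<le> int (snd (l j)) * snd e"
        using e(1) e0 by (simp_all add: supp_edge_poly)
      then have "int (fst (l j)) * fst e \<le> M j j"
        by (simp add: wt_def)
      then have "fst e \<le> p j"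
        using fst_pos[of j] by (simp add: M_self(1))
      then have "int (fst (l j)) * fst k' < int (fst (l j)) * p j"
        using False fst_pos[of j] by (intro mult_strict_left_mono) (auto simp: k'_def)
      then have "0 < int (snd (l j)) * snd k'"
        using wt less.prems(2) by (simp add: wt_def M_self(1))
      then have "0 \<le> snd k'"
        using snd_pos[of j] by (simp add: zero_less_mult_iff)
      moreover have "nat (- fst k') < nat (- fst k)"
        using False e1 by (simp add: k'_def)
      ultimately show "mono2 (k - (0, q j) + e) \<in> divisible_part j (wt (l j) k)"
        using less.hyps[of k'] less.prems(2) wt by (simp add: k'_def)
    qed
  qed
qed

lemma mono2_divisible_right:
  assumes "0 \<le> fst k" "M j j \<le> wt (l j) k"
  shows "mono2 k \<in> divisible_part j (wt (l j) k)"
  using assms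
proof (induction "nat (- snd k)" arbitrary: k rule: less_induct)
  case less
  show ?case
  proof (cases "0 \<le> snd k")
    case True
    then show ?thesis
      using less.prems by (intro mono2_divisible_nonneg) (simp add: less_eq_prod_def)
  next
    case False
    show ?thesis
    proof (rule mono2_divisible_reduce[OF edge_poly_right_end])
      fix e assume e: "e \<in> supp (edge_poly j)" "e \<noteq> (p j, 0)"
      define k' where "k' = k - (p j, 0) + e"
      have e0: "0 \<le> fst e" "0 \<le> snd e"
        using edge_poly_nonneg[OF e(1)] by (auto simp: less_eq_prod_def)
      then have e1: "0 < snd e"
        using edge_poly_snd_0[OF e(1)] e(2) by linarith
      have wt: "wt (l j) k' = wt (l j) k"
        using e(1) edge_poly_right_end[of j] by (simp add: k'_def wt_add wt_diff supp_edge_poly)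
      have "wt (l j) e = M j j" "0 \<le> int (fst (l j)) * fst e"
        using e(1) e0 by (simp_all add: supp_edge_poly)
      then have "int (snd (l j)) * snd e \<le> M j j"
        by (simp add: wt_def)
      then have "snd e \<le> q j"
        using snd_pos[of j] by (simp add: M_self(2))
      then have "int (snd (l j)) * snd k' < int (snd (l j)) * q j"
        using False snd_pos[of j] by (intro mult_strict_left_mono) (auto simp: k'_def)
      then have "0 < int (fst (l j)) * fst k'"
        using wt less.prems(2) by (simp add: wt_def M_self(2))
      then have "0 \<le> fst k'"
        using fst_pos[of j] by (simp add: zero_less_mult_iff)
      moreover have "nat (- snd k') < nat (- snd k)"
        using False e1 by (simp add: k'_def)
      ultimately show "mono2 (k - (p j, 0) + e) \<in> divisible_part j (wt (l j) k)"
        using less.hyps[of k'] less.prems(2) wt by (simp add: k'_def)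
    qed
  qed
qed

lemma mono2_divisible:
  assumes "M j j \<le> wt (l j) k"
  shows "mono2 k \<in> divisible_part j (wt (l j) k)"
proof -
  have "0 \<le> fst k \<or> 0 \<le> snd k"
  proof (rule ccontr)
    assume "\<not> (0 \<le> fst k \<or> 0 \<le> snd k)"
    then have "int (fst (l j)) * fst k \<le> 0" "int (snd (l j)) * snd k \<le> 0"
      by (simp_all add: mult_nonneg_nonpos)
    then show False
      using assms M_self_pos[of j] by (simp add: wt_def)
  qed
  then show ?thesis
    using mono2_divisible_left mono2_divisible_right assms by blast
qed

text \<open>
  Up to a unit and to terms of weight at least \<open>N\<close>, \<open>f\<close> agrees with a polynomial
  whose Newton diagram is the translate of the \<open>j\<close>-th edge to the coordinate axes.  This
  replaces the factorization of \<open>f\<close>.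
\<close>

definition edge_factor :: "'i \<Rightarrow> int \<Rightarrow> complex fls fls \<Rightarrow> bool" where
  "edge_factor j N g \<longleftrightarrow> g \<in> qpolys \<and> g - edge_poly j \<in> wfil (l j) (M j j + 1) \<and>
     (\<exists>h\<in>lpolys. g - h * f \<in> wfil (l j) N)"

text \<open>The part of weight \<open>N\<close> of the error \<open>g - h * f\<close> is written as
  \<open>edge_poly j * a + r\<close>. Taking \<open>r\<close> off \<open>g\<close> and adding
  \<open>a * mono2 (- s j)\<close> to \<open>h\<close> leaves an error of weight above
  \<open>N\<close>. Since \<open>N\<close> exceeds \<open>M j j\<close>, \<open>r\<close> does not
  disturb the leading form of \<open>g\<close>.\<close>

lemma edge_factor_exists_step:
  assumes "edge_factor j N g" "M j j < N"
  shows "\<exists>g'. edge_factor j (N + 1) g'"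
proof -
  obtain h where g: "g \<in> qpolys" "g - edge_poly j \<in> wfil (l j) (M j j + 1)" and
      h: "h \<in> lpolys" "g - h * f \<in> wfil (l j) N"
    using assms(1) by (auto simp: edge_factor_def)
  obtain k0 where k0: "\<forall>k\<in>supp h. k0 \<le> k"
    using lpolys_bdd_below[OF h(1)] .
  define w where "w = g - h * f"
  define S where "S = {k. wt (l j) k = N}"
  \<comment> \<open>The product \<open>h * f\<close> can be an infinite series; its part of weight
    \<open>N\<close> is finite because its support is bounded below.\<close>
  have fin: "finite (S \<inter> supp w)"
  proof (rule finite_subset)
    show "S \<inter> supp w \<subseteq> supp g \<union> {k. k0 + 0 \<le> k \<and> wt (l j) k \<le> N}"
      using supp_diff[of g "h * f"] supp_mult_bdd_below[OF k0, of f 0] supp_f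
      by (auto simp: S_def w_def)
    show "finite (supp g \<union> {k. k0 + 0 \<le> k \<and> wt (l j) k \<le> N})"
      using g(1) finite_wt_le[OF fst_pos snd_pos] by (auto simp: qpolys_def lpolys_def)
  qed
  note sub = subspace_divisible_part[of j N]
  have "restr S w \<in> divisible_part j N"
    unfolding restr_def using assms(2) mono2_divisible[of j]
    by (intro scale2.subspace_sum[OF sub] scale2.subspace_scale[OF sub]) (force simp: S_def)
  then obtain a r where a: "a \<in> lpolys" "a \<in> wfil (l j) (N - M j j)"
      and r: "r \<in> qpolys" "r \<in> wfil (l j) N" and ar: "restr S w = edge_poly j * a + r"
    unfolding divisible_part_def by blast
  have rest: "w - restr S w \<in> wfil (l j) (N + 1)"
  proof -
    have "N + 1 \<le> wt (l j) k" if k: "k \<in> supp w - S" for k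
      using wfilD[OF h(2), of k] k by (auto simp: w_def S_def)
    then show ?thesis
      by (simp add: wfil_def supp_diff_restr[OF fin])
  qed
  have "edge_factor j (N + 1) (g - r)"
    unfolding edge_factor_def
  proof (intro conjI bexI)
    show "g - r \<in> qpolys"
      by (rule qpolys_diff[OF g(1) r(1)])
    have "r \<in> wfil (l j) (M j j + 1)"
      using r(2) wfil_mono[of "M j j + 1" N "l j"] assms(2) by auto
    then have "g - edge_poly j - r \<in> wfil (l j) (M j j + 1)"
      using g(2) by blast
    then show "g - r - edge_poly j \<in> wfil (l j) (M j j + 1)"
      by (simp add: algebra_simps)
    have "a * (mono2 (- s j) * f - edge_poly j) \<in> wfil (l j) (N + 1)"
      using wfil_mult[OF a(2) shifted_f_approx] by simp
    then have "(w - restr S w) - a * (mono2 (- s j) * f - edge_poly j) \<in> wfil (l j) (N + 1)"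
      using rest by blast
    moreover have "(w - restr S w) - a * (mono2 (- s j) * f - edge_poly j) =
        g - r - (h + a * mono2 (- s j)) * f"
      by (subst ar) (simp add: w_def algebra_simps)
    ultimately show "g - r - (h + a * mono2 (- s j)) * f \<in> wfil (l j) (N + 1)"
      by simp
    show "h + a * mono2 (- s j) \<in> lpolys"
      by (intro lpolys_add lpolys_mult lpolys_mono2 h(1) a(1))
  qed
  then show ?thesis
    by blast
qed

lemma edge_factor_mono: "edge_factor j N g \<Longrightarrow> N' \<le> N \<Longrightarrow> edge_factor j N' g"
  unfolding edge_factor_def using wfil_mono by blast

lemma edge_factor_exists: "\<exists>g. edge_factor j N g"
proof -
  have *: "\<exists>g. edge_factor j N g" if N: "M j j + 1 \<le> N" for N
    using N
  proof (induction N rule: int_ge_induct)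
    case base
    have "edge_poly j - mono2 (- s j) * f \<in> wfil (l j) (M j j + 1)"
      using wfil_uminus[OF shifted_f_approx[of j]] by simp
    then have "edge_factor j (M j j + 1) (edge_poly j)"
      unfolding edge_factor_def using edge_poly_qpolys[of j] lpolys_mono2[of "- s j"] by auto
    then show ?case
      by blast
  next
    case (step N)
    then show ?case
      using edge_factor_exists_step[of j N] by auto
  qed
  show ?thesis
    using *[of "max N (M j j + 1)"] edge_factor_mono[of j "max N (M j j + 1)" _ N] by auto
qed

lemma edge_factor_wfil:
  assumes "edge_factor j N g"
  shows "g \<in> wfil (l i) (M j i)"
proof -
  have "g \<in> wfil (l j) (M j j)"
  proof (rule wfil_diff_iff[OF _ edge_poly_wfil])
    show "g - edge_poly j \<in> wfil (l j) (M j j)"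
      using assms wfil_mono[of "M j j" "M j j + 1" "l j"] by (auto simp: edge_factor_def)
  qed
  then show ?thesis
    using assms M_le_wt by (auto simp: wfil_def edge_factor_def qpolys_def)
qed

lemma edge_factor_not_wfil:
  assumes "edge_factor j N g"
  shows "g \<notin> wfil (l j) (M j j + 1)"
proof
  assume "g \<in> wfil (l j) (M j j + 1)"
  then have "g - (g - edge_poly j) \<in> wfil (l j) (M j j + 1)"
    using assms unfolding edge_factor_def by blast
  then show False
    using edge_poly_left_end[of j] by (auto simp: wfil_def supp_edge_poly)
qed


section \<open>Order conditions on the left, weight conditions on the right\<close>

text \<open>The condition v''_i \<ge> w with multipliers restricted to Laurent polynomials;
  \<open>laurent_ord_iff\<close> shows that Laurent germs as multipliers give the same
  condition.\<close>

definition ord_ge :: "'i \<Rightarrow> int \<Rightarrow> complex fls fls set" where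
  "ord_ge i w = {g \<in> lpolys. \<exists>h\<in>lpolys. g + h * f \<in> wfil (l i) w}"

lemma ord_ge_lpolys: "g \<in> ord_ge i w \<Longrightarrow> g \<in> lpolys"
  by (simp add: ord_ge_def)

lemma ord_geI: "g \<in> lpolys \<Longrightarrow> h \<in> lpolys \<Longrightarrow> g + h * f \<in> wfil (l i) w \<Longrightarrow> g \<in> ord_ge i w"
  by (auto simp: ord_ge_def)

lemma ord_geE:
  assumes "g \<in> ord_ge i w"
  obtains h where "h \<in> lpolys" "g + h * f \<in> wfil (l i) w"
  using assms by (auto simp: ord_ge_def)

lemma wfil_ord_ge: "g \<in> lpolys \<Longrightarrow> g \<in> wfil (l i) w \<Longrightarrow> g \<in> ord_ge i w"
  by (rule ord_geI[of _ 0]) auto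

lemma ord_ge_add:
  assumes "g \<in> ord_ge i w" "g' \<in> ord_ge i w"
  shows "g + g' \<in> ord_ge i w"
proof -
  obtain h where h: "h \<in> lpolys" "g + h * f \<in> wfil (l i) w"
    using assms(1) by (rule ord_geE)
  obtain h' where h': "h' \<in> lpolys" "g' + h' * f \<in> wfil (l i) w"
    using assms(2) by (rule ord_geE)
  have "(g + h * f) + (g' + h' * f) \<in> wfil (l i) w"
    using h(2) h'(2) by (rule wfil_add)
  then have "g + g' + (h + h') * f \<in> wfil (l i) w"
    by (simp add: algebra_simps)
  then show ?thesis
    by (rule ord_geI[rotated 2])
      (intro lpolys_add h(1) h'(1) ord_ge_lpolys[OF assms(1)] ord_ge_lpolys[OF assms(2)])+
qed

lemma ord_ge_mult:
  assumes "a \<in> lpolys" "a \<in> wfil (l i) w" "g \<in> ord_ge i w'"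
  shows "a * g \<in> ord_ge i (w + w')"
proof -
  obtain h where h: "h \<in> lpolys" "g + h * f \<in> wfil (l i) w'"
    using assms(3) by (rule ord_geE)
  have "a * (g + h * f) \<in> wfil (l i) (w + w')"
    using assms(2) h(2) by (rule wfil_mult)
  then have "a * g + (a * h) * f \<in> wfil (l i) (w + w')"
    by (simp add: algebra_simps)
  then show ?thesis
    by (rule ord_geI[rotated 2])
      (intro lpolys_mult h(1) assms(1) ord_ge_lpolys[OF assms(3)])+
qed

lemma ord_ge_scale2:
  assumes "g \<in> ord_ge i w"
  shows "scale2 d g \<in> ord_ge i w"
proof -
  have "scale2 d 1 * g \<in> ord_ge i (0 + w)"
    using assms lpolys_mono2[of 0] wfil_mono2[of 0 "l i" 0] by (intro ord_ge_mult) auto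
  then show ?thesis
    by (simp add: scale2_mult_left)
qed

lemma subspace_ord_ge: "scale2.subspace (ord_ge i w)"
  by (rule scale2.subspaceI) (auto intro: wfil_ord_ge ord_ge_add ord_ge_scale2)

lemma ord_ge_mono: "w' \<le> w \<Longrightarrow> ord_ge i w \<subseteq> ord_ge i w'"
  using wfil_mono[of w' w "l i"] by (fastforce simp: ord_ge_def)

text \<open>
  \<open>mixed j v\<close> carries order conditions on the left of the \<open>j\<close>-th edge and weight conditions
  on its right.  In \<open>left_part j v\<close> the conditions on the right, including the nonnegativity
  of the exponent of \<open>y\<close>, are dropped; this makes it stable under moves to the right along the
  lines parallel to the edge.
\<close>

definition mixed :: "'i \<Rightarrow> ('i \<Rightarrow> int) \<Rightarrow> complex fls fls set" where
  "mixed j v = {g \<in> qpolys. (\<forall>i. left_of i j \<longrightarrow> g \<in> ord_ge i (v i)) \<and>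
     (\<forall>i. left_of j i \<longrightarrow> g \<in> wfil (l i) (v i))}"

definition left_part :: "'i \<Rightarrow> ('i \<Rightarrow> int) \<Rightarrow> complex fls fls set" where
  "left_part j v = {g \<in> lpolys. (\<forall>k\<in>supp g. 0 \<le> fst k) \<and>
     (\<forall>i. left_of i j \<longrightarrow> g \<in> ord_ge i (v i))}"

definition right_cond :: "'i \<Rightarrow> ('i \<Rightarrow> int) \<Rightarrow> int \<times> int \<Rightarrow> bool" where
  "right_cond j v k \<longleftrightarrow> 0 \<le> snd k \<and> (\<forall>i. left_of j i \<longrightarrow> v i \<le> wt (l i) k)"

text \<open>Everything beyond \<open>left_part\<close> is a condition on single monomials and can be
  enforced by cancelling or deleting terms.\<close>

lemma mixed_iff: "g \<in> mixed j v \<longleftrightarrow> g \<in> left_part j v \<and> (\<forall>k\<in>supp g. right_cond j v k)"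
  by (auto simp: mixed_def left_part_def right_cond_def qpolys_def wfil_def less_eq_prod_def)

lemma subspace_mixed: "scale2.subspace (mixed j v)"
proof (rule scale2.subspaceI)
  show "0 \<in> mixed j v"
    by (auto simp: mixed_def intro: wfil_ord_ge)
  show "x + y \<in> mixed j v" if "x \<in> mixed j v" "y \<in> mixed j v" for x y
    using that by (auto simp: mixed_def intro: qpolys_add ord_ge_add)
  show "scale2 d x \<in> mixed j v" if "x \<in> mixed j v" for d x
    using that by (auto simp: mixed_def intro: qpolys_scale2 ord_ge_scale2)
qed

lemma subspace_left_part: "scale2.subspace (left_part j v)"
proof (rule scale2.subspaceI)
  show "0 \<in> left_part j v"
    by (auto simp: left_part_def intro: wfil_ord_ge)
  show "x + y \<in> left_part j v" if "x \<in> left_part j v" "y \<in> left_part j v" for x y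
    using that supp_add[of x y] by (auto simp: left_part_def intro: ord_ge_add)
  show "scale2 d x \<in> left_part j v" if "x \<in> left_part j v" for d x
    using that supp_scale2[of d x] by (auto simp: left_part_def intro: ord_ge_scale2)
qed

lemma left_part_lpolys: "g \<in> left_part j v \<Longrightarrow> g \<in> lpolys"
  by (simp add: left_part_def)

lemma left_part_mono2_mult:
  assumes g: "g \<in> left_part j v" and d: "0 \<le> fst d" "\<And>i. left_of i j \<Longrightarrow> v' i - v i \<le> wt (l i) d"
  shows "mono2 d * g \<in> left_part j v'"
proof -
  have "mono2 d * g \<in> ord_ge i (v' i)" if "left_of i j" for i
  proof -
    have "mono2 d * g \<in> ord_ge i ((v' i - v i) + v i)"
      using g d(2) that by (intro ord_ge_mult wfil_mono2) (auto simp: left_part_def)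
    then show ?thesis
      by simp
  qed
  then show ?thesis
    using g d(1) by (auto simp: left_part_def supp_mono2_mult)
qed

lemma wt_left_nonneg_snd:
  assumes "left_of i j" "0 \<le> wt (l j) d" "snd d \<le> 0"
  shows "0 \<le> wt (l i) d"
proof -
  have "det i j * snd d \<le> 0"
    using assms(3) det_pos[OF assms(1)] by (simp add: mult_nonneg_nonpos)
  also have "0 \<le> int (fst (l i)) * wt (l j) d"
    using assms(2) by simp
  finally have "0 \<le> int (fst (l j)) * wt (l i) d"
    using wt_det_snd[of j i d] by linarith
  then show ?thesis
    using fst_pos[of j] by (simp add: zero_le_mult_iff)
qed

lemma wt_fst_nonneg:
  assumes "0 \<le> wt (l j) d" "snd d \<le> 0"
  shows "0 \<le> fst d"
proof -
  have "int (snd (l j)) * snd d \<le> 0"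
    using assms(2) by (simp add: mult_nonneg_nonpos)
  then have "0 \<le> int (fst (l j)) * fst d"
    using assms(1) by (simp add: wt_def)
  then show ?thesis
    using fst_pos[of j] by (simp add: zero_le_mult_iff)
qed

lemma wt_left_nonneg_fst:
  assumes "left_of i j" "0 \<le> wt (l j) d" "0 \<le> fst d"
  shows "0 \<le> wt (l i) d"
proof -
  have "0 \<le> int (snd (l i)) * wt (l j) d + det i j * fst d"
    using assms det_pos[OF assms(1)] by simp
  then have "0 \<le> int (snd (l j)) * wt (l i) d"
    by (simp add: wt_det_fst[of j i d])
  then show ?thesis
    using snd_pos[of j] by (simp add: zero_le_mult_iff)
qed

lemma wt_right_neg_snd:
  assumes "left_of j i" "0 \<le> wt (l j) d" "wt (l i) d < 0"
  shows "snd d < 0"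
proof -
  have "int (fst (l i)) * wt (l j) d \<ge> 0" "int (fst (l j)) * wt (l i) d < 0"
    using assms(2,3) fst_pos[of j] by (simp_all add: mult_pos_neg)
  then have "det j i * snd d < 0"
    using wt_det_snd[of i j d] by linarith
  then show ?thesis
    using det_pos[OF assms(1)] by (simp add: mult_less_0_iff)
qed

text \<open>Passing from a good monomial to a bad one of no smaller \<open>j\<close>-weight means
  going down. By \<open>wt_left_nonneg_snd\<close> such a move lowers no weight on the left, so it
  keeps leading monomials leading.\<close>

lemma not_right_cond_snd:
  assumes "right_cond j v k1" "\<not> right_cond j v k" "wt (l j) k1 \<le> wt (l j) k"
  shows "snd (k - k1) < 0"
proof (cases "snd k < 0")
  case True
  then show ?thesis
    using assms(1) by (simp add: right_cond_def)
next
  case False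
  then obtain i where i: "left_of j i" "wt (l i) k < v i"
    using assms(2) by (auto simp: right_cond_def not_le)
  moreover have "v i \<le> wt (l i) k1"
    using assms(1) i(1) by (simp add: right_cond_def)
  ultimately show ?thesis
    using assms(3) by (intro wt_right_neg_snd[OF i(1)]) (simp_all add: wt_diff)
qed

section \<open>Leading monomials of the left conditions\<close>

definition lead :: "'i \<Rightarrow> ('i \<Rightarrow> int) \<Rightarrow> (int \<times> int) set" where
  "lead j v = {k. \<exists>h\<in>left_part j v. h - mono2 k \<in> wfil (l j) (wt (l j) k + 1)}"

lemma lead_add:
  assumes "k \<in> lead j v" "0 \<le> fst d" "\<And>i. left_of i j \<Longrightarrow> 0 \<le> wt (l i) d"
  shows "k + d \<in> lead j v"
proof -
  obtain h where h: "h \<in> left_part j v" "h - mono2 k \<in> wfil (l j) (wt (l j) k + 1)"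
    using assms(1) by (auto simp: lead_def)
  have "mono2 d * (h - mono2 k) \<in> wfil (l j) (wt (l j) d + (wt (l j) k + 1))"
    by (intro wfil_mult wfil_mono2 h order_refl)
  then have "mono2 d * h - mono2 (k + d) \<in> wfil (l j) (wt (l j) (k + d) + 1)"
    by (simp add: right_diff_distrib mono2_add[symmetric] wt_add algebra_simps)
  moreover have "mono2 d * h \<in> left_part j v"
    using assms(2,3) by (intro left_part_mono2_mult[OF h(1)]) auto
  ultimately show ?thesis
    by (auto simp: lead_def)
qed

lemma lead_realize:
  assumes g: "g \<in> lpolys" "\<And>k. k \<in> supp g \<Longrightarrow> k \<in> lead j v \<and> wt (l j) k = m"
  shows "\<exists>h\<in>left_part j v. h - g \<in> wfil (l j) (m + 1)"
proof -
  have "\<forall>k\<in>supp g. \<exists>h. h \<in> left_part j v \<and> h - mono2 k \<in> wfil (l j) (m + 1)"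
    using g(2) by (fastforce simp: lead_def)
  from bchoice[OF this] obtain H where
    H: "\<forall>k\<in>supp g. H k \<in> left_part j v \<and> H k - mono2 k \<in> wfil (l j) (m + 1)" ..
  show ?thesis
  proof
    show "(\<Sum>k\<in>supp g. scale2 (coeff2 g k) (H k)) \<in> left_part j v"
      using H by (intro scale2.subspace_sum[OF subspace_left_part]
          scale2.subspace_scale[OF subspace_left_part]) auto
    have "(\<Sum>k\<in>supp g. scale2 (coeff2 g k) (H k - mono2 k)) \<in> wfil (l j) (m + 1)"
      using H by (intro scale2.subspace_sum[OF subspace_wfil]
          scale2.subspace_scale[OF subspace_wfil]) auto
    then show "(\<Sum>k\<in>supp g. scale2 (coeff2 g k) (H k)) - g \<in> wfil (l j) (m + 1)"
      by (subst (2) lpoly_expansion[OF g(1)])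
        (simp add: scale2.scale_right_diff_distrib sum_subtractf)
  qed
qed

text \<open>On a line of constant weight the leading monomials behave like an ideal of a polynomial
  ring in one variable containing a power of that variable: they form a ray.\<close>

lemma lead_ray:
  assumes g: "g \<in> left_part j v" "g \<in> wfil (l j) m"
    and k1: "k1 \<in> supp g" "wt (l j) k1 = m"
    and k1_min: "\<And>k. k \<in> supp g \<Longrightarrow> wt (l j) k = m \<Longrightarrow> fst k1 \<le> fst k"
    and k: "wt (l j) k = m" "fst k1 \<le> fst k"
  shows "k \<in> lead j v"
proof -
  have k1_nonneg: "0 \<le> fst k1"
    using g(1) k1(1) by (auto simp: left_part_def)
  \<comment> \<open>As \<open>det i j\<close> is at least 1 for \<open>i\<close> on the left, a
    monomial of \<open>j\<close>-weight \<open>m\<close> with first exponent at least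
    \<open>B\<close> satisfies all weight conditions on the left, hence the order conditions. The
    sum of absolute values is merely a bound uniform in \<open>i\<close>.\<close>
  define B where "B = (\<Sum>i\<in>UNIV. \<bar>int (snd (l j)) * v i - int (snd (l i)) * m\<bar>)"
  have B: "int (snd (l j)) * v i - int (snd (l i)) * m \<le> B" for i
  proof -
    have "\<bar>int (snd (l j)) * v i - int (snd (l i)) * m\<bar> \<le> B"
      unfolding B_def by (rule member_le_sum) auto
    then show ?thesis
      by linarith
  qed
  show ?thesis
    using k
  proof (induction "nat (B - fst k)" arbitrary: k rule: less_induct)
    case less
    show ?case
    proof (cases "B \<le> fst k")
      case True
      have "v i \<le> wt (l i) k" if i: "left_of i j" for i
      proof -
        have "1 * fst k \<le> det i j * fst k"
          using det_pos[OF i] less.prems k1_nonneg by (intro mult_right_mono) auto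
        then have "int (snd (l j)) * v i \<le> int (snd (l j)) * wt (l i) k"
          using B[of i] True less.prems(1) wt_det_fst[of j i k] by simp
        then show ?thesis
          using snd_pos[of j] by simp
      qed
      then have "mono2 k \<in> left_part j v"
        using less.prems k1_nonneg by (auto simp: left_part_def intro!: wfil_ord_ge wfil_mono2)
      then show ?thesis
        unfolding lead_def by (intro CollectI bexI[of _ "mono2 k"]) auto
    next
      case False
      \<comment> \<open>Descending from \<open>B\<close>: \<open>g\<close> is translated so that its
        leftmost leading monomial falls on \<open>k\<close>. The other leading monomials then lie to
        the right of \<open>k\<close>, are leading by induction and can be subtracted.\<close>
      define d where "d = k - k1"
      have d: "0 \<le> fst d" "wt (l j) d = 0"
        using less.prems k1 by (simp_all add: d_def wt_diff)
      define g' where "g' = mono2 d * g"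
      have supp_g': "n - d \<in> supp g" if "n \<in> supp g'" for n
        using that by (simp add: g'_def supp_def)
      have g': "g' \<in> left_part j v"
        unfolding g'_def using d wt_left_nonneg_fst[of _ j d]
        by (intro left_part_mono2_mult[OF g(1)]) auto
      have g'_wfil: "g' \<in> wfil (l j) m"
        using wfil_mult[OF wfil_mono2[of 0 "l j" d] g(2)] d(2) by (simp add: g'_def)
      have k_supp: "coeff2 g' k \<noteq> 0"
        using k1(1) by (simp add: g'_def d_def supp_def)
      define S where "S = {n. wt (l j) n = m \<and> n \<noteq> k}"
      have S_iff: "n \<in> S \<longleftrightarrow> wt (l j) n = m \<and> n \<noteq> k" for n
        by (simp add: S_def)
      have fin: "finite (S \<inter> supp g')"
        using left_part_lpolys[OF g'] by (rule lpoly_finite)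
      have "\<exists>h\<in>left_part j v. h - restr S g' \<in> wfil (l j) (m + 1)"
      proof (rule lead_realize[OF restr_in_lpolys[OF fin]])
        fix n assume "n \<in> supp (restr S g')"
        then have n: "wt (l j) n = m" "n \<noteq> k" "n \<in> supp g'"
          by (auto simp: supp_restr[OF fin] S_iff)
        have "fst k1 \<le> fst (n - d)"
          using d n(1) by (intro k1_min[OF supp_g'[OF n(3)]]) (simp add: wt_diff)
        then have "fst k \<le> fst n"
          by (simp add: d_def)
        moreover have "fst k \<noteq> fst n"
        proof
          assume "fst k = fst n"
          then have "snd k = snd n"
            using n(1) less.prems(1) snd_pos[of j] by (auto simp: wt_def)
          with \<open>fst k = fst n\<close> n(2) show False
            by (simp add: prod_eq_iff)
        qed
        ultimately show "n \<in> lead j v \<and> wt (l j) n = m"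
          using less.prems False n(1) by (intro conjI less.hyps) auto
      qed
      then obtain h where h: "h \<in> left_part j v" "h - restr S g' \<in> wfil (l j) (m + 1)" ..
      define a where "a = coeff2 g' k"
      have "coeff2 (g' - restr S g' - scale2 a (mono2 k)) n = 0" if n: "wt (l j) n < m + 1" for n
        using n wfil_coeff2[OF g'_wfil, of n] less.prems(1)
        by (auto simp: coeff2_restr[OF fin] S_iff a_def coeff2_mono2)
      then have "g' - restr S g' - scale2 a (mono2 k) \<in> wfil (l j) (m + 1)"
        by (force simp: wfil_def supp_def)
      then have "scale2 (inverse a) ((g' - restr S g' - scale2 a (mono2 k)) - (h - restr S g')) \<in> wfil (l j) (m + 1)"
        by (rule wfil_scale2[OF wfil_diff[OF _ h(2)]])
      moreover have "(g' - restr S g' - scale2 a (mono2 k)) - (h - restr S g') =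
          (g' - h) - scale2 a (mono2 k)"
        by simp
      moreover have "scale2 (inverse a) ((g' - h) - scale2 a (mono2 k)) =
          scale2 (inverse a) (g' - h) - mono2 k"
        using k_supp by (simp add: a_def scale2.scale_right_diff_distrib[of _ "g' - h"])
      moreover have "scale2 (inverse a) (g' - h) \<in> left_part j v"
        using g' h(1) by (intro scale2.subspace_scale[OF subspace_left_part]
            scale2.subspace_diff[OF subspace_left_part])
      ultimately show ?thesis
        using less.prems(1) unfolding lead_def by (intro CollectI bexI) simp_all
    qed
  qed
qed

text \<open>
  A monomial violating a condition on the right of the edge is obtained from \<open>k1\<close> by a move
  along which all weights on the left increase, so it is a leading monomial itself and can be
  cancelled.
\<close>

lemma left_part_correction_step:
  assumes k1: "k1 \<in> lead j v" "right_cond j v k1"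
    and h: "h \<in> left_part j v" "h - g \<in> wfil (l j) m"
    and cond: "\<And>k. k \<in> supp h \<Longrightarrow> wt (l j) k < t \<Longrightarrow> right_cond j v k"
    and t: "m \<le> t" "wt (l j) k1 \<le> t"
  shows "\<exists>h'\<in>left_part j v. h' - g \<in> wfil (l j) m \<and>
    (\<forall>k\<in>supp h'. wt (l j) k < t + 1 \<longrightarrow> right_cond j v k)"
proof -
  define S where "S = {k. wt (l j) k = t \<and> \<not> right_cond j v k}"
  have S_iff: "k \<in> S \<longleftrightarrow> wt (l j) k = t \<and> \<not> right_cond j v k" for k
    by (simp add: S_def)
  have fin: "finite (S \<inter> supp h)"
    using left_part_lpolys[OF h(1)] by (rule lpoly_finite)
  have "\<exists>r\<in>left_part j v. r - restr S h \<in> wfil (l j) (t + 1)"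
  proof (rule lead_realize[OF restr_in_lpolys[OF fin]])
    fix k assume "k \<in> supp (restr S h)"
    then have k: "wt (l j) k = t" "\<not> right_cond j v k"
      by (auto simp: supp_restr[OF fin] S_iff)
    have neg: "snd (k - k1) < 0"
      using k t by (intro not_right_cond_snd[OF k1(2)]) auto
    have d: "0 \<le> wt (l j) (k - k1)"
      using k(1) t(2) by (simp add: wt_diff)
    have "k1 + (k - k1) \<in> lead j v"
    proof (rule lead_add[OF k1(1)])
      show "0 \<le> fst (k - k1)"
        using neg by (intro wt_fst_nonneg[OF d]) simp
      show "0 \<le> wt (l i) (k - k1)" if "left_of i j" for i
        using neg by (intro wt_left_nonneg_snd[OF that d]) simp
    qed
    then show "k \<in> lead j v \<and> wt (l j) k = t"
      using k(1) by simp
  qed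
  then obtain r where r: "r \<in> left_part j v" "r - restr S h \<in> wfil (l j) (t + 1)" ..
  have "restr S h \<in> wfil (l j) t"
    by (auto simp: wfil_def supp_restr[OF fin] S_iff)
  then have r_wfil: "r \<in> wfil (l j) t"
    using r(2) wfil_mono[of t "t + 1" "l j"] by (intro wfil_diff_iff[of r "restr S h"]) auto
  show ?thesis
  proof (intro bexI conjI ballI impI)
    show "h - r \<in> left_part j v"
      by (intro scale2.subspace_diff[OF subspace_left_part] h r)
    have "(h - g) - r \<in> wfil (l j) m"
      using h(2) r_wfil wfil_mono[OF t(1), of "l j"] by blast
    then show "h - r - g \<in> wfil (l j) m"
      by (simp add: algebra_simps)
    fix k assume k: "k \<in> supp (h - r)" "wt (l j) k < t + 1"
    show "right_cond j v k"
    proof (cases "wt (l j) k < t")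
      case True
      then have "coeff2 r k = 0"
        by (rule wfil_coeff2[OF r_wfil])
      then show ?thesis
        using k(1) True by (intro cond) (simp_all add: supp_def)
    next
      case False
      have "coeff2 r k = coeff2 (restr S h) k"
        using wfil_coeff2[OF r(2) k(2)] by simp
      then show ?thesis
        using k False by (auto simp: supp_def coeff2_restr[OF fin] S_iff split: if_splits)
    qed
  qed
qed

text \<open>Violations are removed one weight level at a time. Each correction has weight at least
  that of the level being cleared, so cleared levels stay clear and the leading form
  \<open>g\<close> survives.\<close>

lemma left_part_correction:
  assumes k1: "k1 \<in> lead j v" "right_cond j v k1" "wt (l j) k1 = m"
    and h: "h \<in> left_part j v" "h - g \<in> wfil (l j) (m + 1)"
    and g: "g \<in> wfil (l j) m" "\<And>k. k \<in> supp g \<Longrightarrow> right_cond j v k"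
    and t: "m + 1 \<le> t"
  shows "\<exists>h'\<in>left_part j v. h' - g \<in> wfil (l j) (m + 1) \<and>
    (\<forall>k\<in>supp h'. wt (l j) k < t \<longrightarrow> right_cond j v k)"
  using t
proof (induction t rule: int_ge_induct)
  case base
  have "right_cond j v k" if k: "k \<in> supp h" "wt (l j) k < m + 1" for k
    using wfil_coeff2[OF h(2) k(2)] k(1) by (intro g(2)) (simp add: supp_def)
  then show ?case
    using h by blast
next
  case (step t)
  then obtain h' where h': "h' \<in> left_part j v" "h' - g \<in> wfil (l j) (m + 1)"
      "\<And>k. k \<in> supp h' \<Longrightarrow> wt (l j) k < t \<Longrightarrow> right_cond j v k"
    by blast
  show ?case
    using step.hyps k1(3) by (intro left_part_correction_step[OF k1(1,2) h']) auto
qed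

text \<open>At high \<open>j\<close>-weight a violation on the right forces a negative exponent of
  \<open>y\<close>: for a nonnegative one \<open>wt_det_snd\<close> makes all weights on the right
  large. With that exponent negative the weights on the left are large. From \<open>t0\<close> on,
  bad terms can thus be deleted, so finitely many corrections suffice.\<close>

lemma high_weight_left:
  obtains t0 where "\<And>k i. t0 \<le> wt (l j) k \<Longrightarrow> \<not> right_cond j v k \<Longrightarrow> left_of i j \<Longrightarrow> v i \<le> wt (l i) k"
proof -
  define t0 where "t0 = 1 + (\<Sum>i\<in>UNIV. \<bar>int (fst (l j)) * v i\<bar>)"
  have t0: "int (fst (l j)) * v i < t0" for i
  proof -
    have "\<bar>int (fst (l j)) * v i\<bar> \<le> (\<Sum>i\<in>UNIV. \<bar>int (fst (l j)) * v i\<bar>)"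
      by (rule member_le_sum) auto
    then show ?thesis
      unfolding t0_def by linarith
  qed
  have t0_pos: "0 < t0"
    unfolding t0_def by (intro add_pos_nonneg sum_nonneg) auto
  have scale: "t0 \<le> int (fst (l i)) * wt (l j) k" if "t0 \<le> wt (l j) k" for i k
  proof -
    have "1 * wt (l j) k \<le> int (fst (l i)) * wt (l j) k"
      using fst_pos[of i] that t0_pos by (intro mult_right_mono) auto
    then show ?thesis
      using that by linarith
  qed
  show thesis
  proof (rule that)
    fix k i assume k: "t0 \<le> wt (l j) k" "\<not> right_cond j v k" and i: "left_of i j"
    have "snd k < 0"
    proof (rule ccontr)
      assume snd: "\<not> snd k < 0"
      then obtain i' where i': "left_of j i'" "wt (l i') k < v i'"
        using k(2) by (auto simp: right_cond_def not_le)
      have "int (fst (l j)) * wt (l i') k < t0"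
        using i'(2) t0[of i'] mult_left_mono[of "wt (l i') k" "v i'" "int (fst (l j))"] by auto
      then have "det j i' * snd k < 0"
        using scale[OF k(1), of i'] wt_det_snd[of i' j k] by linarith
      then show False
        using det_pos[OF i'(1)] snd by (simp add: mult_less_0_iff)
    qed
    then have "det i j * snd k \<le> 0"
      using det_pos[OF i] by (simp add: mult_nonneg_nonpos)
    then have "int (fst (l j)) * v i \<le> int (fst (l j)) * wt (l i) k"
      using scale[OF k(1), of i] t0[of i] wt_det_snd[of j i k] by linarith
    then show "v i \<le> wt (l i) k"
      using fst_pos[of j] by simp
  qed
qed

text \<open>Below the bound of \<open>high_weight_left\<close> bad terms are cancelled by
  corrections; above it they are deleted, which respects the left conditions and leaves the leading
  form alone.\<close>

lemma mixed_realize: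
  assumes k1: "k1 \<in> lead j v" "right_cond j v k1" "wt (l j) k1 = m"
    and h: "h \<in> left_part j v" "h - g \<in> wfil (l j) (m + 1)"
    and g: "g \<in> wfil (l j) m" "\<And>k. k \<in> supp g \<Longrightarrow> right_cond j v k"
  shows "\<exists>h'\<in>mixed j v. h' - g \<in> wfil (l j) (m + 1)"
proof -
  obtain t0 where t0: "\<And>k i. t0 \<le> wt (l j) k \<Longrightarrow> \<not> right_cond j v k \<Longrightarrow> left_of i j \<Longrightarrow> v i \<le> wt (l i) k"
    by (rule high_weight_left[of j v]) blast
  define t where "t = max t0 (m + 1)"
  obtain h' where h': "h' \<in> left_part j v" "h' - g \<in> wfil (l j) (m + 1)"
      "\<And>k. k \<in> supp h' \<Longrightarrow> wt (l j) k < t \<Longrightarrow> right_cond j v k"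
    using left_part_correction[OF k1 h g, of t] unfolding t_def by auto
  define S where "S = {k. \<not> right_cond j v k}"
  have S_iff: "k \<in> S \<longleftrightarrow> \<not> right_cond j v k" for k
    by (simp add: S_def)
  have fin: "finite (S \<inter> supp h')"
    using left_part_lpolys[OF h'(1)] by (rule lpoly_finite)
  have high: "t \<le> wt (l j) k" if "k \<in> supp (restr S h')" for k
    using that h'(3)[of k] by (force simp: supp_restr[OF fin] S_iff)
  have "restr S h' \<in> wfil (l i) (v i)" if i: "left_of i j" for i
  proof -
    have "v i \<le> wt (l i) k" if k: "k \<in> supp (restr S h')" for k
      using high[OF k] k i by (intro t0) (auto simp: t_def supp_restr[OF fin] S_iff)
    then show ?thesis
      by (simp add: wfil_def)
  qed
  then have "restr S h' \<in> left_part j v"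
    using h'(1) restr_in_lpolys[OF fin]
    by (auto simp: left_part_def supp_restr[OF fin] intro: wfil_ord_ge)
  then have "h' - restr S h' \<in> left_part j v"
    by (intro scale2.subspace_diff[OF subspace_left_part] h')
  then have "h' - restr S h' \<in> mixed j v"
    unfolding mixed_iff by (auto simp: supp_diff_restr[OF fin] S_iff)
  moreover have "restr S h' \<in> wfil (l j) (m + 1)"
    using high by (force simp: wfil_def t_def)
  then have "(h' - g) - restr S h' \<in> wfil (l j) (m + 1)"
    using h'(2) by blast
  then have "h' - restr S h' - g \<in> wfil (l j) (m + 1)"
    by (simp add: algebra_simps)
  ultimately show ?thesis
    by blast
qed

section \<open>Dividing leading forms by the edge polynomial\<close>

text \<open>If \<open>h * f\<close> cancels the part of \<open>g\<close> of weight \<open>m\<close>,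
  then \<open>h\<close> has weight at least \<open>m - c j\<close>, and that part is minus the
  product of the parts of \<open>h\<close> and \<open>f\<close> of weights \<open>m - c j\<close>
  and \<open>c j\<close>. Moving the monomial at \<open>s j\<close> from \<open>f\<close> to
  \<open>h\<close> gives the quotient.\<close>

lemma leading_form_divisible:
  assumes g: "g \<in> wfil (l j) m" "g \<in> ord_ge j (m + 1)"
  shows "\<exists>a\<in>lpolys. (\<forall>k\<in>supp a. wt (l j) k = m - M j j) \<and>
    g - edge_poly j * a \<in> wfil (l j) (m + 1)"
proof -
  obtain h where h: "h \<in> lpolys" "g + h * f \<in> wfil (l j) (m + 1)"
    using g(2) by (rule ord_geE)
  have "(g + h * f) - g \<in> wfil (l j) m"
    using h(2) wfil_mono[of m "m + 1" "l j"] g(1) by (intro wfil_diff) auto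
  then have "h \<in> wfil (l j) (m - c j)"
    using wfil_cancel_f[OF h(1)] by simp
  then have H_wfil: "mono2 (s j) * - h \<in> wfil (l j) (m - M j j)"
    using wfil_mult[OF wfil_mono2[OF order_refl, of "s j" "l j"] wfil_uminus] by (fastforce simp: c_eq)
  define H where "H = mono2 (s j) * - h"
  define S where "S = {k. wt (l j) k = m - M j j}"
  have S_iff: "k \<in> S \<longleftrightarrow> wt (l j) k = m - M j j" for k
    by (simp add: S_def)
  have "- h \<in> lpolys"
    using lpolys_diff[OF lpolys_0 h(1)] by simp
  then have H: "H \<in> lpolys" "H \<in> wfil (l j) (m - M j j)"
    using lpolys_mult[OF lpolys_mono2, of "- h" "s j"] H_wfil unfolding H_def by simp_all
  have fin: "finite (S \<inter> supp H)"
    using H(1) by (rule lpoly_finite)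
  have rest: "H - restr S H \<in> wfil (l j) (m - M j j + 1)"
  proof -
    have "m - M j j + 1 \<le> wt (l j) k" if k: "k \<in> supp H - S" for k
      using wfilD[OF H(2), of k] k by (auto simp: S_iff)
    then show ?thesis
      by (simp add: wfil_def supp_diff_restr[OF fin])
  qed
  let ?E = "mono2 (- s j) * f - edge_poly j"
  have "mono2 (s j) * mono2 (- s j) = 1"
    by (simp add: mono2_add[symmetric])
  then have "H * (mono2 (- s j) * f) = - (h * f)"
    unfolding H_def by (simp add: algebra_simps)
  then have "g - edge_poly j * restr S H =
      (g + h * f) + (edge_poly j * (H - restr S H) + H * ?E)"
    by (simp add: algebra_simps)
  moreover have "edge_poly j * (H - restr S H) \<in> wfil (l j) (m + 1)"
    using wfil_mult[OF edge_poly_wfil rest] by (simp add: algebra_simps)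
  moreover have "H * ?E \<in> wfil (l j) (m + 1)"
    using wfil_mult[OF H(2) shifted_f_approx] by (simp add: algebra_simps)
  ultimately have "g - edge_poly j * restr S H \<in> wfil (l j) (m + 1)"
    using h(2) by (simp only: wfil_add)
  then show ?thesis
    using restr_in_lpolys[OF fin] by (intro bexI[of _ "restr S H"]) (auto simp: supp_restr[OF fin] S_iff)
qed

text \<open>The only monomial of the edge polynomial on the \<open>y\<close> axis is
  \<open>(0, q j)\<close>, so nothing can cancel the product of the leftmost monomials. It transfers
  what is known at the extreme monomials of a product to those of the quotient.\<close>

lemma edge_poly_mult_left:
  assumes a: "a \<in> lpolys" "k1 \<in> supp a" "\<And>k. k \<in> supp a \<Longrightarrow> fst k1 \<le> fst k"
  shows "k1 + (0, q j) \<in> supp (edge_poly j * a)"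
proof -
  have "coeff2 a k * coeff2 (edge_poly j) (k1 + (0, q j) - k) = 0" if k: "k \<in> supp a" "k \<noteq> k1" for k
  proof (rule ccontr)
    assume "coeff2 a k * coeff2 (edge_poly j) (k1 + (0, q j) - k) \<noteq> 0"
    then have e: "k1 + (0, q j) - k \<in> supp (edge_poly j)"
      by (simp add: supp_def)
    have "0 \<le> fst (k1 + (0, q j) - k)"
      using edge_poly_nonneg[OF e] by (simp add: less_eq_prod_def)
    then have "fst (k1 + (0, q j) - k) = 0"
      using a(3)[OF k(1)] by simp
    from edge_poly_fst_0[OF e this] k(2) show False
      by (simp add: prod_eq_iff)
  qed
  then have "coeff2 (a * edge_poly j) (k1 + (0, q j)) =
      (\<Sum>k\<in>supp a. if k = k1 then coeff2 a k1 * coeff2 (edge_poly j) (0, q j) else 0)"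
    unfolding coeff2_lpoly_mult[OF a(1)] by (intro sum.cong) auto
  also have "\<dots> \<noteq> 0"
    using a(1,2) edge_poly_left_end[of j] by (simp add: lpolys_def) (simp add: supp_def)
  finally show ?thesis
    by (simp add: supp_def mult.commute)
qed

lemma edge_poly_mult_right:
  assumes a: "a \<in> lpolys" "k2 \<in> supp a" "\<And>k. k \<in> supp a \<Longrightarrow> snd k2 \<le> snd k"
  shows "k2 + (p j, 0) \<in> supp (edge_poly j * a)"
proof -
  have "coeff2 a k * coeff2 (edge_poly j) (k2 + (p j, 0) - k) = 0" if k: "k \<in> supp a" "k \<noteq> k2" for k
  proof (rule ccontr)
    assume "coeff2 a k * coeff2 (edge_poly j) (k2 + (p j, 0) - k) \<noteq> 0"
    then have e: "k2 + (p j, 0) - k \<in> supp (edge_poly j)"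
      by (simp add: supp_def)
    have "0 \<le> snd (k2 + (p j, 0) - k)"
      using edge_poly_nonneg[OF e] by (simp add: less_eq_prod_def)
    then have "snd (k2 + (p j, 0) - k) = 0"
      using a(3)[OF k(1)] by simp
    from edge_poly_snd_0[OF e this] k(2) show False
      by (simp add: prod_eq_iff)
  qed
  then have "coeff2 (a * edge_poly j) (k2 + (p j, 0)) =
      (\<Sum>k\<in>supp a. if k = k2 then coeff2 a k2 * coeff2 (edge_poly j) (p j, 0) else 0)"
    unfolding coeff2_lpoly_mult[OF a(1)] by (intro sum.cong) auto
  also have "\<dots> \<noteq> 0"
    using a(1,2) edge_poly_right_end[of j] by (simp add: lpolys_def) (simp add: supp_def)
  finally show ?thesis
    by (simp add: supp_def mult.commute)
qed

text \<open>Each family of conditions on the quotient \<open>a\<close> is controlled by one extreme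
  monomial: the lowest for the right conditions, the leftmost for the left ones. Both are visible in
  \<open>g\<close>, displaced by an end of the segment whose weights are exactly the numbers
  \<open>M j i\<close> on that side.\<close>

lemma mixed_leading_quotient:
  assumes g: "g \<in> mixed j v" "g \<in> wfil (l j) m" "g \<in> ord_ge j (m + 1)"
  shows "\<exists>h\<in>mixed j (\<lambda>i. v i - M j i). h \<in> wfil (l j) (m - M j j) \<and>
    g - edge_poly j * h \<in> wfil (l j) (m + 1)"
proof -
  let ?v = "\<lambda>i. v i - M j i" and ?n = "m - M j j" and ?F = "edge_poly j"
  obtain a where a: "a \<in> lpolys" "\<And>k. k \<in> supp a \<Longrightarrow> wt (l j) k = ?n"
      and ga: "g - ?F * a \<in> wfil (l j) (m + 1)"
    using leading_form_divisible[OF g(2,3)] by blast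
  show ?thesis
  proof (cases "supp a = {}")
    case True
    then have "a = 0"
      by (intro coeff2_eqI) (auto simp: supp_def)
    then show ?thesis
      using ga scale2.subspace_0[OF subspace_mixed] by (intro bexI[of _ 0]) auto
  next
    case False
    have fin: "finite (supp a)"
      using a(1) by (simp add: lpolys_def)
    obtain k1 where k1: "k1 \<in> supp a" and k1_min: "\<And>k. k \<in> supp a \<Longrightarrow> fst k1 \<le> fst k"
      using arg_min_if_finite(1)[OF fin False, of fst] arg_min_least[OF fin False, of _ fst] by blast
    obtain k2 where k2: "k2 \<in> supp a" and k2_min: "\<And>k. k \<in> supp a \<Longrightarrow> snd k2 \<le> snd k"
      using arg_min_if_finite(1)[OF fin False, of snd] arg_min_least[OF fin False, of _ snd] by blast
    have supp_eq: "k \<in> supp g \<longleftrightarrow> k \<in> supp (?F * a)" if "wt (l j) k = m" for k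
      using wfil_coeff2[OF ga, of k] that by (simp add: supp_def)
    have g_left: "k1 + (0, q j) \<in> supp g"
      using edge_poly_mult_left[OF a(1) k1 k1_min] a(2)[OF k1] edge_poly_left_end[of j]
      by (subst supp_eq) (auto simp: wt_add supp_edge_poly)
    have g_right: "k2 + (p j, 0) \<in> supp g"
      using edge_poly_mult_right[OF a(1) k2 k2_min] a(2)[OF k2] edge_poly_right_end[of j]
      by (subst supp_eq) (auto simp: wt_add supp_edge_poly)
    have k2_cond: "right_cond j ?v k2"
    proof -
      have wt_p: "wt (l i) (p j, 0) = M j i" if "left_of j i" for i
        using M_right[OF that] by (simp add: wt_def)
      have "right_cond j v (k2 + (p j, 0))"
        using g(1) g_right unfolding mixed_iff by blast
      then show ?thesis
        by (auto simp: right_cond_def wt_add wt_p)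
    qed
    \<comment> \<open>All monomials of \<open>a\<close> have the same \<open>j\<close>-weight and
      \<open>k2\<close> is the lowest, so none lies below \<open>k2\<close> as a violation would
      require.\<close>
    have a_cond: "right_cond j ?v k" if k: "k \<in> supp a" for k
    proof (rule ccontr)
      assume "\<not> right_cond j ?v k"
      then have "snd (k - k2) < 0"
        using a(2)[OF k] a(2)[OF k2] by (intro not_right_cond_snd[OF k2_cond]) auto
      then show False
        using k2_min[OF k] by simp
    qed
    \<comment> \<open>Dividing by a power of \<open>y\<close> may create negative exponents of
      \<open>y\<close>, which \<open>left_part\<close> permits. It lowers the left bounds by exactly
      \<open>M j i\<close> and puts \<open>k1\<close> at the left end of the leading form, as
      \<open>lead_ray\<close> requires.\<close>
    define g' where "g' = mono2 (- (0, q j)) * g"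
    have supp_g': "k \<in> supp g' \<longleftrightarrow> k + (0, q j) \<in> supp g" for k
      by (simp only: g'_def supp_def mem_Collect_eq coeff2_mono2_mult diff_minus_eq_add)
    have g': "g' \<in> left_part j ?v"
      unfolding g'_def
    proof (rule left_part_mono2_mult)
      show "g \<in> left_part j v"
        using g(1) unfolding mixed_iff by blast
      show "(v i - M j i) - v i \<le> wt (l i) (- (0, q j))" if "left_of i j" for i
        using M_left[OF that] by (simp add: wt_def)
    qed simp
    have wt_q: "wt (l j) (0, q j) = M j j"
      by (simp add: wt_def M_self(2))
    have g'_wfil: "g' \<in> wfil (l j) ?n"
      using wfil_mult[OF wfil_mono2[OF order_refl, of "- (0, q j)" "l j"] g(2)]
      unfolding g'_def wt_uminus wt_q by simp
    have k1_min': "fst k1 \<le> fst k" if k: "k \<in> supp g'" "wt (l j) k = ?n" for k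
    proof -
      have "k + (0, q j) \<in> supp (?F * a)"
        using k supp_g' wt_q by (subst supp_eq[symmetric]) (simp_all add: wt_add)
      then obtain e n where en: "e \<in> supp ?F" "n \<in> supp a" "k + (0, q j) = e + n"
        using supp_mult[of ?F a] by blast
      have "fst k = fst e + fst n"
        using arg_cong[OF en(3), of fst] by simp
      then show ?thesis
        using edge_poly_nonneg[OF en(1)] k1_min[OF en(2)] by (simp add: less_eq_prod_def)
    qed
    have lead: "k \<in> lead j ?v" if k: "k \<in> supp a" for k
      using a(2) k1 k k1_min
      by (intro lead_ray[OF g' g'_wfil _ _ k1_min']) (auto simp: supp_g' g_left)
    obtain h where h: "h \<in> left_part j ?v" "h - a \<in> wfil (l j) (?n + 1)"
      using lead_realize[OF a(1), of j ?v ?n] lead a(2) by blast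
    have a_wfil: "a \<in> wfil (l j) ?n"
      using a(2) by (simp add: wfil_def)
    obtain h' where h': "h' \<in> mixed j ?v" "h' - a \<in> wfil (l j) (?n + 1)"
      using mixed_realize[OF lead[OF k1] a_cond[OF k1] a(2)[OF k1] h a_wfil a_cond] by blast
    have "h' \<in> wfil (l j) ?n"
      using h'(2) a_wfil wfil_mono[of ?n "?n + 1" "l j"] by (intro wfil_diff_iff[of h' a]) auto
    moreover have "?F * (h' - a) \<in> wfil (l j) (m + 1)"
      using wfil_mult[OF edge_poly_wfil h'(2)] by (simp add: algebra_simps)
    then have "(g - ?F * a) - ?F * (h' - a) \<in> wfil (l j) (m + 1)"
      using ga by blast
    then have "g - ?F * h' \<in> wfil (l j) (m + 1)"
      by (simp add: algebra_simps)
    ultimately show ?thesis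
      using h'(1) by blast
  qed
qed

lemma mixed_edge_factor_mult:
  assumes \<phi>: "edge_factor j N \<phi>" and h: "h \<in> mixed j (\<lambda>i. v i - M j i)"
  shows "\<phi> * h \<in> mixed j v"
proof -
  have \<phi>_q: "\<phi> \<in> qpolys"
    using \<phi> by (simp add: edge_factor_def)
  have "\<phi> * h \<in> ord_ge i (v i)" if "left_of i j" for i
    using ord_ge_mult[OF qpolys_lpolys[OF \<phi>_q] edge_factor_wfil[OF \<phi>], of h i "v i - M j i"] h that
    by (simp add: mixed_def)
  moreover have "\<phi> * h \<in> wfil (l i) (v i)" if "left_of j i" for i
    using wfil_mult[OF edge_factor_wfil[OF \<phi>, of i], of h "v i - M j i"] h that
    by (simp add: mixed_def)
  ultimately show ?thesis
    using \<phi>_q h by (simp add: mixed_def qpolys_mult)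
qed

text \<open>Modulo weight \<open>N\<close>, \<phi> is a multiple of \<open>f\<close>; multiplying by
  a polynomial, whose weights are nonnegative, keeps the error at weight at least
  \<open>N\<close>.\<close>

lemma edge_factor_mult_ord_ge:
  assumes \<phi>: "edge_factor j N \<phi>" and h: "h \<in> qpolys"
  shows "\<phi> * h \<in> ord_ge j N"
proof -
  obtain b where b: "b \<in> lpolys" "\<phi> - b * f \<in> wfil (l j) N" and \<phi>_q: "\<phi> \<in> qpolys"
    using \<phi> by (auto simp: edge_factor_def)
  have "(\<phi> - b * f) * h \<in> wfil (l j) N"
    using wfil_mult[OF b(2) qpolys_wfil[OF h]] by simp
  then have "\<phi> * h + (- b * h) * f \<in> wfil (l j) N"
    by (simp add: algebra_simps)
  moreover have "- b \<in> lpolys"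
    using lpolys_diff[OF lpolys_0 b(1)] by simp
  ultimately show ?thesis
    using qpolys_lpolys[OF \<phi>_q] qpolys_lpolys[OF h] by (intro ord_geI[of _ "- b * h"] lpolys_mult)
qed

text \<open>The distributivity behind the product formula: passing from a weight condition to an order
  condition for the \<open>j\<close>-th edge adds exactly the multiples of \<open>\<phi>\<close>.\<close>

lemma mixed_ord_ge_decompose:
  assumes \<phi>: "edge_factor j N \<phi>" and g: "g \<in> mixed j v" "g \<in> ord_ge j N"
  shows "\<exists>h\<in>mixed j (\<lambda>i. v i - M j i). g - \<phi> * h \<in> wfil (l j) N"
proof -
  \<comment> \<open>The remainder is pushed up from weight 0, which every polynomial has. In each
    step its leading form is divided by the edge polynomial; using \<phi> in place of the latter
    changes only terms of higher weight.\<close>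
  have *: "\<exists>h\<in>mixed j (\<lambda>i. v i - M j i). g - \<phi> * h \<in> wfil (l j) m" if "0 \<le> m" "m \<le> N" for m
    using that
  proof (induction m rule: int_ge_induct)
    case base
    show ?case
    proof (rule bexI[OF _ scale2.subspace_0[OF subspace_mixed]])
      show "g - \<phi> * 0 \<in> wfil (l j) 0"
        using g(1) by (simp add: mixed_def qpolys_wfil)
    qed
  next
    case (step m)
    then obtain h where h: "h \<in> mixed j (\<lambda>i. v i - M j i)" "g - \<phi> * h \<in> wfil (l j) m"
      by auto
    have 1: "g - \<phi> * h \<in> mixed j v"
      by (intro scale2.subspace_diff[OF subspace_mixed] g mixed_edge_factor_mult[OF \<phi>] h)
    have "g - \<phi> * h \<in> ord_ge j N"
      using h(1) by (intro scale2.subspace_diff[OF subspace_ord_ge] g edge_factor_mult_ord_ge[OF \<phi>])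
        (simp add: mixed_def)
    then have 2: "g - \<phi> * h \<in> ord_ge j (m + 1)"
      using step.prems ord_ge_mono[of "m + 1" N j] by auto
    obtain h1 where h1: "h1 \<in> mixed j (\<lambda>i. v i - M j i)" "h1 \<in> wfil (l j) (m - M j j)"
        "g - \<phi> * h - edge_poly j * h1 \<in> wfil (l j) (m + 1)"
      using mixed_leading_quotient[OF 1 h(2) 2] by blast
    have "\<phi> - edge_poly j \<in> wfil (l j) (M j j + 1)"
      using \<phi> by (simp add: edge_factor_def)
    from wfil_mult[OF this h1(2)] have "(\<phi> - edge_poly j) * h1 \<in> wfil (l j) (m + 1)"
      by (simp add: algebra_simps)
    with h1(3) have "(g - \<phi> * h - edge_poly j * h1) - (\<phi> - edge_poly j) * h1 \<in> wfil (l j) (m + 1)"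
      by blast
    then have "g - \<phi> * (h + h1) \<in> wfil (l j) (m + 1)"
      by (simp add: algebra_simps)
    then show ?case
      using scale2.subspace_add[OF subspace_mixed h(1) h1(1)] by blast
  qed
  show ?thesis
  proof (cases "0 \<le> N")
    case True
    then show ?thesis
      using * by blast
  next
    case False
    have "g \<in> wfil (l j) N"
      using g(1) qpolys_wfil[of g "l j"] wfil_mono[of N 0 "l j"] False by (auto simp: mixed_def)
    then show ?thesis
      using scale2.subspace_0[OF subspace_mixed] by (intro bexI[of _ 0]) auto
  qed
qed

lemma wfil_cancel_edge_factor:
  assumes \<phi>: "edge_factor j N \<phi>" and h: "h \<in> lpolys" "\<phi> * h \<in> wfil (l j) w"
  shows "h \<in> wfil (l j) (w - M j j)"
proof (rule wfil_mult_cancel[OF fst_pos snd_pos h(1) edge_factor_wfil[OF \<phi>] edge_factor_not_wfil[OF \<phi>]])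
  show "\<forall>k\<in>supp \<phi>. 0 \<le> k"
    using \<phi> by (simp add: edge_factor_def qpolys_def)
  show "h * \<phi> \<in> wfil (l j) w"
    using h(2) by (simp add: mult.commute)
qed

lemma edge_factor_nonzero: "edge_factor j N \<phi> \<Longrightarrow> \<phi> \<noteq> 0"
  using edge_factor_not_wfil by fastforce

end

section \<open>Dimensions of quotients\<close>

lemma subspace_mult_image:
  assumes U: "scale2.subspace U"
  shows "scale2.subspace ((*) a ` U)"
proof (rule scale2.subspaceI)
  show "0 \<in> (*) a ` U"
    using scale2.subspace_0[OF U] by (intro image_eqI[of _ _ 0]) auto
  show "x + y \<in> (*) a ` U" if "x \<in> (*) a ` U" "y \<in> (*) a ` U" for x y
    using that scale2.subspace_add[OF U] by (auto simp: distrib_left[symmetric])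
  show "scale2 c x \<in> (*) a ` U" if x: "x \<in> (*) a ` U" for c x
  proof -
    obtain u where "u \<in> U" "x = a * u"
      using x by blast
    then show ?thesis
      using scale2.subspace_scale[OF U, of u c]
      by (intro image_eqI[of _ _ "scale2 c u"]) (simp_all add: scale2_mult_right)
  qed
qed

text \<open>Existence of coefficients is spanning modulo \<open>W\<close>; uniqueness, applied to
  the class of 0, is independence modulo \<open>W\<close>.\<close>

lemma quotient_basis_iff:
  assumes "scale2.subspace V" "scale2.subspace W"
  shows "quotient_basis V W B \<longleftrightarrow> finite B \<and> B \<subseteq> V \<and>
    (\<forall>c. (\<Sum>b\<in>B. scale2 (c b) b) \<in> W \<longrightarrow> (\<forall>b\<in>B. c b = 0)) \<and>
    (\<forall>g\<in>V. \<exists>c. g - (\<Sum>b\<in>B. scale2 (c b) b) \<in> W)"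
    (is "_ \<longleftrightarrow> _ \<and> _ \<and> ?I \<and> ?S")
proof (intro iffI conjI)
  assume qb: "quotient_basis V W B"
  then show "finite B"
    unfolding quotient_basis_def by (elim conjE)
  from qb show "B \<subseteq> V"
    unfolding quotient_basis_def by (elim conjE)
  have ex1: "\<exists>!c. c \<in> B \<rightarrow>\<^sub>E UNIV \<and> g - (\<Sum>b\<in>B. scale2 (c b) b) \<in> W" if "g \<in> V" for g
    using qb that unfolding quotient_basis_def by (elim conjE) (rule bspec)
  show ?S
  proof
    fix g assume "g \<in> V"
    from ex1[OF this] show "\<exists>c. g - (\<Sum>b\<in>B. scale2 (c b) b) \<in> W"
      by (elim ex1E conjE) (rule exI)
  qed
  show ?I
  proof (intro allI impI ballI)
    fix c b assume c: "(\<Sum>b\<in>B. scale2 (c b) b) \<in> W" and b: "b \<in> B"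
    have 1: "restrict c B \<in> B \<rightarrow>\<^sub>E UNIV \<and> 0 - (\<Sum>b\<in>B. scale2 (restrict c B b) b) \<in> W"
      using scale2.subspace_neg[OF assms(2) c] by simp
    have 2: "restrict (\<lambda>b. 0) B \<in> B \<rightarrow>\<^sub>E UNIV \<and>
        0 - (\<Sum>b\<in>B. scale2 (restrict (\<lambda>b. 0) B b) b) \<in> W"
      using scale2.subspace_0[OF assms(2)] by simp
    have "restrict c B = restrict (\<lambda>b. 0) B"
      by (rule trans[OF sym])
        (rule the1_equality[OF ex1[OF scale2.subspace_0[OF assms(1)]]], rule 1 2)+
    from fun_cong[OF this, of b] show "c b = 0"
      using b by simp
  qed
next
  assume r: "finite B \<and> B \<subseteq> V \<and> ?I \<and> ?S"
  have "\<exists>!c. c \<in> B \<rightarrow>\<^sub>E UNIV \<and> g - (\<Sum>b\<in>B. scale2 (c b) b) \<in> W" if g: "g \<in> V" for g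
  proof -
    obtain c where c: "g - (\<Sum>b\<in>B. scale2 (c b) b) \<in> W"
      using bspec[OF conjunct2[OF conjunct2[OF conjunct2[OF r]]] g] by (rule exE)
    have "c' = restrict c B"
      if c': "c' \<in> B \<rightarrow>\<^sub>E UNIV \<and> g - (\<Sum>b\<in>B. scale2 (c' b) b) \<in> W" for c'
    proof -
      have "(g - (\<Sum>b\<in>B. scale2 (c b) b)) - (g - (\<Sum>b\<in>B. scale2 (c' b) b)) \<in> W"
        by (rule scale2.subspace_diff[OF assms(2) c conjunct2[OF c']])
      also have "(g - (\<Sum>b\<in>B. scale2 (c b) b)) - (g - (\<Sum>b\<in>B. scale2 (c' b) b)) =
          (\<Sum>b\<in>B. scale2 (c' b - c b) b)"
        by (simp add: scale2.scale_left_diff_distrib sum_subtractf)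
      finally have "\<forall>b\<in>B. c' b - c b = 0"
        by (rule mp[OF spec[OF conjunct1[OF conjunct2[OF conjunct2[OF r]]]]])
      then show ?thesis
        using conjunct1[OF c'] by (intro PiE_ext[of _ B "\<lambda>_. UNIV"]) auto
    qed
    moreover have "restrict c B \<in> B \<rightarrow>\<^sub>E UNIV \<and> g - (\<Sum>b\<in>B. scale2 (restrict c B b) b) \<in> W"
      using c by simp
    ultimately show ?thesis
      by (intro ex1I[of _ "restrict c B"])
  qed
  then have "\<forall>g\<in>V. \<exists>!c. c \<in> B \<rightarrow>\<^sub>E UNIV \<and> g - (\<Sum>b\<in>B. scale2 (c b) b) \<in> W"
    by (intro ballI)
  with conjunct1[OF r] conjunct1[OF conjunct2[OF r]] show "quotient_basis V W B"
    unfolding quotient_basis_def by (intro conjI)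
qed

lemma quotient_basisD:
  assumes "scale2.subspace V" "scale2.subspace W" "quotient_basis V W B"
  shows "finite B" "B \<subseteq> V"
    and "(\<Sum>b\<in>B. scale2 (c b) b) \<in> W \<Longrightarrow> \<forall>b\<in>B. c b = 0"
    and "g \<in> V \<Longrightarrow> \<exists>c. g - (\<Sum>b\<in>B. scale2 (c b) b) \<in> W"
proof -
  note * = iffD1[OF quotient_basis_iff[OF assms(1,2)] assms(3)]
  show "finite B" "B \<subseteq> V"
    by (rule conjunct1[OF *] conjunct1[OF conjunct2[OF *]])+
  show "(\<Sum>b\<in>B. scale2 (c b) b) \<in> W \<Longrightarrow> \<forall>b\<in>B. c b = 0"
    by (rule mp[OF spec[OF conjunct1[OF conjunct2[OF conjunct2[OF *]]]]])
  show "g \<in> V \<Longrightarrow> \<exists>c. g - (\<Sum>b\<in>B. scale2 (c b) b) \<in> W"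
    by (rule bspec[OF conjunct2[OF conjunct2[OF conjunct2[OF *]]]])
qed

text \<open>A relational form of the dimension, which includes the existence of a finite basis and
  so avoids reasoning under the description operator of \<open>quotient_dim\<close>.\<close>

definition has_qdim :: "complex fls fls set \<Rightarrow> complex fls fls set \<Rightarrow> nat \<Rightarrow> bool" where
  "has_qdim V W n \<longleftrightarrow> (\<exists>B. quotient_basis V W B \<and> card B = n)"

text \<open>Steinitz exchange modulo \<open>W\<close>: representatives of \<open>B\<close> in the
  span of \<open>S\<close> remain distinct and independent, so the bound in an honest vector space
  applies.\<close>

lemma card_le_of_independent_mod:
  assumes W: "scale2.subspace W" and S: "finite S" and B: "finite B"
    and BS: "\<And>b. b \<in> B \<Longrightarrow> \<exists>s\<in>scale2.span S. b - s \<in> W"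
    and indep: "\<And>c. (\<Sum>b\<in>B. scale2 (c b) b) \<in> W \<Longrightarrow> \<forall>b\<in>B. c b = 0"
  shows "card B \<le> card S"
proof -
  obtain p where p: "\<And>b. b \<in> B \<Longrightarrow> p b \<in> scale2.span S \<and> b - p b \<in> W"
    using BS by metis
  have indep_p: "\<forall>b\<in>B. c b = 0" if c: "(\<Sum>b\<in>B. scale2 (c b) (p b)) = 0" for c
  proof (rule indep)
    have "(\<Sum>b\<in>B. scale2 (c b) (b - p b)) \<in> W"
      using p by (intro scale2.subspace_sum[OF W] scale2.subspace_scale[OF W]) auto
    then show "(\<Sum>b\<in>B. scale2 (c b) b) \<in> W"
      using c by (simp add: scale2.scale_right_diff_distrib sum_subtractf)
  qed
  have inj: "inj_on p B"
  proof (rule inj_onI, rule ccontr)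
    fix a b assume ab: "a \<in> B" "b \<in> B" "p a = p b" "a \<noteq> b"
    define c :: "complex fls fls \<Rightarrow> complex" where "c x = (if x = a then 1 else if x = b then -1 else 0)" for x
    have "(\<Sum>x\<in>B. scale2 (c x) (p x)) = (\<Sum>x\<in>{a, b}. scale2 (c x) (p x))"
      using ab B by (intro sum.mono_neutral_right) (auto simp: c_def)
    also have "\<dots> = 0"
      using ab by (simp add: c_def)
    finally have "c a = 0"
      using bspec[OF indep_p ab(1)] by simp
    then show False
      by (simp add: c_def)
  qed
  have "scale2.independent (p ` B)"
  proof (subst scale2.independent_explicit_finite_subsets, intro allI impI ballI)
    fix A u v
    assume A: "A \<subseteq> p ` B" "finite A" and u: "(\<Sum>v\<in>A. scale2 (u v) v) = 0" and v: "v \<in> A"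
    define c where "c x = (if p x \<in> A then u (p x) else 0)" for x
    have "(\<Sum>b\<in>B. scale2 (c b) (p b)) = (\<Sum>v\<in>p ` B. if v \<in> A then scale2 (u v) v else 0)"
      unfolding sum.reindex[OF inj] by (intro sum.cong) (auto simp: c_def)
    also have "\<dots> = (\<Sum>v\<in>A. scale2 (u v) v)"
      using A B by (simp add: sum.If_cases Int_absorb1)
    finally have "\<forall>b\<in>B. c b = 0"
      using u indep_p by simp
    then show "u v = 0"
      using A v by (force simp: c_def)
  qed
  moreover have "p ` B \<subseteq> scale2.span S"
    using p by auto
  ultimately have "card (p ` B) \<le> card S"
    using scale2.independent_span_bound[OF S] by blast
  then show ?thesis
    by (simp add: card_image[OF inj])
qed

lemma span_approx:
  assumes "scale2.subspace V" "scale2.subspace W" "quotient_basis V W B" "g \<in> V"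
  shows "\<exists>s\<in>scale2.span B. g - s \<in> W"
proof -
  obtain c where "g - (\<Sum>b\<in>B. scale2 (c b) b) \<in> W"
    using quotient_basisD(4)[OF assms] by (rule exE)
  moreover have "(\<Sum>b\<in>B. scale2 (c b) b) \<in> scale2.span B"
    by (intro scale2.span_sum scale2.span_scale scale2.span_base)
  ultimately show ?thesis
    by blast
qed

context
  fixes V W :: "complex fls fls set"
  assumes V: "scale2.subspace V" and W: "scale2.subspace W"
begin

lemma has_qdim_le:
  assumes "has_qdim V W n" "has_qdim V W m"
  shows "n \<le> m"
proof -
  obtain B C where B: "quotient_basis V W B" "card B = n" and C: "quotient_basis V W C" "card C = m"
    using assms by (auto simp: has_qdim_def)
  have "card B \<le> card C"
  proof (rule card_le_of_independent_mod[OF W])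
    show "\<exists>s\<in>scale2.span C. b - s \<in> W" if "b \<in> B" for b
      by (rule span_approx[OF V W C(1) subsetD[OF quotient_basisD(2)[OF V W B(1)] that]])
  qed (fact quotient_basisD(1,3)[OF V W B(1)] quotient_basisD(1)[OF V W C(1)])+
  then show ?thesis
    by (simp add: B C)
qed

lemma has_qdim_unique: "has_qdim V W n \<Longrightarrow> has_qdim V W m \<Longrightarrow> n = m"
  using has_qdim_le by (blast intro: antisym)

lemma quotient_dim_eq: "has_qdim V W n \<Longrightarrow> quotient_dim V W = n"
  unfolding quotient_dim_def has_qdim_def[symmetric] using has_qdim_unique by blast

text \<open>The sizes of families independent modulo \<open>W\<close> are bounded by
  \<open>card S\<close>; one of maximal size spans, since adding a further element gives a relation
  that can be solved for it.\<close>

lemma has_qdim_exists: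
  assumes S: "finite S" "\<And>g. g \<in> V \<Longrightarrow> \<exists>s\<in>scale2.span S. g - s \<in> W"
  shows "\<exists>n. has_qdim V W n"
proof -
  define ind where "ind B \<longleftrightarrow> finite B \<and> B \<subseteq> V \<and>
    (\<forall>c. (\<Sum>b\<in>B. scale2 (c b) b) \<in> W \<longrightarrow> (\<forall>b\<in>B. c b = 0))" for B
  have bound: "card B \<le> card S" if B: "ind B" for B
  proof (rule card_le_of_independent_mod[OF W S(1)])
    show "finite B"
      using B by (simp add: ind_def)
    show "\<forall>b\<in>B. c b = 0" if "(\<Sum>b\<in>B. scale2 (c b) b) \<in> W" for c
      using B that unfolding ind_def by (elim conjE allE[of _ c]) (rule mp)
    show "\<exists>s\<in>scale2.span S. b - s \<in> W" if "b \<in> B" for b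
      using B that by (intro S(2)) (auto simp: ind_def)
  qed
  define N where "N = Max (card ` Collect ind)"
  have "card ` Collect ind \<subseteq> {..card S}"
    using bound by auto
  then have fin: "finite (card ` Collect ind)"
    by (rule finite_subset) simp
  have "ind {}"
    by (simp add: ind_def)
  then have "N \<in> card ` Collect ind"
    unfolding N_def using fin by (intro Max_in) auto
  then obtain B where B: "ind B" "card B = N"
    by auto
  have "\<exists>c. g - (\<Sum>b\<in>B. scale2 (c b) b) \<in> W" if g: "g \<in> V" for g
  proof (cases "g \<in> B")
    case True
    have "(\<Sum>b\<in>B. scale2 (if b = g then 1 else 0) b) = (\<Sum>b\<in>B. if b = g then g else 0)"
      by (intro sum.cong) auto
    also have "\<dots> = g"
      using True B by (simp add: ind_def)
    finally have "g - (\<Sum>b\<in>B. scale2 (if b = g then 1 else 0) b) \<in> W"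
      using scale2.subspace_0[OF W] by simp
    then show ?thesis
      by (rule exI[of _ "\<lambda>b. if b = g then 1 else 0"])
  next
    case False
    have "\<not> ind (insert g B)"
    proof
      assume i: "ind (insert g B)"
      then have "card (insert g B) \<le> N"
        unfolding N_def using fin by (intro Max_ge) auto
      then show False
        using False B by (simp add: ind_def)
    qed
    then obtain c where c: "(\<Sum>b\<in>insert g B. scale2 (c b) b) \<in> W" "\<exists>b\<in>insert g B. c b \<noteq> 0"
      using B(1) g by (auto simp: ind_def)
    then have sum: "scale2 (c g) g + (\<Sum>b\<in>B. scale2 (c b) b) \<in> W"
      using False B(1) by (simp add: ind_def)
    have "c g \<noteq> 0"
    proof
      assume "c g = 0"
      then have "\<forall>b\<in>B. c b = 0"
        using sum B(1) by (simp add: ind_def)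
      then show False
        using c(2) \<open>c g = 0\<close> by auto
    qed
    then have "scale2 (inverse (c g)) (scale2 (c g) g + (\<Sum>b\<in>B. scale2 (c b) b)) =
        g - (\<Sum>b\<in>B. scale2 (- (c b / c g)) b)"
      by (simp add: scale2.scale_right_distrib scale2.scale_sum_right sum_negf divide_inverse mult.commute)
    then show ?thesis
      using scale2.subspace_scale[OF W sum, of "inverse (c g)"]
      by (intro exI[of _ "\<lambda>b. - (c b / c g)"]) simp
  qed
  with B(1) have "quotient_basis V W B"
    unfolding quotient_basis_iff[OF V W] ind_def by (intro conjI ballI) simp_all
  then show ?thesis
    by (auto simp: has_qdim_def)
qed

text \<open>Second isomorphism theorem: the same basis serves for both quotients.\<close>

lemma has_qdim_sum:
  assumes "has_qdim V (V \<inter> W) n"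
  shows "has_qdim {v + w | v w. v \<in> V \<and> w \<in> W} W n"
proof -
  obtain B where qB: "quotient_basis V (V \<inter> W) B" and n: "card B = n"
    using assms by (auto simp: has_qdim_def)
  note B = quotient_basisD[OF V scale2.subspace_inter[OF V W] qB]
  have "\<exists>c. v + w - (\<Sum>b\<in>B. scale2 (c b) b) \<in> W" if "v \<in> V" "w \<in> W" for v w
  proof -
    obtain c where "v - (\<Sum>b\<in>B. scale2 (c b) b) \<in> V \<inter> W"
      using B(4)[OF \<open>v \<in> V\<close>] by (rule exE)
    then have "(v - (\<Sum>b\<in>B. scale2 (c b) b)) + w \<in> W"
      using \<open>w \<in> W\<close> scale2.subspace_add[OF W] by blast
    then show ?thesis
      by (intro exI[of _ c]) (simp add: algebra_simps)
  qed
  moreover have "\<forall>b\<in>B. c b = 0" if "(\<Sum>b\<in>B. scale2 (c b) b) \<in> W" for c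
    using that B(2) by (intro B(3) IntI scale2.subspace_sum[OF V] scale2.subspace_scale[OF V]) auto
  moreover have "B \<subseteq> {v + w | v w. v \<in> V \<and> w \<in> W}"
    using B(2) scale2.subspace_0[OF W] by force
  ultimately have "quotient_basis {v + w | v w. v \<in> V \<and> w \<in> W} W B"
    using B(1) by (subst quotient_basis_iff[OF scale2.subspace_sums[OF V W] W]) auto
  then show ?thesis
    using n by (auto simp: has_qdim_def)
qed

lemma has_qdim_mult:
  assumes "has_qdim V W n" "a \<noteq> 0"
  shows "has_qdim ((*) a ` V) ((*) a ` W) n"
proof -
  obtain B where qB: "quotient_basis V W B" and n: "card B = n"
    using assms by (auto simp: has_qdim_def)
  note B = quotient_basisD[OF V W qB]
  note sub = subspace_mult_image
  have inj: "inj_on ((*) a) A" for A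
    using assms(2) by (auto simp: inj_on_def)
  have sum: "(\<Sum>b\<in>(*) a ` B. scale2 (c b) b) = a * (\<Sum>b\<in>B. scale2 (c (a * b)) b)" for c
    by (simp add: sum.reindex[OF inj] sum_distrib_left scale2_mult_right)
  have "\<forall>b\<in>(*) a ` B. c b = 0" if "(\<Sum>b\<in>(*) a ` B. scale2 (c b) b) \<in> (*) a ` W" for c
    using that B(3)[of "\<lambda>b. c (a * b)"] assms(2) by (auto simp: sum)
  moreover have "\<exists>c. a * g - (\<Sum>b\<in>(*) a ` B. scale2 (c b) b) \<in> (*) a ` W" if "g \<in> V" for g
  proof -
    obtain c where "g - (\<Sum>b\<in>B. scale2 (c b) b) \<in> W"
      using B(4)[OF \<open>g \<in> V\<close>] by (rule exE)
    then have "a * g - (\<Sum>b\<in>(*) a ` B. scale2 (c (b / a)) b) \<in> (*) a ` W"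
      using assms(2) by (auto simp: sum right_diff_distrib[symmetric])
    then show ?thesis
      by (rule exI[of _ "\<lambda>b. c (b / a)"])
  qed
  ultimately have "quotient_basis ((*) a ` V) ((*) a ` W) ((*) a ` B)"
    using B(1,2) by (subst quotient_basis_iff[OF sub[OF V] sub[OF W]]) auto
  then show ?thesis
    using n card_image[OF inj] by (auto simp: has_qdim_def)
qed

end

text \<open>Third isomorphism theorem: bases of the two steps are disjoint, and their union is a
  basis of the whole.\<close>

lemma has_qdim_trans:
  assumes sub: "scale2.subspace U" "scale2.subspace V" "scale2.subspace W" and le: "W \<subseteq> V" "V \<subseteq> U"
    and UV: "has_qdim U V m" and VW: "has_qdim V W n"
  shows "has_qdim U W (m + n)"
proof -
  obtain B where qB: "quotient_basis U V B" and m: "card B = m"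
    using UV by (auto simp: has_qdim_def)
  note B = quotient_basisD[OF sub(1,2) qB]
  obtain C where qC: "quotient_basis V W C" and n: "card C = n"
    using VW by (auto simp: has_qdim_def)
  note C = quotient_basisD[OF sub(2,3) qC]
  have disj: "B \<inter> C = {}"
  proof (rule ccontr)
    assume "B \<inter> C \<noteq> {}"
    then obtain x where x: "x \<in> B" "x \<in> C"
      by blast
    have "(\<Sum>b\<in>B. scale2 (if b = x then 1 else 0) b) = (\<Sum>b\<in>B. if b = x then x else 0)"
      by (intro sum.cong) auto
    also have "\<dots> = x"
      using x B(1) by simp
    finally have "\<forall>b\<in>B. (if b = x then 1 else 0) = (0 :: complex)"
      using x C(2) by (intro B(3)) auto
    then show False
      using x by auto
  qed
  have sum: "(\<Sum>b\<in>B \<union> C. scale2 (c b) b) = (\<Sum>b\<in>B. scale2 (c b) b) + (\<Sum>b\<in>C. scale2 (c b) b)" for c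
    using disj B(1) C(1) by (intro sum.union_disjoint)
  have CV: "(\<Sum>b\<in>C. scale2 (c b) b) \<in> V" for c
    using C(2) by (intro scale2.subspace_sum[OF sub(2)] scale2.subspace_scale[OF sub(2)]) auto
  have "\<forall>b\<in>B \<union> C. c b = 0" if c: "(\<Sum>b\<in>B \<union> C. scale2 (c b) b) \<in> W" for c
  proof -
    have "((\<Sum>b\<in>B. scale2 (c b) b) + (\<Sum>b\<in>C. scale2 (c b) b)) - (\<Sum>b\<in>C. scale2 (c b) b) \<in> V"
      using c le(1) CV by (intro scale2.subspace_diff[OF sub(2)]) (auto simp: sum)
    then have 0: "\<forall>b\<in>B. c b = 0"
      by (intro B(3)) simp
    then have "(\<Sum>b\<in>B. scale2 (c b) b) = 0"
      by simp
    then show ?thesis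
      using 0 c C(3)[of c] by (auto simp: sum)
  qed
  moreover have "\<exists>c. g - (\<Sum>b\<in>B \<union> C. scale2 (c b) b) \<in> W" if "g \<in> U" for g
  proof -
    obtain c where c: "g - (\<Sum>b\<in>B. scale2 (c b) b) \<in> V"
      using B(4)[OF \<open>g \<in> U\<close>] by (rule exE)
    obtain d where d: "g - (\<Sum>b\<in>B. scale2 (c b) b) - (\<Sum>b\<in>C. scale2 (d b) b) \<in> W"
      using C(4)[OF c] by (rule exE)
    define e where "e b = (if b \<in> B then c b else d b)" for b
    have "(\<Sum>b\<in>B. scale2 (e b) b) = (\<Sum>b\<in>B. scale2 (c b) b)"
      by (simp add: e_def)
    moreover have "(\<Sum>b\<in>C. scale2 (e b) b) = (\<Sum>b\<in>C. scale2 (d b) b)"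
      using disj by (intro sum.cong) (auto simp: e_def)
    ultimately show ?thesis
      using d by (intro exI[of _ e]) (simp add: sum diff_diff_eq)
  qed
  ultimately have "quotient_basis U W (B \<union> C)"
    using B(1,2) C(1,2) le by (subst quotient_basis_iff[OF sub(1,3)]) auto
  moreover have "card (B \<union> C) = m + n"
    using disj B(1) C(1) m n by (simp add: card_Un_disjoint)
  ultimately show ?thesis
    by (auto simp: has_qdim_def)
qed

no_notation fps_nth (infixl \<open>$\<close> 75)

section \<open>Codimensions of the interpolating filtrations\<close>

context edge_data
begin

text \<open>Interpolates between the monomial filtration (\<open>A\<close> empty) and the
  polynomials in the filtration by the v''_i (\<open>A\<close> everything).\<close>

definition jfil :: "'i set \<Rightarrow> int ^ 'i \<Rightarrow> complex fls fls set" where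
  "jfil A v = {g \<in> qpolys. \<forall>i. g \<in> (if i \<in> A then ord_ge i (v $ i) else wfil (l i) (v $ i))}"

lemma subspace_jfil: "scale2.subspace (jfil A v)"
proof -
  have "jfil A v = qpolys \<inter> (\<Inter>i. (if i \<in> A then ord_ge i (v $ i) else wfil (l i) (v $ i)))"
    by (auto simp: jfil_def)
  moreover have "scale2.subspace (\<Inter>i. (if i \<in> A then ord_ge i (v $ i) else wfil (l i) (v $ i)))"
    by (rule scale2.subspace_Inter) (auto simp: subspace_ord_ge subspace_wfil)
  ultimately show ?thesis
    by (simp add: scale2.subspace_inter subspace_qpolys)
qed

lemma jfil_qpolys: "jfil A v \<subseteq> qpolys"
  by (auto simp: jfil_def)

lemma wfil_jfil: "g \<in> qpolys \<Longrightarrow> (\<And>i. g \<in> wfil (l i) (v $ i)) \<Longrightarrow> g \<in> jfil A v"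
  by (auto simp: jfil_def intro: wfil_ord_ge qpolys_lpolys)

lemma wfil_mixed: "g \<in> qpolys \<Longrightarrow> (\<And>i. g \<in> wfil (l i) (v $ i)) \<Longrightarrow> g \<in> mixed j (($) v)"
  by (auto simp: mixed_def intro: wfil_ord_ge qpolys_lpolys)

definition small :: "int ^ 'i \<Rightarrow> (int \<times> int) set" where
  "small v = {k. 0 \<le> k \<and> (\<exists>i. wt (l i) k < v $ i)}"

lemma finite_small: "finite (small v)"
proof (rule finite_subset)
  show "small v \<subseteq> (\<Union>i. {k. 0 \<le> k \<and> wt (l i) k \<le> v $ i})"
    by (auto simp: small_def intro: less_imp_le)
  show "finite (\<Union>i. {k. 0 \<le> k \<and> wt (l i) k \<le> v $ i})"
    by (simp add: finite_wt_le[OF fst_pos snd_pos])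
qed

lemma small_remainder:
  assumes "g \<in> qpolys"
  shows "g - restr (small v) g \<in> qpolys" "g - restr (small v) g \<in> wfil (l i) (v $ i)"
proof -
  have fin: "finite (small v \<inter> supp g)"
    using finite_small by blast
  have "0 \<le> k \<and> v $ i \<le> wt (l i) k" if k: "k \<in> supp g - small v" for k
    using assms k by (auto simp: qpolys_def small_def not_less)
  then show "g - restr (small v) g \<in> qpolys" "g - restr (small v) g \<in> wfil (l i) (v $ i)"
    using assms restr_in_lpolys[OF fin]
    by (auto simp: qpolys_def wfil_def supp_diff_restr[OF fin])
qed

lemma restr_in_span: "restr S g \<in> scale2.span (mono2 ` S)"
  unfolding restr_def by (intro scale2.span_sum scale2.span_scale scale2.span_base) auto

text \<open>The finitely many monomials violating some weight bound span \<open>V\<close> modulo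
  \<open>W\<close>.\<close>

lemma has_qdim_cofinite:
  assumes "scale2.subspace V" "scale2.subspace W" "V \<subseteq> qpolys"
    and W: "\<And>g. g \<in> qpolys \<Longrightarrow> (\<And>i. g \<in> wfil (l i) (v $ i)) \<Longrightarrow> g \<in> W"
  shows "has_qdim V W (quotient_dim V W)"
proof -
  have "\<exists>n. has_qdim V W n"
  proof (rule has_qdim_exists[OF assms(1,2)])
    show "finite (mono2 ` small v)"
      by (intro finite_imageI finite_small)
    fix g assume "g \<in> V"
    then have "g - restr (small v) g \<in> W"
      using small_remainder assms(3) by (intro W) auto
    then show "\<exists>s\<in>scale2.span (mono2 ` small v). g - s \<in> W"
      using restr_in_span by blast
  qed
  then show ?thesis
    using quotient_dim_eq[OF assms(1,2)] by metis
qed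

definition hilb :: "'i set \<Rightarrow> int ^ 'i \<Rightarrow> nat" where
  "hilb A v = quotient_dim qpolys (jfil A v)"

lemma has_qdim_hilb: "has_qdim qpolys (jfil A v) (hilb A v)"
  unfolding hilb_def by (rule has_qdim_cofinite[OF subspace_qpolys subspace_jfil _ wfil_jfil]) auto

definition mixed_codim :: "'i \<Rightarrow> int ^ 'i \<Rightarrow> nat" where
  "mixed_codim j v = quotient_dim qpolys (mixed j (($) v))"

lemma has_qdim_mixed: "has_qdim qpolys (mixed j (($) v)) (mixed_codim j v)"
  unfolding mixed_codim_def by (rule has_qdim_cofinite[OF subspace_qpolys subspace_mixed _ wfil_mixed]) auto

lemma mixed_codim_cong: "(\<And>i. i \<noteq> j \<Longrightarrow> v $ i = w $ i) \<Longrightarrow> mixed_codim j v = mixed_codim j w"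
proof -
  assume "\<And>i. i \<noteq> j \<Longrightarrow> v $ i = w $ i"
  then have "v $ i = w $ i" if "left_of i j \<or> left_of j i" for i
    using that left_of_irrefl by metis
  then have "mixed j (($) v) = mixed j (($) w)"
    by (auto simp: mixed_def)
  then show ?thesis
    by (simp add: mixed_codim_def)
qed

definition Mvec :: "'i \<Rightarrow> int ^ 'i" where
  "Mvec j = (\<chi> i. M j i)"

lemma jfil_left: "jfil {i. left_of i j} v = mixed j (($) v) \<inter> wfil (l j) (v $ j)"
  using left_of_cases[of _ j] left_of_irrefl[of j] left_of_asym
  by (auto simp: jfil_def mixed_def split: if_splits) metis+

lemma jfil_left_insert: "jfil (insert j {i. left_of i j}) v = mixed j (($) v) \<inter> ord_ge j (v $ j)"
  using left_of_cases[of _ j] left_of_irrefl[of j] left_of_asym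
  by (auto simp: jfil_def mixed_def split: if_splits) metis+

text \<open>The number \<open>y\<close> is computed twice: as the codimension of J(v - M_j) in X(v -
  M_j), and, through multiplication by \<phi>, as that of J(v) in J'(v). Eliminating it gives the
  recursion.\<close>

lemma hilb_insert:
  "int (hilb (insert j {i. left_of i j}) v) = int (hilb {i. left_of i j} v) -
    int (hilb {i. left_of i j} (v - Mvec j)) + int (mixed_codim j (v - Mvec j))"
proof -
  obtain \<phi> where \<phi>: "edge_factor j (v $ j) \<phi>"
    using edge_factor_exists by blast
  let ?A = "{i. left_of i j}" and ?w = "v - Mvec j"
  define X where "X = mixed j (($) v)"
  define X' where "X' = mixed j (($) ?w)"
  have X'_alt: "X' = mixed j (\<lambda>i. v $ i - M j i)"
  proof -
    have "($) ?w = (\<lambda>i. v $ i - M j i)"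
      by (simp add: fun_eq_iff Mvec_def)
    then show ?thesis
      by (simp add: X'_def)
  qed
  have sub: "scale2.subspace X" "scale2.subspace X'"
    by (simp_all add: X_def X'_def subspace_mixed)
  have mult_X: "\<phi> * h \<in> X" if "h \<in> X'" for h
    using mixed_edge_factor_mult[OF \<phi>, of h "($) v"] that by (simp add: X_def X'_alt)
  have X'_q: "X' \<subseteq> qpolys"
    by (auto simp: X'_def mixed_def)
  have JM: "jfil ?A ?w = X' \<inter> wfil (l j) (v $ j - M j j)"
    unfolding jfil_left X'_def Mvec_def by simp
  have J: "jfil ?A v = X \<inter> wfil (l j) (v $ j)"
    unfolding jfil_left X_def ..
  have Jj: "jfil (insert j ?A) v = X \<inter> ord_ge j (v $ j)"
    unfolding jfil_left_insert X_def ..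
  define y where "y = quotient_dim X' (jfil ?A ?w)"
  have y: "has_qdim X' (jfil ?A ?w) y"
    unfolding y_def by (rule has_qdim_cofinite[OF sub(2) subspace_jfil X'_q wfil_jfil])
  have "has_qdim qpolys (jfil ?A ?w) (mixed_codim j ?w + y)"
    using has_qdim_mixed[of j ?w] y X'_q JM
    by (intro has_qdim_trans[OF subspace_qpolys sub(2) subspace_jfil]) (auto simp: X'_def)
  then have 1: "hilb ?A ?w = mixed_codim j ?w + y"
    using has_qdim_unique[OF subspace_qpolys subspace_jfil has_qdim_hilb] by blast
  \<comment> \<open>The \<open>j\<close>-weight of \<phi> is exactly \<open>M j j\<close>, so the
    weight condition on a multiple of \<phi> passes to the cofactor with no loss.\<close>
  have inter: "(*) \<phi> ` X' \<inter> jfil ?A v = (*) \<phi> ` jfil ?A ?w"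
  proof (intro equalityI subsetI)
    fix g assume "g \<in> (*) \<phi> ` X' \<inter> jfil ?A v"
    then obtain h where h: "h \<in> X'" "g = \<phi> * h" "\<phi> * h \<in> wfil (l j) (v $ j)"
      by (auto simp: J)
    then have "h \<in> wfil (l j) (v $ j - M j j)"
      using X'_q by (intro wfil_cancel_edge_factor[OF \<phi>]) (auto intro: qpolys_lpolys)
    then show "g \<in> (*) \<phi> ` jfil ?A ?w"
      using h JM by auto
  next
    fix g assume "g \<in> (*) \<phi> ` jfil ?A ?w"
    then obtain h where h: "h \<in> X'" "h \<in> wfil (l j) (v $ j - M j j)" "g = \<phi> * h"
      by (auto simp: JM)
    have "g \<in> wfil (l j) (v $ j)"
      using wfil_mult[OF edge_factor_wfil[OF \<phi>] h(2)] by (simp add: h(3))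
    then show "g \<in> (*) \<phi> ` X' \<inter> jfil ?A v"
      using h(1,3) mult_X by (auto simp: J)
  qed
  have sum: "{a + b | a b. a \<in> (*) \<phi> ` X' \<and> b \<in> jfil ?A v} = jfil (insert j ?A) v"
  proof (intro equalityI subsetI)
    fix g assume "g \<in> {a + b | a b. a \<in> (*) \<phi> ` X' \<and> b \<in> jfil ?A v}"
    then obtain h b where h: "h \<in> X'" and b: "b \<in> X" "b \<in> wfil (l j) (v $ j)" and g: "g = \<phi> * h + b"
      by (auto simp: J)
    have "\<phi> * h \<in> ord_ge j (v $ j)"
      using edge_factor_mult_ord_ge[OF \<phi>] h X'_q by blast
    moreover have "b \<in> ord_ge j (v $ j)"
      using b by (intro wfil_ord_ge) (auto simp: X_def mixed_def qpolys_lpolys)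
    ultimately have "g \<in> ord_ge j (v $ j)"
      unfolding g by (rule ord_ge_add)
    moreover have "g \<in> X"
      unfolding g using mult_X[OF h] b(1) by (rule scale2.subspace_add[OF sub(1)])
    ultimately show "g \<in> jfil (insert j ?A) v"
      by (simp add: Jj)
  next
    fix g assume "g \<in> jfil (insert j ?A) v"
    then have g: "g \<in> X" "g \<in> ord_ge j (v $ j)"
      by (auto simp: Jj)
    obtain h where h: "h \<in> X'" "g - \<phi> * h \<in> wfil (l j) (v $ j)"
      using mixed_ord_ge_decompose[OF \<phi>, of g "($) v"] g unfolding X_def X'_alt by blast
    moreover have "g - \<phi> * h \<in> X"
      using g(1) mult_X[OF h(1)] by (rule scale2.subspace_diff[OF sub(1)])
    ultimately have "g - \<phi> * h \<in> jfil ?A v"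
      by (simp add: J)
    then show "g \<in> {a + b | a b. a \<in> (*) \<phi> ` X' \<and> b \<in> jfil ?A v}"
      using h(1) by (intro CollectI exI[of _ "\<phi> * h"] exI[of _ "g - \<phi> * h"]) auto
  qed
  have "has_qdim ((*) \<phi> ` X') ((*) \<phi> ` X' \<inter> jfil ?A v) y"
    unfolding inter by (rule has_qdim_mult[OF sub(2) subspace_jfil y edge_factor_nonzero[OF \<phi>]])
  then have y': "has_qdim (jfil (insert j ?A) v) (jfil ?A v) y"
    unfolding sum[symmetric] by (rule has_qdim_sum[OF subspace_mult_image[OF sub(2)] subspace_jfil])
  have le: "jfil ?A v \<subseteq> jfil (insert j ?A) v"
    unfolding J Jj by (auto simp: X_def mixed_def intro: wfil_ord_ge qpolys_lpolys)
  have "has_qdim qpolys (jfil ?A v) (hilb (insert j ?A) v + y)"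
    by (rule has_qdim_trans[OF subspace_qpolys subspace_jfil subspace_jfil le jfil_qpolys has_qdim_hilb y'])
  then have "hilb ?A v = hilb (insert j ?A) v + y"
    using has_qdim_unique[OF subspace_qpolys subspace_jfil has_qdim_hilb] by blast
  with 1 show ?thesis
    by simp
qed

lemma hilb_empty: "hilb {} v = card (small v)"
proof -
  note sub = subspace_qpolys subspace_jfil[of "{}" v]
  have J: "jfil {} v = {g \<in> qpolys. supp g \<inter> small v = {}}"
  proof (intro equalityI subsetI)
    fix g assume "g \<in> jfil {} v"
    then have g: "g \<in> qpolys" "\<And>i. g \<in> wfil (l i) (v $ i)"
      by (simp_all add: jfil_def)
    have "k \<notin> small v" if "k \<in> supp g" for k
      using wfilD[OF g(2) that] by (simp add: small_def not_less)
    then show "g \<in> {g \<in> qpolys. supp g \<inter> small v = {}}"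
      using g(1) by blast
  next
    fix g assume g: "g \<in> {g \<in> qpolys. supp g \<inter> small v = {}}"
    have "v $ i \<le> wt (l i) k" if k: "k \<in> supp g" for i k
    proof -
      have "0 \<le> k" "k \<notin> small v"
        using g k by (auto simp: qpolys_def)
      then show ?thesis
        by (auto simp: small_def not_less)
    qed
    then show "g \<in> jfil {} v"
      using g by (simp add: jfil_def wfil_def)
  qed
  have inj: "inj_on mono2 (small v)"
    by (rule inj_onI) (metis supp_mono2 singleton_inject)
  have sum: "(\<Sum>b\<in>mono2 ` small v. scale2 (c b) b) = (\<Sum>k\<in>small v. scale2 (c (mono2 k)) (mono2 k))" for c
    by (simp add: sum.reindex[OF inj])
  have coeff: "coeff2 (\<Sum>k\<in>small v. scale2 (c k) (mono2 k)) n = (if n \<in> small v then c n else 0)" for c n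
    using finite_small[of v] by (simp add: coeff2_sum coeff2_mono2 if_distrib cong: if_cong)
  have "quotient_basis qpolys (jfil {} v) (mono2 ` small v)"
    unfolding quotient_basis_iff[OF sub]
  proof (intro conjI allI impI ballI)
    show "finite (mono2 ` small v)"
      by (intro finite_imageI finite_small)
    show "mono2 ` small v \<subseteq> qpolys"
      by (auto simp: qpolys_def small_def)
    fix c b assume c: "(\<Sum>b\<in>mono2 ` small v. scale2 (c b) b) \<in> jfil {} v" and "b \<in> mono2 ` small v"
    then obtain n where n: "n \<in> small v" "b = mono2 n"
      by blast
    have "n \<notin> supp (\<Sum>k\<in>small v. scale2 (c (mono2 k)) (mono2 k))"
      using c n(1) unfolding sum J by blast
    then show "c b = 0"
      using n coeff[of "\<lambda>k. c (mono2 k)" n] by (simp add: supp_def)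
  next
    fix g assume g: "g \<in> qpolys"
    have fin: "finite (small v \<inter> supp g)"
      using finite_small by blast
    have "(\<Sum>k\<in>small v. scale2 (coeff2 g k) (mono2 k)) = restr (small v) g"
      by (rule coeff2_eqI) (simp add: coeff coeff2_restr[OF fin])
    moreover have "g - restr (small v) g \<in> jfil {} v"
      using small_remainder[OF g] by (intro wfil_jfil)
    ultimately have "g - (\<Sum>k\<in>small v. scale2 (coeff2 g (the_inv_into (small v) mono2 (mono2 k))) (mono2 k)) \<in> jfil {} v"
      by (simp add: the_inv_into_f_f[OF inj])
    then show "\<exists>c. g - (\<Sum>b\<in>mono2 ` small v. scale2 (c b) b) \<in> jfil {} v"
      unfolding sum by (intro exI[of _ "\<lambda>b. coeff2 g (the_inv_into (small v) mono2 b)"])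
  qed
  then have "has_qdim qpolys (jfil {} v) (card (small v))"
    using card_image[OF inj] by (auto simp: has_qdim_def)
  then show ?thesis
    using has_qdim_unique[OF sub has_qdim_hilb] by blast
qed

end

section \<open>Formal series\<close>

lemma tpow_mult: "tpow (u + v) = tpow u * tpow v"
  by (simp add: tpow_def mult_single)

lemma lpoly_induct [case_names zero tpow diff]:
  fixes p :: "'i::finite lpoly"
  assumes "P 0" "\<And>u. P (tpow u)" "\<And>a b. P a \<Longrightarrow> P b \<Longrightarrow> P (a - b)"
  shows "P p"
  by (rule frag_induction[of p UNIV]) (use assms in \<open>auto simp: tpow_def\<close>)

lemma series_mult_superset:
  assumes "finite K" "Poly_Mapping.keys p \<subseteq> K"
  shows "series_mult p A w = (\<Sum>v\<in>K. Poly_Mapping.lookup p v * A (w - v))"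
  unfolding series_mult_def using assms
  by (intro sum.mono_neutral_left) (auto simp: in_keys_iff)

lemma series_mult_0 [simp]: "series_mult 0 A = (\<lambda>w. 0)"
  by (simp add: series_mult_def)

lemma series_mult_diff: "series_mult (p - q) A = (\<lambda>w. series_mult p A w - series_mult q A w)"
proof
  fix w
  let ?K = "Poly_Mapping.keys p \<union> Poly_Mapping.keys q"
  show "series_mult (p - q) A w = series_mult p A w - series_mult q A w"
    using keys_diff[of p q]
    by (simp add: series_mult_superset[of ?K] lookup_minus left_diff_distrib sum_subtractf)
qed

lemma series_mult_tpow [simp]: "series_mult (tpow u) A = (\<lambda>w. A (w - u))"
  by (simp add: series_mult_def tpow_def)

lemma tpow_0: "tpow 0 = 1"
  by (simp add: tpow_def)

lemma series_mult_1 [simp]: "series_mult 1 A = A"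
  using series_mult_tpow[of 0 A] by (simp add: tpow_0)

lemma series_mult_diff_right:
  "series_mult p (\<lambda>w. A w - B w) = (\<lambda>w. series_mult p A w - series_mult p B w)"
  by (simp add: series_mult_def right_diff_distrib sum_subtractf)

lemma series_mult_add_right:
  "series_mult p (\<lambda>w. A w + B w) = (\<lambda>w. series_mult p A w + series_mult p B w)"
  by (simp add: series_mult_def distrib_left sum.distrib)

lemma series_mult_uminus_right: "series_mult p (\<lambda>w. - A w) = (\<lambda>w. - series_mult p A w)"
  by (simp add: series_mult_def sum_negf)

lemma series_mult_0_right [simp]: "series_mult p (\<lambda>w. 0) = (\<lambda>w. 0)"
  by (simp add: series_mult_def)

lemma series_mult_shift: "series_mult p (\<lambda>v. A (v + u)) w = series_mult p A (w + u)"
  by (simp add: series_mult_def algebra_simps)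

text \<open>Both sides are additive in \<open>p\<close> and in \<open>q\<close>, so monomials
  suffice, and these act by translations.\<close>

lemma series_mult_mult: "series_mult (p * q) A = series_mult p (series_mult q A)"
proof (induction p rule: lpoly_induct)
  case (tpow u)
  show ?case
  proof (induction q rule: lpoly_induct)
    case (tpow v)
    show ?case
      by (simp only: tpow_mult[symmetric] series_mult_tpow) (simp add: diff_diff_eq)
  qed (simp_all add: right_diff_distrib series_mult_diff)
qed (simp_all add: left_diff_distrib series_mult_diff)

lemma series_mult_delta: "series_mult p (\<lambda>w. if w = 0 then 1 else 0) = Poly_Mapping.lookup p"
proof
  fix w
  have "series_mult p (\<lambda>w. if w = 0 then 1 else 0) w =
      (\<Sum>v\<in>Poly_Mapping.keys p. if v = w then Poly_Mapping.lookup p w else 0)"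
    unfolding series_mult_def by (intro sum.cong) auto
  also have "\<dots> = Poly_Mapping.lookup p w"
    by (simp add: in_keys_iff)
  finally show "series_mult p (\<lambda>w. if w = 0 then 1 else 0) w = Poly_Mapping.lookup p w" .
qed

lemma power_series_outside: "power_series A \<Longrightarrow> \<not> 0 \<le> v \<Longrightarrow> A v = 0"
  by (auto simp: power_series_def)

lemma power_series_mult_one_minus:
  assumes "power_series A" "0 \<le> u"
  shows "power_series (series_mult (1 - tpow u) A)"
  using assms unfolding power_series_def
  by (auto simp: series_mult_diff less_eq_vec_def) (smt (verit, best) vector_minus_component)

text \<open>A power series that is invariant under a positive translation vanishes, since every exponent
  is moved out of the orthant.\<close>

lemma one_minus_tpow_inj:
  fixes A B :: "'i::finite series"
  assumes A: "power_series A" and B: "power_series B" and u: "0 \<le> u" "u \<noteq> 0"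
    and eq: "series_mult (1 - tpow u) A = series_mult (1 - tpow u) B"
  shows "A = B"
proof
  fix w
  define C where "C v = A v - B v" for v
  have C: "C v = C (v - u)" for v
    using fun_cong[OF eq, of v] by (simp add: series_mult_diff C_def)
  have shift: "C w = C (w - of_nat n *s u)" for n
  proof (induction n)
    case (Suc n)
    then show ?case
      using C[of "w - of_nat n *s u"] by (simp add: vector_sadd_rdistrib algebra_simps)
  qed simp
  obtain i where i: "0 < u $ i"
    using u by (auto simp: less_eq_vec_def vec_eq_iff) (metis order_le_less)
  have "(w - of_nat (nat \<bar>w $ i\<bar> + 1) *s u) $ i < 0"
  proof -
    have "(\<bar>w $ i\<bar> + 1) * 1 \<le> (\<bar>w $ i\<bar> + 1) * u $ i"
      using i by (intro mult_left_mono) auto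
    then have "w $ i - (\<bar>w $ i\<bar> + 1) * u $ i < 0"
      using abs_ge_self[of "w $ i"] by (smt (verit, best))
    moreover have "(w - of_nat (nat \<bar>w $ i\<bar> + 1) *s u) $ i = w $ i - (\<bar>w $ i\<bar> + 1) * u $ i"
      by (simp add: algebra_simps)
    ultimately show ?thesis
      by (simp only:)
  qed
  then have "\<not> 0 \<le> w - of_nat (nat \<bar>w $ i\<bar> + 1) *s u"
    by (auto simp: less_eq_vec_def not_le intro!: exI[of _ i])
  then have "C (w - of_nat (nat \<bar>w $ i\<bar> + 1) *s u) = 0"
    using power_series_outside[OF A] power_series_outside[OF B] by (simp add: C_def)
  then show "A w = B w"
    using shift[of "nat \<bar>w $ i\<bar> + 1"] by (simp add: C_def)
qed

lemma series_div_eq: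
  assumes "power_series C" "series_mult p C = A"
    and "\<And>B. power_series B \<Longrightarrow> series_mult p B = series_mult p C \<Longrightarrow> B = C"
  shows "series_div A p = C"
  unfolding series_div_def
proof (rule the_equality)
  show "power_series C \<and> series_mult p C = A"
    using assms(1,2) by (rule conjI)
  show "B = C" if "power_series B \<and> series_mult p B = A" for B
    using that assms(2) by (intro assms(3)) simp_all
qed

lemma one_nonzero_vec: "0 \<le> (1 :: int ^ 'i::finite)" "(1 :: int ^ 'i) \<noteq> 0"
  by (simp_all add: less_eq_vec_def vec_eq_iff)

definition tprod :: "'i set \<Rightarrow> 'i::finite lpoly" where
  "tprod I = (\<Prod>i\<in>I. tpow (axis i 1) - 1)"

lemma tprod_remove: "tprod UNIV = tprod (- {i}) * (tpow (axis i 1) - 1)"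
  unfolding tprod_def by (subst prod.remove[of UNIV i]) (auto simp: Compl_eq_Diff_UNIV mult.commute)

lemma tprod_independent:
  assumes "\<And>v. E (v - axis i 1) = E v"
  shows "series_mult (tprod UNIV) E = (\<lambda>w. 0)"
  by (simp add: tprod_remove[of i] series_mult_mult series_mult_diff assms)

text \<open>Applying t_i - 1 already kills the half-space of exponents with i-th entry at most 0;
  the other factors only look at exponents translated downward, which stay in it.\<close>

lemma tprod_vanish:
  fixes H :: "'i::finite series"
  assumes "\<And>v. v $ i \<le> 0 \<Longrightarrow> H (v - axis i 1) = H v" and w: "w $ i \<le> 0"
  shows "series_mult (tprod UNIV) H w = 0"
proof -
  define B where "B = series_mult (tpow (axis i 1) - 1) H"
  have B: "B v = 0" if "v $ i \<le> 0" for v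
    using assms(1)[OF that] by (simp add: B_def series_mult_diff)
  have "\<forall>w. w $ i \<le> 0 \<longrightarrow> series_mult (tprod I) B w = 0" for I
  proof (induction I rule: infinite_finite_induct)
    case (insert j I)
    have "(w - axis j 1) $ i \<le> 0" if "w $ i \<le> 0" for w :: "int ^ 'i"
      using that by (auto simp: axis_def)
    with insert show ?case
      by (simp add: tprod_def series_mult_mult series_mult_diff)
  qed (use B in \<open>auto simp: tprod_def\<close>)
  then show ?thesis
    using w by (simp add: tprod_remove[of i] series_mult_mult B_def)
qed

text \<open>In one coordinate, t_i - 1 turns the indicator of v_i \<le> 0 into that of v_i =
  1.\<close>

lemma tprod_orthant:
  "series_mult (tprod I) (\<lambda>v. if \<forall>i. v $ i \<le> 0 then 1 else 0) =
    (\<lambda>v. if (\<forall>i\<in>I. v $ i = 1) \<and> (\<forall>i. i \<notin> I \<longrightarrow> v $ i \<le> 0) then 1 else 0)"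
proof (induction I rule: infinite_finite_induct)
  case (insert j I)
  let ?g = "\<lambda>I (v :: int ^ 'a). if (\<forall>i\<in>I. v $ i = 1) \<and> (\<forall>i. i \<notin> I \<longrightarrow> v $ i \<le> 0) then 1 else (0 :: int)"
  have "series_mult (tprod (insert j I)) (\<lambda>v. if \<forall>i. v $ i \<le> 0 then 1 else 0) =
      series_mult (tpow (axis j 1) - 1) (?g I)"
    using insert by (simp add: tprod_def series_mult_mult)
  also have "\<dots> = ?g (insert j I)"
  proof
    fix v :: "int ^ 'a"
    define R where "R \<longleftrightarrow> (\<forall>i\<in>I. v $ i = 1) \<and> (\<forall>i. i \<notin> insert j I \<longrightarrow> v $ i \<le> 0)"
    have "?g I v = (if R \<and> v $ j \<le> 0 then 1 else 0)"
      using insert(2) by (auto simp: R_def)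
    moreover have "?g I (v - axis j 1) = (if R \<and> v $ j - 1 \<le> 0 then 1 else 0)"
    proof -
      have "(v - axis j 1) $ i = (if i = j then v $ j - 1 else v $ i)" for i
        by (simp add: axis_def)
      then show ?thesis
        using insert(2) unfolding R_def by (auto split: if_splits)
    qed
    moreover have "?g (insert j I) v = (if R \<and> v $ j = 1 then 1 else 0)"
      by (auto simp: R_def)
    ultimately show "series_mult (tpow (axis j 1) - 1) (?g I) v = ?g (insert j I) v"
      by (simp add: series_mult_diff)
  qed
  finally show ?case .
qed (auto simp: tprod_def)

lemma tprod_positive:
  fixes w :: "int ^ 'i::finite"
  shows "series_mult (tprod UNIV) (\<lambda>v :: int ^ 'i. if \<exists>i. 0 < v $ i then 1 else 0) w = (if w = 1 then -1 else 0)"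
proof -
  have "(\<lambda>v :: int ^ 'i. if \<exists>i. 0 < v $ i then 1 else (0 :: int)) =
      (\<lambda>v. 1 - (if \<forall>i. v $ i \<le> 0 then 1 else 0))"
    by (auto simp: fun_eq_iff not_less)
  then show ?thesis
    by (simp only: series_mult_diff_right tprod_orthant tprod_independent[of "\<lambda>_. 1"])
      (simp add: vec_eq_iff)
qed

text \<open>At \<open>w\<close>, the factor t_1 ... t_r - 1 takes the value at \<open>w - 1\<close>
  minus that at \<open>w\<close>. The sign and the shift by (1,...,1) turn this into the difference
  of \<open>H\<close> at \<open>v + 1\<close> and \<open>v\<close>. The support in the orthant makes
  the quotient unique.\<close>

lemma poincare_from_hilbert:
  fixes H :: "'i::finite series"
  assumes vanish: "\<And>v i. v $ i \<le> 0 \<Longrightarrow> H (v - axis i 1) = H v"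
  shows "series_div (series_mult (tprod UNIV) (\<lambda>v. H (v + 1) - H v)) (tpow 1 - 1) =
      (\<lambda>w. - series_mult (tprod UNIV) H (w + 1))"
    and "power_series (\<lambda>w. - series_mult (tprod UNIV) H (w + 1))"
proof -
  let ?C = "\<lambda>w. - series_mult (tprod UNIV) H (w + 1)"
  show C: "power_series ?C"
    unfolding power_series_def
  proof (intro allI impI, rule ccontr)
    fix v :: "int ^ 'i" assume nz: "- series_mult (tprod UNIV) H (v + 1) \<noteq> 0" and "\<not> 0 \<le> v"
    then obtain i where "v $ i < 0"
      by (auto simp: less_eq_vec_def not_le)
    then have "series_mult (tprod UNIV) H (v + 1) = 0"
      by (intro tprod_vanish[of i] vanish) auto
    then show False
      using nz by simp
  qed
  have neg: "series_mult (tpow 1 - 1) B = (\<lambda>w. - series_mult (1 - tpow 1) B w)" for B :: "'i series"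
    by (simp add: series_mult_diff)
  show "series_div (series_mult (tprod UNIV) (\<lambda>v. H (v + 1) - H v)) (tpow 1 - 1) = ?C"
  proof (rule series_div_eq[OF C])
    show "series_mult (tpow 1 - 1) ?C = series_mult (tprod UNIV) (\<lambda>v. H (v + 1) - H v)"
      by (simp add: series_mult_diff series_mult_diff_right series_mult_shift fun_eq_iff)
    fix B :: "'i series" assume B: "power_series B" "series_mult (tpow 1 - 1) B = series_mult (tpow 1 - 1) ?C"
    then have "series_mult (1 - tpow 1) B = series_mult (1 - tpow 1) ?C"
      unfolding neg by (simp add: fun_eq_iff)
    then show "B = ?C"
      by (intro one_minus_tpow_inj[OF B(1) C one_nonzero_vec])
  qed
qed

lemma series_div_two:
  assumes C: "power_series C" and u: "0 \<le> u" "u \<noteq> 0" "0 \<le> u'" "u' \<noteq> 0"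
    and eq: "series_mult ((1 - tpow u) * (1 - tpow u')) C = A"
  shows "series_div A ((1 - tpow u) * (1 - tpow u')) = C"
proof (rule series_div_eq[OF C eq])
  fix B assume B: "power_series B"
    "series_mult ((1 - tpow u) * (1 - tpow u')) B = series_mult ((1 - tpow u) * (1 - tpow u')) C"
  have "series_mult (1 - tpow u') B = series_mult (1 - tpow u') C"
    using B(2) unfolding series_mult_mult
    by (rule one_minus_tpow_inj[OF power_series_mult_one_minus[OF B(1) u(3)]
        power_series_mult_one_minus[OF C u(3)] u(1,2)])
  then show "B = C"
    using one_minus_tpow_inj[OF B(1) C u(3,4)] by blast
qed

section \<open>The Poincare series from the codimension functions\<close>

context edge_data
begin

abbreviation Hilb :: "'i set \<Rightarrow> 'i series" where
  "Hilb A \<equiv> (\<lambda>v. int (hilb A v))"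

text \<open>Polynomials have nonnegative weights, so a condition with bound at most 0 is
  void.\<close>

lemma Hilb_nonpos:
  assumes "v $ i \<le> 0"
  shows "Hilb A (v - axis i 1) = Hilb A v"
proof -
  have "g \<in> wfil (l i) w \<and> g \<in> ord_ge i w" if g: "g \<in> qpolys" "w \<le> 0" for g w
    using wfil_mono[OF g(2), of "l i"] qpolys_wfil[OF g(1), of "l i"] wfil_ord_ge[OF qpolys_lpolys[OF g(1)]]
    by blast
  note low = this
  define w where "w = v - axis i 1"
  have w: "w $ k = (if k = i then v $ i - 1 else v $ k)" for k
    by (simp add: w_def axis_def)
  have *: "g \<in> (if k \<in> A then ord_ge k (w $ k) else wfil (l k) (w $ k)) \<longleftrightarrow>
      g \<in> (if k \<in> A then ord_ge k (v $ k) else wfil (l k) (v $ k))" if g: "g \<in> qpolys" for g k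
  proof (cases "k = i")
    case True
    have "g \<in> wfil (l i) (w $ i) \<and> g \<in> ord_ge i (w $ i)" "g \<in> wfil (l i) (v $ i) \<and> g \<in> ord_ge i (v $ i)"
      using assms by (intro low[OF g]; simp add: w)+
    then show ?thesis
      using True by simp
  qed (simp add: w)
  have "jfil A (v - axis i 1) = jfil A v"
    unfolding jfil_def w_def[symmetric] using * by blast
  then show ?thesis
    by (simp add: hilb_def)
qed

lemma tprod_Hilb_insert:
  "series_mult (tprod UNIV) (Hilb (insert j {i. left_of i j})) =
    series_mult (1 - tpow (Mvec j)) (series_mult (tprod UNIV) (Hilb {i. left_of i j}))"
proof -
  let ?A = "{i. left_of i j}"
  define E where "E v = int (mixed_codim j (v - Mvec j))" for v
  have "mixed_codim j (v - axis j 1 - Mvec j) = mixed_codim j (v - Mvec j)" for v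
    by (rule mixed_codim_cong) (simp add: axis_def)
  then have E: "series_mult (tprod UNIV) E = (\<lambda>w. 0)"
    by (intro tprod_independent[of _ j]) (simp add: E_def)
  have "Hilb (insert j ?A) = (\<lambda>v. series_mult (1 - tpow (Mvec j)) (Hilb ?A) v + E v)"
    by (simp add: fun_eq_iff hilb_insert series_mult_diff E_def)
  then have "series_mult (tprod UNIV) (Hilb (insert j ?A)) =
      series_mult (tprod UNIV) (series_mult (1 - tpow (Mvec j)) (Hilb ?A))"
    by (simp add: series_mult_add_right E)
  then show ?thesis
    by (simp add: series_mult_mult[symmetric] mult.commute)
qed

definition slope :: "'i \<Rightarrow> real" where
  "slope i = real (snd (l i)) / real (fst (l i))"

lemma left_of_iff_slope: "left_of i j \<longleftrightarrow> slope i < slope j"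
proof -
  have "slope i < slope j \<longleftrightarrow> real (snd (l i)) * real (fst (l j)) < real (snd (l j)) * real (fst (l i))"
    using fst_pos[of i] fst_pos[of j] by (simp add: slope_def divide_simps)
  also have "\<dots> \<longleftrightarrow> left_of i j"
    unfolding left_of_def by (metis mult.commute of_nat_less_iff of_nat_mult)
  finally show ?thesis ..
qed

text \<open>The set of restored edges must be closed to the left, since \<open>hilb_insert\<close>
  restores an edge exactly when all those to its left, and no others, have been restored. The
  induction removes the rightmost edge of \<open>A\<close>.\<close>

lemma tprod_Hilb:
  assumes "\<And>i j. j \<in> A \<Longrightarrow> left_of i j \<Longrightarrow> i \<in> A"
  shows "series_mult (tprod UNIV) (Hilb A) =
    series_mult (\<Prod>j\<in>A. 1 - tpow (Mvec j)) (series_mult (tprod UNIV) (Hilb {}))"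
  using assms
proof (induction "card A" arbitrary: A)
  case 0
  then show ?case
    by simp
next
  case (Suc n)
  have "finite A" "A \<noteq> {}"
    using Suc.hyps(2) by auto
  then obtain j where j: "j \<in> A" "\<And>i. i \<in> A \<Longrightarrow> - slope j \<le> - slope i"
    using arg_min_if_finite(1)[of A "\<lambda>i. - slope i"] arg_min_least[of A _ "\<lambda>i. - slope i"] by metis
  define B where "B = {i. left_of i j}"
  have A: "A = insert j B"
  proof (intro equalityI subsetI)
    fix i assume i: "i \<in> A"
    then show "i \<in> insert j B"
      using left_of_cases[of i j] j(2)[OF i] by (auto simp: B_def left_of_iff_slope)
  next
    fix i assume "i \<in> insert j B"
    then show "i \<in> A"
      using j(1) Suc.prems[OF j(1)] by (auto simp: B_def)
  qed
  have jB: "j \<notin> B"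
    by (simp add: B_def left_of_irrefl)
  have "series_mult (tprod UNIV) (Hilb B) =
      series_mult (\<Prod>j\<in>B. 1 - tpow (Mvec j)) (series_mult (tprod UNIV) (Hilb {}))"
    using Suc.hyps(2) jB by (intro Suc.hyps(1)) (auto simp: A B_def left_of_iff_slope)
  then show ?case
    using jB tprod_Hilb_insert[of j, folded B_def]
    by (simp add: A series_mult_mult)
qed

definition xvec :: "int ^ 'i" where
  "xvec = (\<chi> i. int (fst (l i)))"

definition yvec :: "int ^ 'i" where
  "yvec = (\<chi> i. int (snd (l i)))"

lemma vec_pos: "0 \<le> xvec" "xvec \<noteq> 0" "0 \<le> yvec" "yvec \<noteq> 0"
  using fst_pos snd_pos by (auto simp: xvec_def yvec_def less_eq_vec_def vec_eq_iff)

text \<open>\<open>Hilb {}\<close> counts monomials in \<open>small v\<close>. Translation by one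
  step in \<open>y\<close> shows that 1 - t^u(y) keeps those with no \<open>y\<close>; then 1 -
  t^u(x) keeps only the monomial 1, which is counted when some v_i is positive.\<close>

lemma Hilb_empty_series:
  "series_mult ((1 - tpow xvec) * (1 - tpow yvec)) (Hilb {}) =
    (\<lambda>v. if \<exists>i. 0 < v $ i then 1 else 0)"
proof -
  have image_add: "k \<in> (\<lambda>k. k + d) ` S \<longleftrightarrow> k - d \<in> S" for k d :: "int \<times> int" and S
    by (auto simp: image_iff) (metis diff_add_cancel)
  have card_split: "card S = card (S - T) + card U"
    if "finite S" "(\<lambda>k. k + d) ` U = S \<inter> T" for S T U :: "(int \<times> int) set" and d
  proof -
    have "card S = card (S - T) + card (S \<inter> T)"
      using that(1) by (subst card_Un_disjoint[symmetric]) (auto intro!: arg_cong[of _ _ card])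
    also have "card (S \<inter> T) = card U"
      unfolding that(2)[symmetric] by (intro card_image) (auto simp: inj_on_def)
    finally show ?thesis .
  qed
  let ?S = "\<lambda>v. small v - {k. 0 < snd k}"
  have small_nonneg: "0 \<le> fst k \<and> 0 \<le> snd k" if "k \<in> small v" for k v
    using that by (auto simp: small_def less_eq_prod_def)
  define a where "a v = int (card (?S v))" for v
  have shift_y: "Hilb {} v - Hilb {} (v - yvec) = a v" for v
  proof -
    have "k - (0, 1) \<in> small (v - yvec) \<longleftrightarrow> k \<in> small v \<and> 0 < snd k" for k
    proof -
      have "wt (l i) (k - (0, 1)) < (v - yvec) $ i \<longleftrightarrow> wt (l i) k < v $ i" for i
        by (simp add: yvec_def wt_diff) (simp add: wt_def)
      then show ?thesis
        by (auto simp: small_def less_eq_prod_def)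
    qed
    then have "(\<lambda>k. k + (0, 1)) ` small (v - yvec) = small v \<inter> {k. 0 < snd k}"
      by (intro set_eqI) (simp only: image_add, blast)
    from card_split[OF finite_small this] show ?thesis
      by (simp add: hilb_empty a_def)
  qed
  have shift_x: "a v - a (v - xvec) = (if \<exists>i. 0 < v $ i then 1 else 0)" for v
  proof -
    have "k - (1, 0) \<in> ?S (v - xvec) \<longleftrightarrow> k \<in> ?S v \<and> 0 < fst k" for k
    proof -
      have "wt (l i) (k - (1, 0)) < (v - xvec) $ i \<longleftrightarrow> wt (l i) k < v $ i" for i
        by (simp add: xvec_def wt_diff) (simp add: wt_def)
      then show ?thesis
        by (auto simp: small_def less_eq_prod_def)
    qed
    then have "(\<lambda>k. k + (1, 0)) ` ?S (v - xvec) = ?S v \<inter> {k. 0 < fst k}"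
      by (intro set_eqI) (simp only: image_add, blast)
    from card_split[OF finite_Diff[OF finite_small] this]
    have "a v - a (v - xvec) = int (card (?S v - {k. 0 < fst k}))"
      by (simp add: a_def)
    also have "?S v - {k. 0 < fst k} = (if \<exists>i. 0 < v $ i then {0} else {})"
    proof -
      have zero: "k = 0" if "k \<in> ?S v - {k. 0 < fst k}" for k
        using that small_nonneg[of k v] by (auto simp: prod_eq_iff)
      have mem: "0 \<in> small v \<longleftrightarrow> (\<exists>i. 0 < v $ i)"
        by (simp add: small_def)
      show ?thesis
        unfolding mem[symmetric]
      proof (intro equalityI subsetI)
        fix k assume k: "k \<in> ?S v - {k. 0 < fst k}"
        then show "k \<in> (if 0 \<in> small v then {0} else {})"
          using zero[OF k] by simp
      qed (simp split: if_splits)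
    qed
    finally show ?thesis
      by simp
  qed
  have "series_mult (1 - tpow yvec) (Hilb {}) = a"
    by (simp add: fun_eq_iff series_mult_diff shift_y)
  then show ?thesis
    by (simp add: series_mult_mult) (simp add: fun_eq_iff series_mult_diff shift_x)
qed

lemma poincare_Hilb:
  "series_div (series_mult (tprod UNIV) (\<lambda>v. Hilb UNIV (v + 1) - Hilb UNIV v)) (tpow 1 - 1) =
    series_div (Poly_Mapping.lookup (\<Prod>j\<in>UNIV. 1 - tpow (Mvec j)))
      ((1 - tpow xvec) * (1 - tpow yvec))"
proof -
  let ?C = "\<lambda>w. - series_mult (tprod UNIV) (Hilb UNIV) (w + 1)"
    and ?N = "\<Prod>j\<in>UNIV. 1 - tpow (Mvec j)" and ?D = "(1 - tpow xvec) * (1 - tpow yvec)"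
  note C = poincare_from_hilbert[of "Hilb UNIV", OF Hilb_nonpos]
  have "series_mult ?D (series_mult (tprod UNIV) (Hilb UNIV)) =
      series_mult ?D (series_mult ?N (series_mult (tprod UNIV) (Hilb {})))"
    by (subst tprod_Hilb) auto
  also have "\<dots> = series_mult ?N (series_mult (tprod UNIV) (series_mult ?D (Hilb {})))"
    by (simp only: series_mult_mult[symmetric] mult_ac)
  also have "\<dots> = series_mult ?N (\<lambda>w. if w = 1 then -1 else 0)"
    unfolding Hilb_empty_series using tprod_positive by (metis (no_types, lifting) ext)
  finally have *: "series_mult ?D (series_mult (tprod UNIV) (Hilb UNIV)) w =
      series_mult ?N (\<lambda>w. if w = 1 then -1 else 0) w" for w
    by simp
  have "series_mult ?D ?C w = Poly_Mapping.lookup ?N w" for w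
  proof -
    have "series_mult ?D ?C w = - series_mult ?D (series_mult (tprod UNIV) (Hilb UNIV)) (w + 1)"
      by (simp only: series_mult_uminus_right series_mult_shift)
    also have "\<dots> = series_mult ?N (\<lambda>v. - (if v + 1 = 1 then -1 else 0)) w"
      unfolding * series_mult_uminus_right series_mult_shift[of ?N "\<lambda>v. if v = 1 then -1 else 0"] ..
    also have "(\<lambda>v :: int ^ 'i. - (if v + 1 = 1 then -1 else 0)) = (\<lambda>v. if v = 0 then 1 else (0 :: int))"
      by (auto simp: fun_eq_iff)
    finally show ?thesis
      by (simp only: series_mult_delta)
  qed
  then have "series_div (Poly_Mapping.lookup ?N) ?D = ?C"
    by (intro series_div_two C(2) vec_pos) auto
  then show ?thesis
    using C(1) by simp
qed

end

section \<open>Edges of the Newton diagram\<close>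

definition real_point :: "int \<times> int \<Rightarrow> real \<times> real" where
  "real_point k = (real_of_int (fst k), real_of_int (snd k))"

lemma support2_eq: "support2 g = real_point ` supp g"
  by (force simp: support2_def supp_def real_point_def)

lemma linear_form_real_point: "linear_form l (real_point k) = real_of_int (wt l k)"
  by (simp add: linear_form_def real_point_def wt_def)

lemma linear_form_add: "linear_form l (x + y) = linear_form l x + linear_form l y"
  by (simp add: linear_form_def algebra_simps)

lemma linear_form_scaleR: "linear_form l (t *\<^sub>R x) = t * linear_form l x"
  by (simp add: linear_form_def algebra_simps)

text \<open>The polygon is stable under adding \<open>(1, 1)\<close>, so it has points strictly
  above the line of the edge. A point \<open>x\<close> below would be joined to one of them by a
  segment meeting the face in its interior, which would put \<open>x\<close> itself in the
  face.\<close>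

lemma edge_lower_bound:
  assumes e: "e edge_of newton_polygon g" and aff: "affine hull e = {k. linear_form l k = c}"
    and l: "0 < fst l" "0 < snd l" and x: "x \<in> newton_polygon g"
  shows "c \<le> linear_form l x"
proof (rule ccontr)
  let ?N = "newton_polygon g" and ?d = "(1, 1) :: real \<times> real"
  assume "\<not> c \<le> linear_form l x"
  then have less: "linear_form l x < c"
    by simp
  have face: "e face_of ?N" and dim: "aff_dim e = 1"
    using e by (auto simp: edge_of_def)
  obtain z where z: "z \<in> e"
    using dim by (cases "e = {}") auto
  have conv: "convex ?N"
    by (simp add: newton_polygon_def)
  have "(\<lambda>y. ?d + y) ` ?N \<subseteq> ?N"
    unfolding newton_polygon_def convex_hull_translation[symmetric]
  proof (intro hull_mono subsetI)
    fix y assume "y \<in> (\<lambda>y. ?d + y) ` (\<Union>k\<in>support2 g. {k + q | q. 0 \<le> fst q \<and> 0 \<le> snd q})"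
    then obtain k q where "k \<in> support2 g" "0 \<le> fst q" "0 \<le> snd q" "y = ?d + (k + q)"
      by blast
    then show "y \<in> (\<Union>k\<in>support2 g. {k + q | q. 0 \<le> fst q \<and> 0 \<le> snd q})"
      by (intro UN_I[of k] CollectI exI[of _ "?d + q"]) (simp_all add: add.left_commute)
  qed
  then have zd: "?d + z \<in> ?N"
    using z face_of_imp_subset[OF face] by blast
  have z_c: "linear_form l z = c"
    using aff hull_subset[of e affine] z by auto
  then have zd_c: "c < linear_form l (?d + z)"
    using l by (simp add: linear_form_add) (simp add: linear_form_def)
  define w where "w = ?d + z"
  note zd = zd[folded w_def] and zd_c = zd_c[folded w_def]
  define t where "t = (c - linear_form l x) / (linear_form l w - linear_form l x)"
  have t: "0 < t" "t < 1"
    using less zd_c by (simp_all add: t_def)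
  define y where "y = (1 - t) *\<^sub>R x + t *\<^sub>R w"
  have "linear_form l y = (1 - t) * linear_form l x + t * linear_form l w"
    by (simp only: y_def linear_form_add linear_form_scaleR)
  also have "\<dots> = linear_form l x + t * (linear_form l w - linear_form l x)"
    by (simp add: algebra_simps)
  also have "\<dots> = c"
    using less zd_c by (simp add: t_def)
  finally have y_c: "linear_form l y = c" .
  have "y \<in> ?N"
    unfolding y_def using t by (intro convexD[OF conv x zd]) auto
  then have "y \<in> e"
    using y_c face_of_imp_eq_affine_Int[OF conv face] aff by blast
  moreover have "y \<in> open_segment x w"
    unfolding in_segment y_def using t less zd_c by auto
  ultimately have "x \<in> e"
    using face_ofD[OF face _ x zd] by blast
  then show False
    using aff hull_subset[of e affine] less by auto
qed

lemma edge_convex_hull: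
  assumes e: "e edge_of newton_polygon g" and aff: "affine hull e = {k. linear_form l k = c}"
    and l: "0 < fst l" "0 < snd l"
  shows "e = convex hull (real_point ` {k \<in> supp g. real_of_int (wt l k) = c})"
    and "k \<in> supp g \<Longrightarrow> c \<le> real_of_int (wt l k)"
    and "e = newton_polygon g \<inter> {x. linear_form l x = c}"
proof -
  let ?N = "newton_polygon g" and ?E = "real_point ` {k \<in> supp g. real_of_int (wt l k) = c}"
  let ?U = "\<Union>k\<in>support2 g. {k + q | q. 0 \<le> fst q \<and> 0 \<le> snd q}"
  have face: "e face_of ?N"
    using e by (auto simp: edge_of_def)
  have conv: "convex ?N"
    by (simp add: newton_polygon_def)
  show e_eq: "e = ?N \<inter> {x. linear_form l x = c}"
    using face_of_imp_eq_affine_Int[OF conv face] aff by blast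
  have supp_N: "real_point k \<in> ?N" if "k \<in> supp g" for k
  proof -
    have "real_point k \<in> ?U"
      using that unfolding support2_eq
      by (intro UN_I[of "real_point k"] CollectI exI[of _ 0]) simp_all
    then show ?thesis
      unfolding newton_polygon_def by (rule hull_inc)
  qed
  show lower: "c \<le> real_of_int (wt l k)" if "k \<in> supp g" for k
    using edge_lower_bound[OF e aff l supp_N[OF that]] by (simp add: linear_form_real_point)
  have hull_c: "linear_form l x = c" if "x \<in> convex hull ?E" for x
  proof -
    have "convex {x. linear_form l x = c}"
      by (auto simp: convex_def linear_form_add linear_form_scaleR distrib_right[symmetric])
    then have "convex hull ?E \<subseteq> {x. linear_form l x = c}"
      by (intro hull_minimal) (auto simp: linear_form_real_point)
    then show ?thesis
      using that by blast
  qed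
  \<comment> \<open>An open half plane together with a convex part of its boundary is convex. It
    contains all the translated quadrants, hence the polygon, so the polygon meets the line only in
    the hull of the support points on it.\<close>
  let ?Q = "{x. c < linear_form l x} \<union> convex hull ?E"
  have "convex ?Q"
  proof (rule iffD2[OF convex_alt], intro ballI allI impI)
    fix x y and t :: real assume x: "x \<in> ?Q" and y: "y \<in> ?Q" and t: "0 \<le> t \<and> t \<le> 1"
    have ge: "c \<le> linear_form l x" "c \<le> linear_form l y"
      using x y hull_c by fastforce+
    consider "t = 0" | "t = 1" | "0 < t" "t < 1" "x \<in> convex hull ?E" "y \<in> convex hull ?E"
      | "0 < t" "t < 1" "c < linear_form l x" | "0 < t" "t < 1" "c < linear_form l y"
      using x y t by fastforce
    then show "(1 - t) *\<^sub>R x + t *\<^sub>R y \<in> ?Q"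
    proof cases
      case 3
      then have "(1 - t) *\<^sub>R x + t *\<^sub>R y \<in> convex hull ?E"
        by (intro convexD[OF convex_convex_hull]) auto
      then show ?thesis
        by blast
    next
      case 4
      then have "(1 - t) * c + t * c < (1 - t) * linear_form l x + t * linear_form l y"
        using ge by (intro add_less_le_mono mult_strict_left_mono mult_left_mono) auto
      then show ?thesis
        by (simp add: linear_form_add linear_form_scaleR left_diff_distrib)
    next
      case 5
      then have "(1 - t) * c + t * c < (1 - t) * linear_form l x + t * linear_form l y"
        using ge by (intro add_le_less_mono mult_strict_left_mono mult_left_mono) auto
      then show ?thesis
        by (simp add: linear_form_add linear_form_scaleR left_diff_distrib)
    qed (use x y in auto)
  qed
  moreover have "?U \<subseteq> ?Q"
  proof
    fix x assume "x \<in> ?U"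
    then obtain k q where kq: "k \<in> supp g" "x = real_point k + q" "0 \<le> fst q" "0 \<le> snd q"
      by (auto simp: support2_eq)
    have x: "linear_form l x = real_of_int (wt l k) + linear_form l q"
      by (simp add: kq linear_form_add linear_form_real_point)
    show "x \<in> ?Q"
    proof (cases "q = 0 \<and> real_of_int (wt l k) = c")
      case True
      then have "x \<in> ?E"
        using kq by auto
      then have "x \<in> convex hull ?E"
        by (rule hull_inc)
      then show ?thesis
        by (rule UnI2)
    next
      case False
      have "0 \<le> linear_form l q"
        using kq by (simp add: linear_form_def)
      moreover have "0 < linear_form l q" if "q \<noteq> 0"
      proof -
        have "0 < fst q \<or> 0 < snd q"
          using that kq by (auto simp: prod_eq_iff)
        then show ?thesis
          using l kq by (auto simp: linear_form_def intro: add_pos_nonneg add_nonneg_pos)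
      qed
      ultimately have "c < linear_form l x"
        using False lower[OF kq(1)] x by fastforce
      then show ?thesis
        by blast
    qed
  qed
  ultimately have "?N \<subseteq> ?Q"
    unfolding newton_polygon_def by (intro hull_minimal)
  then have "e \<subseteq> convex hull ?E"
    unfolding e_eq by auto
  moreover have "convex hull ?E \<subseteq> e"
  proof (intro subsetI)
    fix x assume x: "x \<in> convex hull ?E"
    have "convex hull ?E \<subseteq> ?N"
      using supp_N by (intro hull_minimal conv) auto
    then show "x \<in> e"
      unfolding e_eq using x hull_c[OF x] by blast
  qed
  ultimately show "e = convex hull ?E"
    by blast
qed

lemma convex_hull_fst_bounds:
  assumes "x \<in> convex hull (real_point ` E)" "\<And>k. k \<in> E \<Longrightarrow> a \<le> fst k \<and> fst k \<le> b"
  shows "real_of_int a \<le> fst x \<and> fst x \<le> real_of_int b"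
proof -
  have "convex hull (real_point ` E) \<subseteq> fst -` {real_of_int a..real_of_int b}"
    using assms(2) by (intro hull_minimal convex_linear_vimage linear_fst) (auto simp: real_point_def)
  then show ?thesis
    using assms(1) by auto
qed

lemma convex_hull_snd_bounds:
  assumes "x \<in> convex hull (real_point ` E)" "\<And>k. k \<in> E \<Longrightarrow> a \<le> snd k \<and> snd k \<le> b"
  shows "real_of_int a \<le> snd x \<and> snd x \<le> real_of_int b"
proof -
  have "convex hull (real_point ` E) \<subseteq> snd -` {real_of_int a..real_of_int b}"
    using assms(2) by (intro hull_minimal convex_linear_vimage linear_snd) (auto simp: real_point_def)
  then show ?thesis
    using assms(1) by auto
qed

lemma edge_geometry:
  assumes g: "\<And>k. k \<in> supp g \<Longrightarrow> 0 \<le> k" and e: "e \<in> newton_edges g"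
    and red: "reduced_equation e l" and S: "axis_translate e S"
  obtains c s p q where "g \<in> wfil l c" "0 < p" "0 < q"
    "wt l (s + (0, q)) = c" "wt l (s + (p, 0)) = c" "s + (0, q) \<in> supp g" "s + (p, 0) \<in> supp g"
    "\<And>k. k \<in> supp g \<Longrightarrow> wt l k = c \<Longrightarrow> s \<le> k"
    "S = closed_segment (real_of_int p, 0) (0, real_of_int q)"
    "e = newton_polygon g \<inter> {x. linear_form l x = real_of_int c}"
proof -
  have e: "e edge_of newton_polygon g"
    using e by (simp add: newton_edges_def)
  obtain c where l: "0 < fst l" "0 < snd l" and aff: "affine hull e = {k. linear_form l k = c}"
    using red by (auto simp: reduced_equation_def)
  note hull = edge_convex_hull[OF e aff l]
  define E where "E = {k \<in> supp g. real_of_int (wt l k) = c}"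
  have e_hull: "e = convex hull (real_point ` E)"
    unfolding E_def by (rule hull(1))
  have dim: "aff_dim e = 1"
    using e by (simp add: edge_of_def)
  then have E_ne: "E \<noteq> {}"
    using e_hull by auto
  then obtain k0 where k0: "k0 \<in> E"
    by blast
  have wt_E: "wt l k = wt l k0" if "k \<in> E" for k
    using that k0 unfolding E_def by (metis (mono_tags, lifting) mem_Collect_eq of_int_eq_iff)
  have c_eq: "c = real_of_int (wt l k0)"
    using k0 by (simp add: E_def)
  have E_fin: "finite E"
    by (rule finite_subset[OF _ finite_wt_le[OF l, of 0 "wt l k0"]])
      (use wt_E g in \<open>auto simp: E_def\<close>)
  obtain kl where kl: "kl \<in> E" "\<And>k. k \<in> E \<Longrightarrow> fst kl \<le> fst k"
    using arg_min_if_finite(1)[OF E_fin E_ne, of fst] arg_min_least[OF E_fin E_ne, of _ fst] by blast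
  obtain kr where kr: "kr \<in> E" "\<And>k. k \<in> E \<Longrightarrow> snd kr \<le> snd k"
    using arg_min_if_finite(1)[OF E_fin E_ne, of snd] arg_min_least[OF E_fin E_ne, of _ snd] by blast
  have mono: "snd k \<le> snd k' \<longleftrightarrow> fst k' \<le> fst k" if "k \<in> E" "k' \<in> E" for k k'
  proof -
    have "int (fst l) * (fst k - fst k') = int (snd l) * (snd k' - snd k)"
      using wt_E[OF that(1)] wt_E[OF that(2)] by (simp add: wt_def algebra_simps)
    then have "0 \<le> int (fst l) * (fst k - fst k') \<longleftrightarrow> 0 \<le> int (snd l) * (snd k' - snd k)"
      by simp
    then show ?thesis
      using l by (simp add: zero_le_mult_iff)
  qed
  have kl_snd: "snd k \<le> snd kl" if "k \<in> E" for k
    using mono[OF that kl(1)] kl(2)[OF that] by simp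
  have kr_fst: "fst k \<le> fst kr" if "k \<in> E" for k
    using mono[OF kr(1) that] kr(2)[OF that] by simp
  have fst_less: "fst kl < fst kr"
  proof (rule ccontr)
    assume "\<not> fst kl < fst kr"
    then have "fst k = fst kl" if "k \<in> E" for k
      using kl(2)[OF that] kr_fst[OF that] by simp
    moreover from this have "snd k = snd kl" if "k \<in> E" for k
      using mono[OF that kl(1)] mono[OF kl(1) that] that by (simp add: antisym)
    ultimately have "E = {kl}"
      using kl(1) by (auto simp: prod_eq_iff)
    then have "e = {real_point kl}"
      by (simp add: e_hull)
    then show False
      using dim by simp
  qed
  have snd_less: "snd kr < snd kl"
    using mono[OF kl(1) kr(1)] fst_less by auto
  obtain v a b where Sv: "S = (\<lambda>k. v + k) ` e" and ab: "0 \<le> a" "0 \<le> b" and Sab: "S = closed_segment (a, 0) (0, b)"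
    using S unfolding axis_translate_def by blast
  have box: "0 \<le> fst x \<and> fst x \<le> a \<and> 0 \<le> snd x \<and> snd x \<le> b" if x: "x \<in> S" for x
  proof -
    obtain u where "0 \<le> u" "u \<le> 1" "x = (1 - u) *\<^sub>R (a, 0) + u *\<^sub>R (0, b)"
      using x unfolding Sab in_segment by blast
    then show ?thesis
      using ab by (simp add: mult_left_le_one_le)
  qed
  have kl_S: "v + real_point kl \<in> S" and kr_S: "v + real_point kr \<in> S"
    using kl(1) kr(1) hull_inc[of _ "real_point ` E" convex] by (auto simp: Sv e_hull)
  have unshift: "x - v \<in> e" if "x \<in> S" for x
  proof -
    obtain y where "y \<in> e" "x = v + y"
      using \<open>x \<in> S\<close> unfolding Sv by blast
    then show ?thesis
      by simp
  qed
  have left: "(0, b) - v \<in> e" and right: "(a, 0) - v \<in> e"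
    by (intro unshift; simp add: Sab)+
  have bounds: "real_of_int (fst kl) \<le> fst x \<and> fst x \<le> real_of_int (fst kr)"
    "real_of_int (snd kr) \<le> snd x \<and> snd x \<le> real_of_int (snd kl)" if "x \<in> e" for x
    using convex_hull_fst_bounds[of x E "fst kl" "fst kr"] convex_hull_snd_bounds[of x E "snd kr" "snd kl"]
      that kl(2) kr(2) kl_snd kr_fst unfolding e_hull by blast+
  \<comment> \<open>The translate lies in the quadrant and touches both axes; comparing its bounding
    box with that of the edge, in both directions, determines the translation and the two
    lengths.\<close>
  have fv: "fst v = - real_of_int (fst kl)"
    using bounds(1)[OF left] box[OF kl_S] by (simp add: real_point_def)
  have sv: "snd v = - real_of_int (snd kr)"
    using bounds(2)[OF right] box[OF kr_S] by (simp add: real_point_def)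
  have a: "a = real_of_int (fst kr - fst kl)"
    using bounds(1)[OF right] box[OF kr_S] fv by (simp add: real_point_def)
  have b: "b = real_of_int (snd kl - snd kr)"
    using bounds(2)[OF left] box[OF kl_S] sv by (simp add: real_point_def)
  define s where "s = (fst kl, snd kr)"
  have left_eq: "s + (0, snd kl - snd kr) = kl" and right_eq: "s + (fst kr - fst kl, 0) = kr"
    by (simp_all add: s_def prod_eq_iff)
  show thesis
  proof (rule that[of "wt l k0" "fst kr - fst kl" "snd kl - snd kr" s])
    show "g \<in> wfil l (wt l k0)"
      using hull(2) unfolding c_eq by (simp add: wfil_def)
    show "S = closed_segment (real_of_int (fst kr - fst kl), 0) (0, real_of_int (snd kl - snd kr))"
      unfolding Sab a b ..
    show "s \<le> k" if "k \<in> supp g" "wt l k = wt l k0" for k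
    proof -
      have "k \<in> E"
        using that by (simp add: E_def c_eq)
      then show ?thesis
        using kl(2) kr(2) by (simp add: s_def less_eq_prod_def)
    qed
    show "e = newton_polygon g \<inter> {x. linear_form l x = real_of_int (wt l k0)}"
      using hull(3) unfolding c_eq .
    show "wt l (s + (0, snd kl - snd kr)) = wt l k0" "s + (0, snd kl - snd kr) \<in> supp g"
      unfolding left_eq using wt_E[OF kl(1)] kl(1) by (simp_all add: E_def)
    show "wt l (s + (fst kr - fst kl, 0)) = wt l k0" "s + (fst kr - fst kl, 0) \<in> supp g"
      unfolding right_eq using wt_E[OF kr(1)] kr(1) by (simp_all add: E_def)
  qed (use fst_less snd_less in simp_all)
qed

lemma min_weight_segment:
  assumes "0 \<le> p" "0 \<le> q"
  shows "min_weight l (closed_segment (real_of_int p, 0) (0, real_of_int q)) =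
    ereal (real_of_int (min (int (fst l) * p) (int (snd l) * q)))"
  unfolding min_weight_def
proof (rule antisym)
  let ?S = "closed_segment (real_of_int p, 0 :: real) (0, real_of_int q)"
  let ?m = "real_of_int (min (int (fst l) * p) (int (snd l) * q))"
  have "(INF k\<in>?S. ereal (linear_form l k)) \<le> ereal (linear_form l (real_of_int p, 0))"
    "(INF k\<in>?S. ereal (linear_form l k)) \<le> ereal (linear_form l (0, real_of_int q))"
    by (intro INF_lower ends_in_segment)+
  then show "(INF k\<in>?S. ereal (linear_form l k)) \<le> ereal ?m"
    by (simp add: linear_form_def min_def)
  show "ereal ?m \<le> (INF k\<in>?S. ereal (linear_form l k))"
  proof (rule INF_greatest)
    fix k assume "k \<in> ?S"
    then obtain u where u: "0 \<le> u" "u \<le> 1" "k = (1 - u) *\<^sub>R (real_of_int p, 0) + u *\<^sub>R (0, real_of_int q)"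
      unfolding in_segment by blast
    have "?m = (1 - u) * ?m + u * ?m"
      by (simp add: algebra_simps)
    also have "\<dots> \<le> (1 - u) * real_of_int (int (fst l) * p) + u * real_of_int (int (snd l) * q)"
    proof (intro add_mono mult_left_mono)
      show "?m \<le> real_of_int (int (fst l) * p)" "?m \<le> real_of_int (int (snd l) * q)"
        by (simp_all only: of_int_le_iff min.cobounded1 min.cobounded2)
    qed (use u in simp_all)
    also have "\<dots> = linear_form l k"
      by (simp add: u(3) linear_form_def)
    finally show "ereal ?m \<le> ereal (linear_form l k)"
      by simp
  qed
qed

lemma min_weight_single: "min_weight l {real_point k} = ereal (real_of_int (wt l k))"
  by (simp add: min_weight_def linear_form_real_point)

lemma min_weight_ge_iff: "ereal (real_of_int v) \<le> min_weight l (support2 g) \<longleftrightarrow> g \<in> wfil l v"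
  by (auto simp: min_weight_def le_INF_iff support2_eq linear_form_real_point wfil_def)

section \<open>Germs and Laurent germs\<close>

lemma holomorphic2_on_subset: "holomorphic2_on F U \<Longrightarrow> V \<subseteq> U \<Longrightarrow> holomorphic2_on F V"
  by (auto simp: holomorphic2_on_def)

lemma holomorphic2_on_add:
  assumes "holomorphic2_on F U" "holomorphic2_on G U"
  shows "holomorphic2_on (\<lambda>z. F z + G z) U"
  unfolding holomorphic2_on_def
proof
  fix z assume z: "z \<in> U"
  obtain A B where F: "(F has_derivative (\<lambda>v. A * fst v + B * snd v)) (at z)"
    using assms(1) z unfolding holomorphic2_on_def by blast
  obtain A' B' where G: "(G has_derivative (\<lambda>v. A' * fst v + B' * snd v)) (at z)"
    using assms(2) z unfolding holomorphic2_on_def by blast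
  have "((\<lambda>z. F z + G z) has_derivative (\<lambda>v. (A + A') * fst v + (B + B') * snd v)) (at z)"
    using has_derivative_add[OF F G] by (simp add: algebra_simps)
  then show "\<exists>A B. ((\<lambda>z. F z + G z) has_derivative (\<lambda>v. A * fst v + B * snd v)) (at z)"
    by blast
qed

lemma holomorphic2_on_cmult:
  assumes "holomorphic2_on F U"
  shows "holomorphic2_on (\<lambda>z. c * F z) U"
  unfolding holomorphic2_on_def
proof
  fix z assume z: "z \<in> U"
  obtain A B where F: "(F has_derivative (\<lambda>v. A * fst v + B * snd v)) (at z)"
    using assms z unfolding holomorphic2_on_def by blast
  have "((\<lambda>z. c * F z) has_derivative (\<lambda>v. (c * A) * fst v + (c * B) * snd v)) (at z)"
    using has_derivative_mult_right[OF F, of c] by (simp add: algebra_simps)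
  then show "\<exists>A B. ((\<lambda>z. c * F z) has_derivative (\<lambda>v. A * fst v + B * snd v)) (at z)"
    by blast
qed

lemma holomorphic2_on_monomial: "holomorphic2_on (\<lambda>z. fst z ^ m * snd z ^ n) UNIV"
  unfolding holomorphic2_on_def
proof
  fix z :: "complex \<times> complex"
  have "((\<lambda>z. fst z ^ m * snd z ^ n) has_derivative
      (\<lambda>v. (of_nat m * fst z ^ (m - 1) * snd z ^ n) * fst v +
        (fst z ^ m * of_nat n * snd z ^ (n - 1)) * snd v)) (at z)"
    by (auto intro!: derivative_eq_intros simp: algebra_simps)
  then show "\<exists>A B. ((\<lambda>z. fst z ^ m * snd z ^ n) has_derivative (\<lambda>v. A * fst v + B * snd v)) (at z)"
    by blast
qed

definition expansion_on :: "complex fls fls \<Rightarrow> (complex \<times> complex \<Rightarrow> complex) \<Rightarrow> (complex \<times> complex) set \<Rightarrow> bool" where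
  "expansion_on g F U \<longleftrightarrow> (\<forall>x y. (x, y) \<in> U \<longrightarrow>
     ((\<lambda>(i, j). coeff2 g (int i, int j) * x ^ i * y ^ j) has_sum F (x, y)) UNIV)"

lemma hol_germs_iff: "g \<in> hol_germs \<longleftrightarrow> (\<forall>k\<in>supp g. 0 \<le> k) \<and>
    (\<exists>F U. open U \<and> (0, 0) \<in> U \<and> holomorphic2_on F U \<and> expansion_on g F U)"
  by (auto simp: hol_germs_def expansion_on_def supp_def less_eq_prod_def)

lemma hol_germs_add:
  assumes "g \<in> hol_germs" "h \<in> hol_germs"
  shows "g + h \<in> hol_germs"
proof -
  obtain F U where F: "open U" "(0, 0) \<in> U" "holomorphic2_on F U" "expansion_on g F U"
    using assms(1) by (auto simp: hol_germs_iff)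
  obtain G V where G: "open V" "(0, 0) \<in> V" "holomorphic2_on G V" "expansion_on h G V"
    using assms(2) by (auto simp: hol_germs_iff)
  have "expansion_on (g + h) (\<lambda>z. F z + G z) (U \<inter> V)"
    unfolding expansion_on_def
  proof (intro allI impI)
    fix x y assume xy: "(x, y) \<in> U \<inter> V"
    have "((\<lambda>ij. (case ij of (i, j) \<Rightarrow> coeff2 g (int i, int j) * x ^ i * y ^ j) +
        (case ij of (i, j) \<Rightarrow> coeff2 h (int i, int j) * x ^ i * y ^ j)) has_sum (F (x, y) + G (x, y))) UNIV"
      using xy F(4) G(4) by (intro has_sum_add) (auto simp: expansion_on_def)
    then show "((\<lambda>(i, j). coeff2 (g + h) (int i, int j) * x ^ i * y ^ j) has_sum (F (x, y) + G (x, y))) UNIV"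
      by (simp add: case_prod_unfold algebra_simps)
  qed
  moreover have "holomorphic2_on (\<lambda>z. F z + G z) (U \<inter> V)"
    using F(3) G(3) by (intro holomorphic2_on_add) (auto intro: holomorphic2_on_subset)
  moreover have "\<forall>k\<in>supp (g + h). 0 \<le> k"
    using assms supp_add[of g h] by (auto simp: hol_germs_iff)
  ultimately show ?thesis
    unfolding hol_germs_iff using F(1,2) G(1,2)
    by (intro conjI exI[of _ "\<lambda>z. F z + G z"] exI[of _ "U \<inter> V"]) auto
qed

lemma hol_germs_scale2:
  assumes "g \<in> hol_germs"
  shows "scale2 c g \<in> hol_germs"
proof -
  obtain F U where F: "open U" "(0, 0) \<in> U" "holomorphic2_on F U" "expansion_on g F U"
    using assms by (auto simp: hol_germs_iff)
  have "expansion_on (scale2 c g) (\<lambda>z. c * F z) U"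
    unfolding expansion_on_def
  proof (intro allI impI)
    fix x y assume xy: "(x, y) \<in> U"
    have "((\<lambda>ij. c * (case ij of (i, j) \<Rightarrow> coeff2 g (int i, int j) * x ^ i * y ^ j)) has_sum (c * F (x, y))) UNIV"
      using xy F(4) by (intro has_sum_cmult_right) (auto simp: expansion_on_def)
    then show "((\<lambda>(i, j). coeff2 (scale2 c g) (int i, int j) * x ^ i * y ^ j) has_sum (c * F (x, y))) UNIV"
      by (simp add: case_prod_unfold mult.assoc)
  qed
  moreover have "\<forall>k\<in>supp (scale2 c g). 0 \<le> k"
    using assms supp_scale2[of c g] by (auto simp: hol_germs_iff)
  ultimately show ?thesis
    unfolding hol_germs_iff using F(1,2) holomorphic2_on_cmult[OF F(3)]
    by (intro conjI exI[of _ "\<lambda>z. c * F z"] exI[of _ U])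
qed

lemma mono2_hol_germs:
  assumes "0 \<le> k"
  shows "mono2 k \<in> hol_germs"
proof -
  define a b where "a = nat (fst k)" and "b = nat (snd k)"
  have k: "k = (int a, int b)"
    using assms by (simp add: a_def b_def less_eq_prod_def)
  have "expansion_on (mono2 k) (\<lambda>z. fst z ^ a * snd z ^ b) UNIV"
    unfolding expansion_on_def
  proof (intro allI impI)
    fix x y :: complex
    show "((\<lambda>(i, j). coeff2 (mono2 k) (int i, int j) * x ^ i * y ^ j) has_sum
        (fst (x, y) ^ a * snd (x, y) ^ b)) UNIV"
      by (rule has_sum_finite_neutralI[of "{(a, b)}"]) (auto simp: coeff2_mono2 k split: if_splits)
  qed
  then show ?thesis
    unfolding hol_germs_iff using assms holomorphic2_on_monomial[of a b]
    by (intro conjI exI[of _ "\<lambda>z. fst z ^ a * snd z ^ b"] exI[of _ UNIV]) auto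
qed

lemma subspace_hol_germs: "scale2.subspace hol_germs"
proof (rule scale2.subspaceI)
  have "scale2 0 (mono2 0) \<in> hol_germs"
    by (intro hol_germs_scale2 mono2_hol_germs) simp
  then show "0 \<in> hol_germs"
    by simp
qed (simp_all add: hol_germs_add hol_germs_scale2)

lemma qpolys_hol_germs: "g \<in> qpolys \<Longrightarrow> g \<in> hol_germs"
  by (subst lpoly_expansion)
    (auto simp: qpolys_def intro!: scale2.subspace_sum[OF subspace_hol_germs] hol_germs_scale2 mono2_hol_germs)

lemma hol_germs_nonneg: "g \<in> hol_germs \<Longrightarrow> k \<in> supp g \<Longrightarrow> 0 \<le> k"
  by (simp add: hol_germs_iff)

lemma var_x_eq: "var_x = mono2 (1, 0)"
  by (simp add: var_x_def mono2_def fls_X_conv_shift_1)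

lemma var_y_eq: "var_y = mono2 (0, 1)"
  by (simp add: var_y_def mono2_def fls_X_conv_shift_1)

lemma mono2_power: "mono2 k ^ n = mono2 (int n * fst k, int n * snd k)"
proof (induction n)
  case 0
  show ?case
    using mono2_0 by (simp add: zero_prod_def)
next
  case (Suc n)
  then show ?case
    by (simp add: mono2_add[symmetric]) (simp add: plus_prod_def algebra_simps)
qed

lemma var_power: "var_x ^ N * var_y ^ N = mono2 (int N, int N)"
  by (simp add: var_x_eq var_y_eq mono2_power mono2_add[symmetric])

lemma lpolys_laurent_germs:
  assumes "g \<in> lpolys"
  shows "g \<in> laurent_germs"
proof -
  obtain k0 where k0: "\<forall>k\<in>supp g. k0 \<le> k"
    using lpolys_bdd_below[OF assms] by blast
  define N where "N = nat (max \<bar>fst k0\<bar> \<bar>snd k0\<bar>)"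
  have "0 \<le> (int N, int N) + k" if "k \<in> supp g" for k
    using k0 that by (force simp: N_def less_eq_prod_def)
  then have "mono2 (int N, int N) * g \<in> qpolys"
    using assms by (auto simp: qpolys_def supp_mono2_mult intro: lpolys_mult)
  then show ?thesis
    unfolding laurent_germs_def var_power using qpolys_hol_germs by blast
qed

lemma laurent_germs_bdd_below:
  assumes "g \<in> laurent_germs"
  obtains k0 where "\<And>k. k \<in> supp g \<Longrightarrow> k0 \<le> k"
proof -
  obtain N where N: "mono2 (int N, int N) * g \<in> hol_germs"
    using assms unfolding laurent_germs_def var_power by blast
  have "- (int N, int N) \<le> k" if "k \<in> supp g" for k
  proof -
    have "(int N, int N) + k \<in> supp (mono2 (int N, int N) * g)"
      using that by (simp add: supp_mono2_mult)
    then have "0 \<le> (int N, int N) + k"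
      by (rule hol_germs_nonneg[OF N])
    then show ?thesis
      by (auto simp: less_eq_prod_def)
  qed
  then show thesis
    by (rule that)
qed

section \<open>The filtration of germs and its comparison with polynomials\<close>

text \<open>Weights are integers: if no multiplier reaches \<open>v\<close>, all values are at most
  \<open>v - 1\<close>, and so is their supremum. Thus a finite bound is attained even when the
  supremum is infinite.\<close>

lemma order_fun_ge_iff:
  "ereal (real_of_int v) \<le> order_fun f l g \<longleftrightarrow> (\<exists>h\<in>laurent_germs. g + h * f \<in> wfil l v)"
proof
  assume "\<exists>h\<in>laurent_germs. g + h * f \<in> wfil l v"
  then obtain h where "h \<in> laurent_germs" "ereal (real_of_int v) \<le> min_weight l (support2 (g + h * f))"
    by (auto simp: min_weight_ge_iff)
  then show "ereal (real_of_int v) \<le> order_fun f l g"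
    unfolding order_fun_def by (rule SUP_upper2)
next
  assume v: "ereal (real_of_int v) \<le> order_fun f l g"
  show "\<exists>h\<in>laurent_germs. g + h * f \<in> wfil l v"
  proof (rule ccontr)
    assume none: "\<not> (\<exists>h\<in>laurent_germs. g + h * f \<in> wfil l v)"
    have "min_weight l (support2 (g + h * f)) \<le> ereal (real_of_int (v - 1))"
      if h: "h \<in> laurent_germs" for h
    proof -
      obtain k where k: "k \<in> supp (g + h * f)" "wt l k < v"
        using none h by (auto simp: wfil_def not_le)
      then have "min_weight l (support2 (g + h * f)) \<le> ereal (linear_form l (real_point k))"
        unfolding min_weight_def by (intro INF_lower) (auto simp: support2_eq)
      also have "\<dots> \<le> ereal (real_of_int (v - 1))"
        using k(2) unfolding linear_form_real_point by simp
      finally show ?thesis .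
    qed
    then have "order_fun f l g \<le> ereal (real_of_int (v - 1))"
      unfolding order_fun_def by (rule SUP_least)
    with v have "ereal (real_of_int v) \<le> ereal (real_of_int (v - 1))"
      by (rule order_trans)
    then show False
      by simp
  qed
qed

lemma filtration_iff:
  "g \<in> filtration f l v \<longleftrightarrow> g \<in> hol_germs \<and> (\<forall>i. \<exists>h\<in>laurent_germs. g + h * f \<in> wfil (l i) (v $ i))"
  by (simp add: filtration_def order_fun_ge_iff)

text \<open>\<open>f\<close> has nonnegative weight, so the terms of \<open>h\<close> of weight
  above \<open>w\<close> affect \<open>h * f\<close> only at weights at least \<open>w\<close>;
  finitely many terms remain.\<close>

lemma laurent_germs_truncate:
  assumes l: "0 < fst l" "0 < snd l" and f: "\<And>k. k \<in> supp f \<Longrightarrow> 0 \<le> k" and h: "h \<in> laurent_germs"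
  shows "\<exists>h'\<in>lpolys. (h - h') * f \<in> wfil l w"
proof -
  obtain k0 where k0: "\<And>k. k \<in> supp h \<Longrightarrow> k0 \<le> k"
    using laurent_germs_bdd_below[OF h] by blast
  define S where "S = {k. wt l k \<le> w}"
  have fin: "finite (S \<inter> supp h)"
    by (rule finite_subset[OF _ finite_wt_le[OF l, of k0 w]]) (use k0 in \<open>auto simp: S_def\<close>)
  have "h - restr S h \<in> wfil l w"
    unfolding wfil_def supp_diff_restr[OF fin] mem_Collect_eq by (auto simp: S_def)
  moreover have "f \<in> wfil l 0"
    using f by (auto simp: wfil_def intro: wt_nonneg)
  ultimately have "(h - restr S h) * f \<in> wfil l w"
    using wfil_mult[of "h - restr S h" l w f 0] by simp
  then show ?thesis
    using restr_in_lpolys[OF fin] by blast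
qed

context edge_data
begin

lemma laurent_ord_iff:
  "(\<exists>h\<in>laurent_germs. g + h * f \<in> wfil (l i) w) \<longleftrightarrow> (\<exists>h\<in>lpolys. g + h * f \<in> wfil (l i) w)"
proof
  assume "\<exists>h\<in>laurent_germs. g + h * f \<in> wfil (l i) w"
  then obtain h where h: "h \<in> laurent_germs" "g + h * f \<in> wfil (l i) w"
    by blast
  obtain h' where h': "h' \<in> lpolys" "(h - h') * f \<in> wfil (l i) w"
    using laurent_germs_truncate[OF fst_pos snd_pos supp_f h(1)] by blast
  have "(g + h * f) - (h - h') * f \<in> wfil (l i) w"
    using h(2) h'(2) by (rule wfil_diff)
  then have "g + h' * f \<in> wfil (l i) w"
    by (simp add: algebra_simps)
  then show "\<exists>h\<in>lpolys. g + h * f \<in> wfil (l i) w"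
    using h'(1) by blast
qed (use lpolys_laurent_germs in blast)

lemma filtration_alt:
  "g \<in> filtration f l v \<longleftrightarrow> g \<in> hol_germs \<and> (\<forall>i. \<exists>h\<in>lpolys. g + h * f \<in> wfil (l i) (v $ i))"
  by (simp add: filtration_iff laurent_ord_iff)

lemma subspace_filtration: "scale2.subspace (filtration f l v)"
proof (rule scale2.subspaceI)
  show "0 \<in> filtration f l v"
    unfolding filtration_alt using scale2.subspace_0[OF subspace_hol_germs]
    by (auto intro!: bexI[of _ 0])
next
  fix g g' assume g: "g \<in> filtration f l v" "g' \<in> filtration f l v"
  have "\<exists>h\<in>lpolys. g + g' + h * f \<in> wfil (l i) (v $ i)" for i
  proof -
    obtain h where h: "h \<in> lpolys" "g + h * f \<in> wfil (l i) (v $ i)"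
      using g(1) unfolding filtration_alt by blast
    obtain h' where h': "h' \<in> lpolys" "g' + h' * f \<in> wfil (l i) (v $ i)"
      using g(2) unfolding filtration_alt by blast
    have "(g + h * f) + (g' + h' * f) \<in> wfil (l i) (v $ i)"
      using h(2) h'(2) by (rule wfil_add)
    then have "g + g' + (h + h') * f \<in> wfil (l i) (v $ i)"
      by (simp add: algebra_simps)
    then show ?thesis
      using lpolys_add[OF h(1) h'(1)] by blast
  qed
  then show "g + g' \<in> filtration f l v"
    using g by (simp add: filtration_alt hol_germs_add)
next
  fix d g assume g: "g \<in> filtration f l v"
  have "\<exists>h\<in>lpolys. scale2 d g + h * f \<in> wfil (l i) (v $ i)" for i
  proof -
    obtain h where h: "h \<in> lpolys" "g + h * f \<in> wfil (l i) (v $ i)"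
      using g unfolding filtration_alt by blast
    have "scale2 d (g + h * f) \<in> wfil (l i) (v $ i)"
      using h(2) by (rule wfil_scale2)
    then have "scale2 d g + scale2 d h * f \<in> wfil (l i) (v $ i)"
      by (simp add: scale2.scale_right_distrib scale2_mult_left)
    then show ?thesis
      using lpolys_scale2[OF h(1)] by blast
  qed
  then show "scale2 d g \<in> filtration f l v"
    using g by (simp add: filtration_alt hol_germs_scale2)
qed

lemma jfil_eq_filtration: "jfil UNIV v = qpolys \<inter> filtration f l v"
  using qpolys_hol_germs qpolys_lpolys by (auto simp: jfil_def filtration_alt ord_ge_def)

lemma filtration_mono:
  assumes "\<And>i. v $ i \<le> w $ i"
  shows "filtration f l w \<subseteq> filtration f l v"
  using wfil_mono[OF assms] unfolding filtration_alt subset_iff by blast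

text \<open>Cutting a germ off at the finite set \<open>small (v + 1)\<close> leaves a remainder
  that meets every weight bound, and hence every order bound, for \<open>v + 1\<close>.\<close>

lemma filtration_decompose:
  "{a + b | a b. a \<in> jfil UNIV v \<and> b \<in> filtration f l (v + 1)} = filtration f l v"
proof (intro equalityI subsetI)
  have le: "filtration f l (v + 1) \<subseteq> filtration f l v"
    by (intro filtration_mono) simp
  fix g assume "g \<in> {a + b | a b. a \<in> jfil UNIV v \<and> b \<in> filtration f l (v + 1)}"
  then obtain a b where "a \<in> jfil UNIV v" "b \<in> filtration f l (v + 1)" "g = a + b"
    by blast
  then show "g \<in> filtration f l v"
    using le scale2.subspace_add[OF subspace_filtration[of v], of a b] by (auto simp: jfil_eq_filtration)
next
  have le: "filtration f l (v + 1) \<subseteq> filtration f l v"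
    by (intro filtration_mono) simp
  fix g assume g: "g \<in> filtration f l v"
  define a where "a = restr (small (v + 1)) g"
  have fin: "finite (small (v + 1) \<inter> supp g)"
    using finite_small by blast
  have "a \<in> lpolys" "supp a = small (v + 1) \<inter> supp g"
    unfolding a_def by (rule restr_in_lpolys[OF fin], rule supp_restr[OF fin])
  then have a_q: "a \<in> qpolys"
    by (simp add: qpolys_def small_def)
  have g_hol: "g \<in> hol_germs"
    using g by (simp add: filtration_alt)
  have rest: "g - a \<in> hol_germs"
    using g_hol qpolys_hol_germs[OF a_q] by (rule scale2.subspace_diff[OF subspace_hol_germs])
  have "g - a \<in> wfil (l i) ((v + 1) $ i)" for i
  proof -
    have "(v + 1) $ i \<le> wt (l i) k" if k: "k \<in> supp g - small (v + 1)" for k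
    proof -
      have "\<not> wt (l i) k < (v + 1) $ i"
        using hol_germs_nonneg[OF g_hol, of k] k unfolding small_def by blast
      then show ?thesis
        by (simp only: not_less)
    qed
    then show ?thesis
      by (simp only: a_def wfil_def mem_Collect_eq supp_diff_restr[OF fin]) blast
  qed
  then have b: "g - a \<in> filtration f l (v + 1)"
    unfolding filtration_alt using rest by (auto intro!: bexI[of _ 0])
  have "g - (g - a) \<in> filtration f l v"
    by (rule scale2.subspace_diff[OF subspace_filtration g subsetD[OF le b]])
  then have "a \<in> jfil UNIV v"
    using a_q by (simp add: jfil_eq_filtration)
  then show "g \<in> {a + b | a b. a \<in> jfil UNIV v \<and> b \<in> filtration f l (v + 1)}"
    using b by (intro CollectI exI[of _ a] exI[of _ "g - a"]) auto
qed

text \<open>By the second isomorphism theorem the quotient is the same for germs and polynomials,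
  and for polynomials it is a difference of codimensions.\<close>

lemma quotient_dim_filtration:
  "int (quotient_dim (filtration f l v) (filtration f l (v + 1))) = Hilb UNIV (v + 1) - Hilb UNIV v"
proof -
  have le: "filtration f l (v + 1) \<subseteq> filtration f l v"
    by (intro filtration_mono) simp
  then have inter: "jfil UNIV v \<inter> filtration f l (v + 1) = jfil UNIV (v + 1)"
    by (auto simp: jfil_eq_filtration)
  then have le': "jfil UNIV (v + 1) \<subseteq> jfil UNIV v"
    by blast
  define n where "n = quotient_dim (jfil UNIV v) (jfil UNIV (v + 1))"
  have n: "has_qdim (jfil UNIV v) (jfil UNIV (v + 1)) n"
    unfolding n_def by (rule has_qdim_cofinite[OF subspace_jfil subspace_jfil jfil_qpolys wfil_jfil])
  have "has_qdim qpolys (jfil UNIV (v + 1)) (hilb UNIV v + n)"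
    by (rule has_qdim_trans[OF subspace_qpolys subspace_jfil subspace_jfil le' jfil_qpolys has_qdim_hilb n])
  then have "hilb UNIV (v + 1) = hilb UNIV v + n"
    using has_qdim_unique[OF subspace_qpolys subspace_jfil has_qdim_hilb] by blast
  moreover have "has_qdim (filtration f l v) (filtration f l (v + 1)) n"
    using has_qdim_sum[OF subspace_jfil subspace_filtration, of UNIV v "v + 1" n] n
    unfolding inter filtration_decompose by blast
  then have "quotient_dim (filtration f l v) (filtration f l (v + 1)) = n"
    by (rule quotient_dim_eq[OF subspace_filtration subspace_filtration])
  ultimately show ?thesis
    by simp
qed

lemma poincare_series_eq:
  "poincare_series f l = series_div (Poly_Mapping.lookup (\<Prod>j\<in>UNIV. 1 - tpow (Mvec j)))
    ((1 - tpow xvec) * (1 - tpow yvec))"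
  unfolding poincare_series_def quotient_dim_filtration tprod_def[symmetric] by (rule poincare_Hilb)

lemma weight_vector_var_x: "weight_vector l (support2 var_x) = xvec"
  by (simp add: weight_vector_def xvec_def var_x_eq support2_eq min_weight_single vec_eq_iff wt_def)

lemma weight_vector_var_y: "weight_vector l (support2 var_y) = yvec"
  by (simp add: weight_vector_def yvec_def var_y_eq support2_eq min_weight_single vec_eq_iff wt_def)

lemma weight_vector_segment:
  "weight_vector l (closed_segment (real_of_int (p j), 0) (0, real_of_int (q j))) = Mvec j"
  using p_pos[of j] q_pos[of j]
  by (simp add: weight_vector_def Mvec_def M_def min_weight_segment vec_eq_iff del: of_int_min)

end

theorem theorem1:
  fixes f :: "complex fls fls"
    and \<gamma> \<Gamma> :: "'i::finite \<Rightarrow> (real \<times> real) set"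
    and l :: "'i \<Rightarrow> nat \<times> nat"
  assumes "f \<in> hol_germs" and "f \<noteq> 0" and "coeff2 f (0, 0) = 0"
    and "bij_betw \<gamma> UNIV (newton_edges f)"
    and "\<And>i. reduced_equation (\<gamma> i) (l i)"
    and "\<And>i. axis_translate (\<gamma> i) (\<Gamma> i)"
  shows "poincare_series f l =
    series_div (Poly_Mapping.lookup (\<Prod>i\<in>UNIV. 1 - tpow (weight_vector l (\<Gamma> i))))
      ((1 - tpow (weight_vector l (support2 var_x))) *
       (1 - tpow (weight_vector l (support2 var_y))))"
proof -
  note nonneg = hol_germs_nonneg[OF assms(1)]
  have edges: "\<gamma> i \<in> newton_edges f" for i
    using assms(4) by (auto simp: bij_betw_def)
  define P where "P i c s p q \<longleftrightarrow> f \<in> wfil (l i) c \<and> 0 < p \<and> 0 < q \<and>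
      wt (l i) (s + (0, q)) = c \<and> wt (l i) (s + (p, 0)) = c \<and>
      s + (0, q) \<in> supp f \<and> s + (p, 0) \<in> supp f \<and>
      (\<forall>k\<in>supp f. wt (l i) k = c \<longrightarrow> s \<le> k) \<and>
      \<Gamma> i = closed_segment (real_of_int p, 0) (0, real_of_int q) \<and>
      \<gamma> i = newton_polygon f \<inter> {x. linear_form (l i) x = real_of_int c}" for i c s p q
  have "\<exists>c s p q. P i c s p q" for i
  proof (rule edge_geometry[OF nonneg edges[of i] assms(5)[of i] assms(6)[of i]])
    fix c s p q
    assume "f \<in> wfil (l i) c" "0 < p" "0 < q"
      "wt (l i) (s + (0, q)) = c" "wt (l i) (s + (p, 0)) = c" "s + (0, q) \<in> supp f" "s + (p, 0) \<in> supp f"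
      "\<And>k. k \<in> supp f \<Longrightarrow> wt (l i) k = c \<Longrightarrow> s \<le> k"
      "\<Gamma> i = closed_segment (real_of_int p, 0) (0, real_of_int q)"
      "\<gamma> i = newton_polygon f \<inter> {x. linear_form (l i) x = real_of_int c}"
    then have "P i c s p q"
      unfolding P_def by (intro conjI ballI impI)
    then show "\<exists>c s p q. P i c s p q"
      by blast
  qed
  then obtain c s p q where P: "\<And>i. P i (c i) (s i) (p i) (q i)"
    by metis
  have l_pos: "0 < fst (l i)" "0 < snd (l i)" and l_cop: "coprime (fst (l i)) (snd (l i))" for i
    using assms(5)[of i] by (auto simp: reduced_equation_def)
  \<comment> \<open>The number \<open>c i\<close> is the least weight of \<open>f\<close>, so it
    depends on \<open>l i\<close> alone, and together they recover the edge. Hence distinct edges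
    have distinct reduced equations, and by coprimality nonproportional ones.\<close>
  have c_le: "c i \<le> c j" if "l i = l j" for i j
    using P[of i] P[of j] that wfilD[of f "l i" "c i" "s j + (0, q j)"] unfolding P_def by simp
  have l_inj: "i = j" if "l i = l j" for i j
  proof -
    have "c i = c j"
      using c_le[OF that] c_le[OF that[symmetric]] by simp
    then have "\<gamma> i = \<gamma> j"
      using P[of i] P[of j] that unfolding P_def by simp
    then show ?thesis
      using assms(4) by (auto simp: bij_betw_def inj_on_def)
  qed
  interpret edge_data l f c p q s
  proof
    fix i j :: 'i assume "i \<noteq> j"
    show "fst (l i) * snd (l j) \<noteq> fst (l j) * snd (l i)"
    proof
      assume "fst (l i) * snd (l j) = fst (l j) * snd (l i)"
      then have "fst (l i) = fst (l j)" "snd (l i) = snd (l j)"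
        using coprime_crossproduct_nat[of "fst (l i)" "snd (l i)" "fst (l j)" "snd (l j)"]
          l_cop[of i] l_cop[of j] by (auto simp: mult.commute coprime_commute)
      then show False
        using l_inj[of i j] \<open>i \<noteq> j\<close> by (simp add: prod_eq_iff)
    qed
  qed (use P l_pos nonneg in \<open>auto simp: P_def\<close>)
  have "weight_vector l (\<Gamma> i) = Mvec i" for i
    using P[of i] weight_vector_segment[of i] by (simp add: P_def)
  then show ?thesis
    by (simp add: poincare_series_eq weight_vector_var_x weight_vector_var_y)
qed

end
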